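(* Let $K$ be a small category, $\mathcal{V}$ a bicomplete closed symmetric monoidal category, and $\mathscr{C}$ a bicomplete closed $\mathcal{V}$-module. Then the three functors $$\otimes:\mathcal{V}^K\times\mathscr{C}^K\to\mathscr{C}^K,\qquad (M\otimes C)_k=M_k\otimes C_k,$$ $$(-)^{(-)}:(\mathcal{V}^K)^{op}\times\mathscr{C}^K\to\mathscr{C}^K,\qquad (X^M)_k=\mathrm{hom}_l(M\otimes h_k,X),$$ $$\mathrm{Hom}:(\mathscr{C}^K)^{op}\times\mathscr{C}^K\to\mathcal{V}^K,\qquad \mathrm{Hom}(X,Y)_k=\mathscr{C}^K(h_k\otimes X,Y),$$ define a closed $\mathcal{V}^K$-module structure on $\mathscr{C}^K$, where $\mathcal{V}^K$ is the closed symmetric monoidal category with objectwise monoidal product.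
   Context: All categories are locally small; for a category $\mathscr{A}$, $\mathscr{A}_0(x,y)$ denotes the set of morphisms from $x$ to $y$. $\mathcal{V}$ has monoidal product $\otimes$, unit $1$, and internal hom written exponentially: $\mathcal{V}_0(m\otimes n,p)\cong\mathcal{V}_0(m,p^n)$. A $\mathcal{V}$-module is a category $\mathscr{C}$ with an action $\otimes:\mathcal{V}\times\mathscr{C}\to\mathscr{C}$ that is associative and unital up to coherent natural isomorphism. It is closed if there are functors $\mathscr{C}(-,-):\mathscr{C}^{op}\times\mathscr{C}\to\mathcal{V}$ and $(-)^{(-)}:\mathcal{V}^{op}\times\mathscr{C}\to\mathscr{C}$, $(m,c)\mapsto c^m$, with natural isomorphisms $$\mathscr{C}_0(m\otimes c,d)\cong\mathcal{V}_0(m,\mathscr{C}(c,d))\cong\mathscr{C}_0(c,d^m),\qquad m\in\mathcal{V},\ c,d\in\mathscr{C}.$$ $\mathcal{V}^K$, $\mathscr{C}^K$ are the categories of (ordinary) functors from $K$. $\mathcal{V}^K$ with $(M\otimes N)_k=M_k\otimes N_k$ is a closed symmetric monoidal category. For $k\in K$, $h_k:K\to\mathcal{V}$ is the functor $h_k(l)=\coprod_{K_0(k,l)}1$. For $M\in\mathcal{V}^K$ and $X\in\mathscr{C}^K$, $\mathrm{hom}_l(M,X)=\int_{k\in K}X_k^{M_k}\in\mathscr{C}$ (an end). For $X,Y\in\mathscr{C}^K$, $\mathscr{C}^K(X,Y)=\int_{k\in K}\mathscr{C}(X_k,Y_k)\in\mathcal{V}$ (an end). The dependence of $(X^M)_k$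 and $\mathrm{Hom}(X,Y)_k$ on $k$ is through the contravariant functoriality of $k\mapsto h_k$. *)

theory Defs
  imports Main "HOL-Library.FuncSet"
begin

section \<open>Categories, functors, natural transformations\<close>

text \<open>Every arrow determines its domain and codomain. \<open>g \<cdot>\<^bsub>C\<^esub> f\<close> means ``first \<open>f\<close>, then \<open>g\<close>''.\<close>

record ('o, 'a) cat =
  Ob :: "'o set"
  Arr :: "'a set"
  Dom :: "'a \<Rightarrow> 'o"
  Cod :: "'a \<Rightarrow> 'o"
  Ide :: "'o \<Rightarrow> 'a"
  Comp :: "'a \<Rightarrow> 'a \<Rightarrow> 'a" (infixl "\<cdot>\<index>" 70)

definition hom :: "('o, 'a) cat \<Rightarrow> 'o \<Rightarrow> 'o \<Rightarrow> 'a set" where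
  "hom C x y = {f \<in> Arr C. Dom C f = x \<and> Cod C f = y}"

locale category =
  fixes C :: "('o, 'a) cat" (structure)
  assumes Dom_in: "f \<in> Arr C \<Longrightarrow> Dom C f \<in> Ob C"
    and Cod_in: "f \<in> Arr C \<Longrightarrow> Cod C f \<in> Ob C"
    and Ide_in: "x \<in> Ob C \<Longrightarrow> Ide C x \<in> hom C x x"
    and Comp_in: "\<lbrakk>f \<in> hom C x y; g \<in> hom C y z\<rbrakk> \<Longrightarrow> g \<cdot> f \<in> hom C x z"
    and Comp_assoc: "\<lbrakk>f \<in> hom C w x; g \<in> hom C x y; h \<in> hom C y z\<rbrakk>
      \<Longrightarrow> h \<cdot> (g \<cdot> f) = h \<cdot> g \<cdot> f"
    and Ide_left: "f \<in> hom C x y \<Longrightarrow> Ide C y \<cdot> f = f"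
    and Ide_right: "f \<in> hom C x y \<Longrightarrow> f \<cdot> Ide C x = f"

definition is_iso :: "('o, 'a) cat \<Rightarrow> 'o \<Rightarrow> 'o \<Rightarrow> 'a \<Rightarrow> bool" where
  "is_iso C x y f \<longleftrightarrow> f \<in> hom C x y \<and>
     (\<exists>g \<in> hom C y x. g \<cdot>\<^bsub>C\<^esub> f = Ide C x \<and> f \<cdot>\<^bsub>C\<^esub> g = Ide C y)"

definition op :: "('o, 'a) cat \<Rightarrow> ('o, 'a) cat" where
  "op C = \<lparr>Ob = Ob C, Arr = Arr C, Dom = Cod C, Cod = Dom C, Ide = Ide C,
           Comp = (\<lambda>g f. f \<cdot>\<^bsub>C\<^esub> g)\<rparr>"

definition prod_cat :: "('o, 'a) cat \<Rightarrow> ('p, 'b) cat \<Rightarrow> ('o \<times> 'p, 'a \<times> 'b) cat"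
  (infixr "\<times>\<^sub>C" 65) where
  "A \<times>\<^sub>C B = \<lparr>Ob = Ob A \<times> Ob B, Arr = Arr A \<times> Arr B,
     Dom = (\<lambda>(f, g). (Dom A f, Dom B g)), Cod = (\<lambda>(f, g). (Cod A f, Cod B g)),
     Ide = (\<lambda>(x, y). (Ide A x, Ide B y)),
     Comp = (\<lambda>(f', g') (f, g). (f' \<cdot>\<^bsub>A\<^esub> f, g' \<cdot>\<^bsub>B\<^esub> g))\<rparr>"

text \<open>Object map and arrow map.\<close>

record ('o, 'a, 'p, 'b) func =
  OM :: "'o \<Rightarrow> 'p"
  AM :: "'a \<Rightarrow> 'b"

locale Functor = A: category A + B: category B
  for A :: "('o, 'a) cat" and B :: "('p, 'b) cat" +
  fixes F :: "('o, 'a, 'p, 'b) func"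
  assumes OM_in: "x \<in> Ob A \<Longrightarrow> OM F x \<in> Ob B"
    and AM_in: "f \<in> hom A x y \<Longrightarrow> AM F f \<in> hom B (OM F x) (OM F y)"
    and AM_Ide: "x \<in> Ob A \<Longrightarrow> AM F (Ide A x) = Ide B (OM F x)"
    and AM_Comp: "\<lbrakk>f \<in> hom A x y; g \<in> hom A y z\<rbrakk>
      \<Longrightarrow> AM F (g \<cdot>\<^bsub>A\<^esub> f) = AM F g \<cdot>\<^bsub>B\<^esub> AM F f"

locale Nat_trans = F: Functor A B F + G: Functor A B G
  for A :: "('o, 'a) cat" and B :: "('p, 'b) cat" and F G +
  fixes \<tau> :: "'o \<Rightarrow> 'b"
  assumes component_in: "x \<in> Ob A \<Longrightarrow> \<tau> x \<in> hom B (OM F x) (OM G x)"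
    and natural: "f \<in> hom A x y \<Longrightarrow> \<tau> y \<cdot>\<^bsub>B\<^esub> AM F f = AM G f \<cdot>\<^bsub>B\<^esub> \<tau> x"

text \<open>
  The functor category \<open>C\<^sup>K\<close>. An arrow is a natural transformation together with its source and
  target. Functors and transformations are \<^const>\<open>undefined\<close> outside the carriers of \<open>K\<close>, so that
  two of them are equal in HOL iff they agree on \<open>K\<close>.
\<close>

record ('o, 'a, 'p, 'b) ntrans =
  src :: "('o, 'a, 'p, 'b) func"
  trg :: "('o, 'a, 'p, 'b) func"
  cmp :: "'o \<Rightarrow> 'b"

definition fun_cat :: "('o, 'a) cat \<Rightarrow> ('p, 'b) cat \<Rightarrow>
    (('o, 'a, 'p, 'b) func, ('o, 'a, 'p, 'b) ntrans) cat" where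
  "fun_cat K C =
    (let Fs = {F. Functor K C F \<and> OM F \<in> extensional (Ob K) \<and> AM F \<in> extensional (Arr K)} in
     \<lparr>Ob = Fs,
      Arr = {t. src t \<in> Fs \<and> trg t \<in> Fs \<and> Nat_trans K C (src t) (trg t) (cmp t)
                \<and> cmp t \<in> extensional (Ob K)},
      Dom = src, Cod = trg,
      Ide = (\<lambda>F. \<lparr>src = F, trg = F, cmp = (\<lambda>k\<in>Ob K. Ide C (OM F k))\<rparr>),
      Comp = (\<lambda>t s. \<lparr>src = src s, trg = trg t, cmp = (\<lambda>k\<in>Ob K. cmp t k \<cdot>\<^bsub>C\<^esub> cmp s k)\<rparr>)\<rparr>)"

text \<open>For \<open>T : A \<times> B \<rightarrow> D\<close>, the functor \<open>A\<^sup>K \<times> B\<^sup>K \<rightarrow> D\<^sup>K\<close>, \<open>(X, Y) \<mapsto> (k \<mapsto> T(X\<^sub>k, Y\<^sub>k))\<close>.\<close>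

definition pointwise_ob :: "('s, 't) cat \<Rightarrow> ('o \<times> 'p, 'a \<times> 'b, 'q, 'd) func \<Rightarrow>
    ('s, 't, 'o, 'a) func \<Rightarrow> ('s, 't, 'p, 'b) func \<Rightarrow> ('s, 't, 'q, 'd) func" where
  "pointwise_ob K T X Y =
     \<lparr>OM = (\<lambda>k\<in>Ob K. OM T (OM X k, OM Y k)), AM = (\<lambda>f\<in>Arr K. AM T (AM X f, AM Y f))\<rparr>"

definition pointwise :: "('s, 't) cat \<Rightarrow> ('o \<times> 'p, 'a \<times> 'b, 'q, 'd) func \<Rightarrow>
    (('s, 't, 'o, 'a) func \<times> ('s, 't, 'p, 'b) func,
     ('s, 't, 'o, 'a) ntrans \<times> ('s, 't, 'p, 'b) ntrans,
     ('s, 't, 'q, 'd) func, ('s, 't, 'q, 'd) ntrans) func" where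
  "pointwise K T =
     \<lparr>OM = (\<lambda>(X, Y). pointwise_ob K T X Y),
      AM = (\<lambda>(s, t). \<lparr>src = pointwise_ob K T (src s) (src t),
                     trg = pointwise_ob K T (trg s) (trg t),
                     cmp = (\<lambda>k\<in>Ob K. AM T (cmp s k, cmp t k))\<rparr>)\<rparr>"


section \<open>Limits, ends, copowers\<close>

definition is_cone :: "('s, 't) cat \<Rightarrow> ('o, 'a) cat \<Rightarrow> ('s, 't, 'o, 'a) func \<Rightarrow>
    'o \<Rightarrow> ('s \<Rightarrow> 'a) \<Rightarrow> bool" where
  "is_cone J C D x \<pi> \<longleftrightarrow> x \<in> Ob C \<and> (\<forall>j\<in>Ob J. \<pi> j \<in> hom C x (OM D j)) \<and>
     (\<forall>f\<in>Arr J. AM D f \<cdot>\<^bsub>C\<^esub> \<pi> (Dom J f) = \<pi> (Cod J f))"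

definition is_limit :: "('s, 't) cat \<Rightarrow> ('o, 'a) cat \<Rightarrow> ('s, 't, 'o, 'a) func \<Rightarrow>
    'o \<Rightarrow> ('s \<Rightarrow> 'a) \<Rightarrow> bool" where
  "is_limit J C D x \<pi> \<longleftrightarrow> is_cone J C D x \<pi> \<and>
     (\<forall>y \<rho>. is_cone J C D y \<rho> \<longrightarrow> (\<exists>!u. u \<in> hom C y x \<and> (\<forall>j\<in>Ob J. \<pi> j \<cdot>\<^bsub>C\<^esub> u = \<rho> j)))"

text \<open>
  Smallness is relative to a type \<open>'s\<close>: a category is small if its objects and arrows are elements
  of \<open>'s\<close>, and completeness refers to diagrams of such shapes. The argument of type
  \<open>'s itself\<close> only carries the type. For infinite \<open>'s\<close>, the shapes of ends over a small category
  are again small up to relabelling. In cocompleteness, a diagram \<open>J \<rightarrow> C\<close> is the same as a diagram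
  \<open>J\<^sup>o\<^sup>p \<rightarrow> C\<^sup>o\<^sup>p\<close>, with the same object and arrow maps.
\<close>

definition complete :: "'s itself \<Rightarrow> ('o, 'a) cat \<Rightarrow> bool" where
  "complete S C \<longleftrightarrow> (\<forall>(J :: ('s, 's) cat) D. Functor J C D \<longrightarrow> (\<exists>x \<pi>. is_limit J C D x \<pi>))"

definition cocomplete :: "'s itself \<Rightarrow> ('o, 'a) cat \<Rightarrow> bool" where
  "cocomplete S C \<longleftrightarrow>
     (\<forall>(J :: ('s, 's) cat) D. Functor J C D \<longrightarrow> (\<exists>x \<iota>. is_limit (op J) (op C) D x \<iota>))"

definition bicomplete :: "'s itself \<Rightarrow> ('o, 'a) cat \<Rightarrow> bool" where
  "bicomplete S C \<longleftrightarrow> complete S C \<and> cocomplete S C"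

text \<open>Ends of functors \<open>F : K\<^sup>o\<^sup>p \<times> K \<rightarrow> D\<close>.\<close>

definition is_wedge :: "('s, 't) cat \<Rightarrow> ('o, 'a) cat \<Rightarrow> ('s \<times> 's, 't \<times> 't, 'o, 'a) func \<Rightarrow>
    'o \<Rightarrow> ('s \<Rightarrow> 'a) \<Rightarrow> bool" where
  "is_wedge K D F x \<pi> \<longleftrightarrow> x \<in> Ob D \<and> (\<forall>k\<in>Ob K. \<pi> k \<in> hom D x (OM F (k, k))) \<and>
     (\<forall>k l. \<forall>f\<in>hom K k l. AM F (Ide K k, f) \<cdot>\<^bsub>D\<^esub> \<pi> k = AM F (f, Ide K l) \<cdot>\<^bsub>D\<^esub> \<pi> l)"

definition is_end :: "('s, 't) cat \<Rightarrow> ('o, 'a) cat \<Rightarrow> ('s \<times> 's, 't \<times> 't, 'o, 'a) func \<Rightarrow>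
    'o \<Rightarrow> ('s \<Rightarrow> 'a) \<Rightarrow> bool" where
  "is_end K D F x \<pi> \<longleftrightarrow> is_wedge K D F x \<pi> \<and>
     (\<forall>y \<rho>. is_wedge K D F y \<rho> \<longrightarrow> (\<exists>!u. u \<in> hom D y x \<and> (\<forall>k\<in>Ob K. \<pi> k \<cdot>\<^bsub>D\<^esub> u = \<rho> k)))"

text \<open>Ends are determined only up to unique isomorphism; fix a choice for every \<open>F\<close>.\<close>

definition the_end :: "('s, 't) cat \<Rightarrow> ('o, 'a) cat \<Rightarrow> ('s \<times> 's, 't \<times> 't, 'o, 'a) func \<Rightarrow>
    'o \<times> ('s \<Rightarrow> 'a)" where
  "the_end K D F = (SOME (x, \<pi>). is_end K D F x \<pi>)"

definition end_ob where "end_ob K D F = fst (the_end K D F)"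
definition end_pr where "end_pr K D F = snd (the_end K D F)"

text \<open>The arrow \<open>\<integral>\<^sub>k F(k,k) \<rightarrow> \<integral>\<^sub>k G(k,k)\<close> induced by \<open>\<theta>\<^sub>k : F(k,k) \<rightarrow> G(k,k)\<close>.\<close>

definition end_map :: "('s, 't) cat \<Rightarrow> ('o, 'a) cat \<Rightarrow> ('s \<times> 's, 't \<times> 't, 'o, 'a) func \<Rightarrow>
    ('s \<times> 's, 't \<times> 't, 'o, 'a) func \<Rightarrow> ('s \<Rightarrow> 'a) \<Rightarrow> 'a" where
  "end_map K D F G \<theta> = (THE u. u \<in> hom D (end_ob K D F) (end_ob K D G) \<and>
     (\<forall>k\<in>Ob K. end_pr K D G k \<cdot>\<^bsub>D\<^esub> u = \<theta> k \<cdot>\<^bsub>D\<^esub> end_pr K D F k))"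

text \<open>
  For \<open>T : A\<^sup>o\<^sup>p \<times> B \<rightarrow> D\<close>, the functor \<open>(A\<^sup>K)\<^sup>o\<^sup>p \<times> B\<^sup>K \<rightarrow> D\<close>, \<open>(X, Y) \<mapsto> \<integral>\<^sub>k T(X\<^sub>k, Y\<^sub>k)\<close>.
\<close>

definition bifun :: "('o \<times> 'p, 'a \<times> 'b, 'q, 'd) func \<Rightarrow> ('s, 't, 'o, 'a) func \<Rightarrow>
    ('s, 't, 'p, 'b) func \<Rightarrow> ('s \<times> 's, 't \<times> 't, 'q, 'd) func" where
  "bifun T X Y = \<lparr>OM = (\<lambda>(k, l). OM T (OM X k, OM Y l)), AM = (\<lambda>(f, g). AM T (AM X f, AM Y g))\<rparr>"

definition end_functor :: "('s, 't) cat \<Rightarrow> ('q, 'd) cat \<Rightarrow> ('o \<times> 'p, 'a \<times> 'b, 'q, 'd) func \<Rightarrow>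
    (('s, 't, 'o, 'a) func \<times> ('s, 't, 'p, 'b) func,
     ('s, 't, 'o, 'a) ntrans \<times> ('s, 't, 'p, 'b) ntrans, 'q, 'd) func" where
  "end_functor K D T =
     \<lparr>OM = (\<lambda>(X, Y). end_ob K D (bifun T X Y)),
      AM = (\<lambda>(s, t). end_map K D (bifun T (trg s) (src t)) (bifun T (src s) (trg t))
                        (\<lambda>k. AM T (cmp s k, cmp t k)))\<rparr>"

text \<open>The copower \<open>\<Coprod>\<^bsub>i\<in>I\<^esub> x\<close>, again with a fixed choice.\<close>

definition is_copower :: "('o, 'a) cat \<Rightarrow> 'i set \<Rightarrow> 'o \<Rightarrow> 'o \<Rightarrow> ('i \<Rightarrow> 'a) \<Rightarrow> bool" where
  "is_copower C I x y \<iota> \<longleftrightarrow> y \<in> Ob C \<and> (\<forall>i\<in>I. \<iota> i \<in> hom C x y) \<and>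
     (\<forall>z \<kappa>. z \<in> Ob C \<and> (\<forall>i\<in>I. \<kappa> i \<in> hom C x z)
        \<longrightarrow> (\<exists>!u. u \<in> hom C y z \<and> (\<forall>i\<in>I. u \<cdot>\<^bsub>C\<^esub> \<iota> i = \<kappa> i)))"

definition the_copower :: "('o, 'a) cat \<Rightarrow> 'i set \<Rightarrow> 'o \<Rightarrow> 'o \<times> ('i \<Rightarrow> 'a)" where
  "the_copower C I x = (SOME (y, \<iota>). is_copower C I x y \<iota>)"

definition copower_ob where "copower_ob C I x = fst (the_copower C I x)"
definition copower_in where "copower_in C I x = snd (the_copower C I x)"

text \<open>The arrow \<open>\<Coprod>\<^bsub>i\<in>I\<^esub> x \<rightarrow> \<Coprod>\<^bsub>j\<in>J\<^esub> x\<close> induced by a map \<open>r : I \<rightarrow> J\<close> of index sets.\<close>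

definition copower_map :: "('o, 'a) cat \<Rightarrow> 'o \<Rightarrow> 'i set \<Rightarrow> 'i set \<Rightarrow> ('i \<Rightarrow> 'i) \<Rightarrow> 'a" where
  "copower_map C x I J r = (THE u. u \<in> hom C (copower_ob C I x) (copower_ob C J x) \<and>
     (\<forall>i\<in>I. u \<cdot>\<^bsub>C\<^esub> copower_in C I x i = copower_in C J x (r i)))"


section \<open>Closed symmetric monoidal categories\<close>

text \<open>
  Components: \<open>assoc a b c : (a \<otimes> b) \<otimes> c \<rightarrow> a \<otimes> (b \<otimes> c)\<close>, \<open>lunit a : 1 \<otimes> a \<rightarrow> a\<close>,
  \<open>runit a : a \<otimes> 1 \<rightarrow> a\<close>, \<open>braid a b : a \<otimes> b \<rightarrow> b \<otimes> a\<close>.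
\<close>

record ('o, 'a) monoidal =
  mcat :: "('o, 'a) cat"
  tens :: "('o \<times> 'o, 'a \<times> 'a, 'o, 'a) func"
  unit_ob :: "'o"
  assoc :: "'o \<Rightarrow> 'o \<Rightarrow> 'o \<Rightarrow> 'a"
  lunit :: "'o \<Rightarrow> 'a"
  runit :: "'o \<Rightarrow> 'a"
  braid :: "'o \<Rightarrow> 'o \<Rightarrow> 'a"

locale monoidal_syntax =
  fixes V :: "('o, 'a) monoidal"
begin

abbreviation tensor_ob (infixr "\<otimes>" 75) where "a \<otimes> b \<equiv> OM (tens V) (a, b)"
abbreviation tensor_arr (infixr "\<otimes>\<^sub>a" 75) where "f \<otimes>\<^sub>a g \<equiv> AM (tens V) (f, g)"
abbreviation comp_V (infixl "\<bullet>" 70) where "g \<bullet> f \<equiv> g \<cdot>\<^bsub>mcat V\<^esub> f"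
abbreviation ObV where "ObV \<equiv> Ob (mcat V)"
abbreviation homV where "homV \<equiv> hom (mcat V)"
abbreviation idV where "idV \<equiv> Ide (mcat V)"
abbreviation I where "I \<equiv> unit_ob V"

end

locale symmetric_monoidal = monoidal_syntax V +
  tens: Functor "mcat V \<times>\<^sub>C mcat V" "mcat V" "tens V" + category "mcat V"
  for V :: "('o, 'a) monoidal" +
  assumes unit_in: "I \<in> ObV"
    and assoc_iso: "\<lbrakk>a \<in> ObV; b \<in> ObV; c \<in> ObV\<rbrakk> \<Longrightarrow>
      is_iso (mcat V) ((a \<otimes> b) \<otimes> c) (a \<otimes> (b \<otimes> c)) (assoc V a b c)"
    and assoc_natural: "\<lbrakk>f \<in> homV a a'; g \<in> homV b b'; h \<in> homV c c'\<rbrakk> \<Longrightarrow>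
      assoc V a' b' c' \<bullet> ((f \<otimes>\<^sub>a g) \<otimes>\<^sub>a h) = (f \<otimes>\<^sub>a (g \<otimes>\<^sub>a h)) \<bullet> assoc V a b c"
    and lunit_iso: "a \<in> ObV \<Longrightarrow> is_iso (mcat V) (I \<otimes> a) a (lunit V a)"
    and lunit_natural: "f \<in> homV a b \<Longrightarrow> lunit V b \<bullet> (idV I \<otimes>\<^sub>a f) = f \<bullet> lunit V a"
    and runit_iso: "a \<in> ObV \<Longrightarrow> is_iso (mcat V) (a \<otimes> I) a (runit V a)"
    and runit_natural: "f \<in> homV a b \<Longrightarrow> runit V b \<bullet> (f \<otimes>\<^sub>a idV I) = f \<bullet> runit V a"
    and braid_iso: "\<lbrakk>a \<in> ObV; b \<in> ObV\<rbrakk> \<Longrightarrow> is_iso (mcat V) (a \<otimes> b) (b \<otimes> a) (braid V a b)"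
    and braid_natural: "\<lbrakk>f \<in> homV a a'; g \<in> homV b b'\<rbrakk> \<Longrightarrow>
      braid V a' b' \<bullet> (f \<otimes>\<^sub>a g) = (g \<otimes>\<^sub>a f) \<bullet> braid V a b"
    and pentagon: "\<lbrakk>a \<in> ObV; b \<in> ObV; c \<in> ObV; d \<in> ObV\<rbrakk> \<Longrightarrow>
      assoc V a b (c \<otimes> d) \<bullet> assoc V (a \<otimes> b) c d =
      (idV a \<otimes>\<^sub>a assoc V b c d) \<bullet> assoc V a (b \<otimes> c) d \<bullet> (assoc V a b c \<otimes>\<^sub>a idV d)"
    and triangle: "\<lbrakk>a \<in> ObV; b \<in> ObV\<rbrakk> \<Longrightarrow>
      (idV a \<otimes>\<^sub>a lunit V b) \<bullet> assoc V a I b = runit V a \<otimes>\<^sub>a idV b"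
    and hexagon: "\<lbrakk>a \<in> ObV; b \<in> ObV; c \<in> ObV\<rbrakk> \<Longrightarrow>
      assoc V b c a \<bullet> braid V a (b \<otimes> c) \<bullet> assoc V a b c =
      (idV b \<otimes>\<^sub>a braid V a c) \<bullet> assoc V b a c \<bullet> (braid V a b \<otimes>\<^sub>a idV c)"
    and symmetry: "\<lbrakk>a \<in> ObV; b \<in> ObV\<rbrakk> \<Longrightarrow> braid V b a \<bullet> braid V a b = idV (a \<otimes> b)"

text \<open>
  For \<open>T : V \<times> C \<rightarrow> C\<close>, \<open>H : C\<^sup>o\<^sup>p \<times> C \<rightarrow> V\<close> and \<open>P : V\<^sup>o\<^sup>p \<times> C \<rightarrow> C\<close>, a natural isomorphism of
  functors \<open>V\<^sup>o\<^sup>p \<times> C\<^sup>o\<^sup>p \<times> C \<rightarrow> Set\<close>: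
  \<open>C(T(m,c), d) \<cong> V(m, H(c,d))\<close>, respectively \<open>V(m, H(c,d)) \<cong> C(c, P(m,d))\<close>.
\<close>

definition natural_bij_TH where
  "natural_bij_TH V C T H \<phi> \<longleftrightarrow>
     (\<forall>m\<in>Ob V. \<forall>c\<in>Ob C. \<forall>d\<in>Ob C.
        bij_betw (\<phi> m c d) (hom C (OM T (m, c)) d) (hom V m (OM H (c, d)))) \<and>
     (\<forall>m m' c c' d d' f g h u.
        f \<in> hom V m' m \<and> g \<in> hom C c' c \<and> h \<in> hom C d d' \<and> u \<in> hom C (OM T (m, c)) d \<longrightarrow>
        \<phi> m' c' d' (h \<cdot>\<^bsub>C\<^esub> u \<cdot>\<^bsub>C\<^esub> AM T (f, g)) = AM H (g, h) \<cdot>\<^bsub>V\<^esub> \<phi> m c d u \<cdot>\<^bsub>V\<^esub> f)"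

definition natural_bij_HP where
  "natural_bij_HP V C H P \<psi> \<longleftrightarrow>
     (\<forall>m\<in>Ob V. \<forall>c\<in>Ob C. \<forall>d\<in>Ob C.
        bij_betw (\<psi> m c d) (hom V m (OM H (c, d))) (hom C c (OM P (m, d)))) \<and>
     (\<forall>m m' c c' d d' f g h v.
        f \<in> hom V m' m \<and> g \<in> hom C c' c \<and> h \<in> hom C d d' \<and> v \<in> hom V m (OM H (c, d)) \<longrightarrow>
        \<psi> m' c' d' (AM H (g, h) \<cdot>\<^bsub>V\<^esub> v \<cdot>\<^bsub>V\<^esub> f) = AM P (f, h) \<cdot>\<^bsub>C\<^esub> \<psi> m c d v \<cdot>\<^bsub>C\<^esub> g)"

locale closed_symmetric_monoidal = symmetric_monoidal V for V :: "('o, 'a) monoidal" +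
  assumes closed: "\<exists>H \<phi>. Functor (op (mcat V) \<times>\<^sub>C mcat V) (mcat V) H \<and>
    natural_bij_TH (mcat V) (mcat V) (tens V) H \<phi>"


section \<open>Closed modules\<close>

text \<open>
  \<open>act\<close> is the action, with \<open>\<alpha> m n c : (m \<otimes> n) \<otimes> c \<rightarrow> m \<otimes> (n \<otimes> c)\<close> and \<open>\<lambda>\<^sub>c : 1 \<otimes> c \<rightarrow> c\<close> its
  coherence isomorphisms (\<open>l c\<close> below). The remaining unit axiom
  \<open>\<lambda>\<^bsub>m \<otimes> c\<^esub> \<circ> \<alpha> 1 m c = \<lambda>\<^sub>m \<otimes> c\<close> follows from the two stated.
\<close>

locale module_cat = symmetric_monoidal V + C: category C +
  act: Functor "mcat V \<times>\<^sub>C C" C act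
  for V :: "('o, 'a) monoidal" and C :: "('p, 'b) cat"
    and act :: "('o \<times> 'p, 'a \<times> 'b, 'p, 'b) func" +
  fixes \<alpha> :: "'o \<Rightarrow> 'o \<Rightarrow> 'p \<Rightarrow> 'b" and l :: "'p \<Rightarrow> 'b"
  assumes \<alpha>_iso: "\<lbrakk>m \<in> ObV; n \<in> ObV; c \<in> Ob C\<rbrakk> \<Longrightarrow>
      is_iso C (OM act (m \<otimes> n, c)) (OM act (m, OM act (n, c))) (\<alpha> m n c)"
    and \<alpha>_natural: "\<lbrakk>f \<in> homV m m'; g \<in> homV n n'; h \<in> hom C c c'\<rbrakk> \<Longrightarrow>
      \<alpha> m' n' c' \<cdot>\<^bsub>C\<^esub> AM act (f \<otimes>\<^sub>a g, h) = AM act (f, AM act (g, h)) \<cdot>\<^bsub>C\<^esub> \<alpha> m n c"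
    and l_iso: "c \<in> Ob C \<Longrightarrow> is_iso C (OM act (I, c)) c (l c)"
    and l_natural: "h \<in> hom C c d \<Longrightarrow> l d \<cdot>\<^bsub>C\<^esub> AM act (idV I, h) = h \<cdot>\<^bsub>C\<^esub> l c"
    and module_pentagon: "\<lbrakk>m \<in> ObV; n \<in> ObV; p \<in> ObV; c \<in> Ob C\<rbrakk> \<Longrightarrow>
      \<alpha> m n (OM act (p, c)) \<cdot>\<^bsub>C\<^esub> \<alpha> (m \<otimes> n) p c =
      AM act (idV m, \<alpha> n p c) \<cdot>\<^bsub>C\<^esub> \<alpha> m (n \<otimes> p) c \<cdot>\<^bsub>C\<^esub> AM act (assoc V m n p, Ide C c)"
    and module_triangle: "\<lbrakk>m \<in> ObV; c \<in> Ob C\<rbrakk> \<Longrightarrow>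
      AM act (idV m, l c) \<cdot>\<^bsub>C\<^esub> \<alpha> m I c = AM act (runit V m, Ide C c)"

text \<open>\<open>cot\<close> is \<open>(m, c) \<mapsto> c\<^sup>m\<close> and \<open>en\<close> is the \<open>V\<close>-valued hom functor of \<open>C\<close>.\<close>

locale closed_module = module_cat V C act \<alpha> l +
  cot: Functor "op (mcat V) \<times>\<^sub>C C" C cot +
  en: Functor "op C \<times>\<^sub>C C" "mcat V" en
  for V :: "('o, 'a) monoidal" and C :: "('p, 'b) cat" and act \<alpha> l
    and cot :: "('o \<times> 'p, 'a \<times> 'b, 'p, 'b) func"
    and en :: "('p \<times> 'p, 'b \<times> 'b, 'o, 'a) func" +
  assumes adjunctions: "\<exists>\<phi> \<psi>. natural_bij_TH (mcat V) C act en \<phi> \<and>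
    natural_bij_HP (mcat V) C en cot \<psi>"


section \<open>The structures on functor categories\<close>

text \<open>\<open>V\<^sup>K\<close> with the objectwise product and objectwise coherence isomorphisms.\<close>

definition fun_monoidal :: "('s, 't) cat \<Rightarrow> ('o, 'a) monoidal \<Rightarrow>
    (('s, 't, 'o, 'a) func, ('s, 't, 'o, 'a) ntrans) monoidal" where
  "fun_monoidal K V =
    (let T = pointwise K (tens V); t = (\<lambda>M N. OM T (M, N));
         u = \<lparr>OM = (\<lambda>k\<in>Ob K. unit_ob V), AM = (\<lambda>f\<in>Arr K. Ide (mcat V) (unit_ob V))\<rparr> in
     \<lparr>mcat = fun_cat K (mcat V),
      tens = T,
      unit_ob = u,
      assoc = (\<lambda>M N P. \<lparr>src = t (t M N) P, trg = t M (t N P),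
                        cmp = (\<lambda>k\<in>Ob K. assoc V (OM M k) (OM N k) (OM P k))\<rparr>),
      lunit = (\<lambda>M. \<lparr>src = t u M, trg = M, cmp = (\<lambda>k\<in>Ob K. lunit V (OM M k))\<rparr>),
      runit = (\<lambda>M. \<lparr>src = t M u, trg = M, cmp = (\<lambda>k\<in>Ob K. runit V (OM M k))\<rparr>),
      braid = (\<lambda>M N. \<lparr>src = t M N, trg = t N M,
                      cmp = (\<lambda>k\<in>Ob K. braid V (OM M k) (OM N k))\<rparr>)\<rparr>)"

text \<open>The functor \<open>h : K\<^sup>o\<^sup>p \<rightarrow> V\<^sup>K\<close>, \<open>h\<^sub>k(l) = \<Coprod>\<^bsub>K(k,l)\<^esub> 1\<close>.\<close>

definition h_ob :: "('s, 't) cat \<Rightarrow> ('o, 'a) monoidal \<Rightarrow> 's \<Rightarrow> ('s, 't, 'o, 'a) func" where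
  "h_ob K V k =
     \<lparr>OM = (\<lambda>l\<in>Ob K. copower_ob (mcat V) (hom K k l) (unit_ob V)),
      AM = (\<lambda>g\<in>Arr K. copower_map (mcat V) (unit_ob V) (hom K k (Dom K g)) (hom K k (Cod K g))
                        (\<lambda>f. g \<cdot>\<^bsub>K\<^esub> f))\<rparr>"

definition h_functor :: "('s, 't) cat \<Rightarrow> ('o, 'a) monoidal \<Rightarrow>
    ('s, 't, ('s, 't, 'o, 'a) func, ('s, 't, 'o, 'a) ntrans) func" where
  "h_functor K V =
     \<lparr>OM = h_ob K V,
      AM = (\<lambda>e. \<lparr>src = h_ob K V (Cod K e), trg = h_ob K V (Dom K e),
                 cmp = (\<lambda>l\<in>Ob K. copower_map (mcat V) (unit_ob V)
                          (hom K (Cod K e) l) (hom K (Dom K e) l) (\<lambda>f. f \<cdot>\<^bsub>K\<^esub> e))\<rparr>)\<rparr>"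

text \<open>The objectwise action \<open>V\<^sup>K \<times> C\<^sup>K \<rightarrow> C\<^sup>K\<close> is \<^term>\<open>pointwise K act\<close>; its coherence isomorphisms:\<close>

definition fun_\<alpha> where
  "fun_\<alpha> K V act \<alpha> M N X =
     \<lparr>src = pointwise_ob K act (pointwise_ob K (tens V) M N) X,
      trg = pointwise_ob K act M (pointwise_ob K act N X),
      cmp = (\<lambda>k\<in>Ob K. \<alpha> (OM M k) (OM N k) (OM X k))\<rparr>"

definition fun_l where
  "fun_l K V act l X =
     \<lparr>src = pointwise_ob K act (unit_ob (fun_monoidal K V)) X, trg = X,
      cmp = (\<lambda>k\<in>Ob K. l (OM X k))\<rparr>"

text \<open>\<open>hom\<^sub>l(M, X) = \<integral>\<^sub>k X\<^sub>k\<^bsup>M\<^sub>k\<^esup>\<close> and \<open>C\<^sup>K(X, Y) = \<integral>\<^sub>k C(X\<^sub>k, Y\<^sub>k)\<close>.\<close>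

abbreviation hom_l where "hom_l K C cot \<equiv> end_functor K C cot"
abbreviation enriched_hom where "enriched_hom K V en \<equiv> end_functor K (mcat V) en"

text \<open>\<open>(X\<^sup>M)\<^sub>k = hom\<^sub>l(M \<otimes> h\<^sub>k, X)\<close>, functorial in \<open>k\<close> by contravariance of \<open>h\<close>.\<close>

definition fun_cot_ob where
  "fun_cot_ob K V C cot M X =
    (let VK = fun_monoidal K V; CK = fun_cat K C; h = h_functor K V in
     \<lparr>OM = (\<lambda>k\<in>Ob K. OM (hom_l K C cot) (OM (tens VK) (M, OM h k), X)),
      AM = (\<lambda>f\<in>Arr K. AM (hom_l K C cot)
              (AM (tens VK) (Ide (mcat VK) M, AM h f), Ide CK X))\<rparr>)"

definition fun_cot where
  "fun_cot K V C cot =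
    (let VK = fun_monoidal K V; h = h_functor K V in
     \<lparr>OM = (\<lambda>(M, X). fun_cot_ob K V C cot M X),
      AM = (\<lambda>(s, t). \<lparr>src = fun_cot_ob K V C cot (trg s) (src t),
                     trg = fun_cot_ob K V C cot (src s) (trg t),
                     cmp = (\<lambda>k\<in>Ob K. AM (hom_l K C cot)
                              (AM (tens VK) (s, Ide (mcat VK) (OM h k)), t))\<rparr>)\<rparr>)"

text \<open>\<open>Hom(X, Y)\<^sub>k = C\<^sup>K(h\<^sub>k \<otimes> X, Y)\<close>, functorial in \<open>k\<close> by contravariance of \<open>h\<close>.\<close>

definition fun_Hom_ob where
  "fun_Hom_ob K V C act en X Y =
    (let CK = fun_cat K C; actK = pointwise K act; h = h_functor K V in
     \<lparr>OM = (\<lambda>k\<in>Ob K. OM (enriched_hom K V en) (OM actK (OM h k, X), Y)),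
      AM = (\<lambda>f\<in>Arr K. AM (enriched_hom K V en) (AM actK (AM h f, Ide CK X), Ide CK Y))\<rparr>)"

definition fun_Hom where
  "fun_Hom K V C act en =
    (let VK = fun_monoidal K V; actK = pointwise K act; h = h_functor K V in
     \<lparr>OM = (\<lambda>(X, Y). fun_Hom_ob K V C act en X Y),
      AM = (\<lambda>(s, t). \<lparr>src = fun_Hom_ob K V C act en (trg s) (src t),
                     trg = fun_Hom_ob K V C act en (src s) (trg t),
                     cmp = (\<lambda>k\<in>Ob K. AM (enriched_hom K V en)
                              (AM actK (Ide (mcat VK) (OM h k), s), t))\<rparr>)\<rparr>)"

end

theory Submission
  imports Defs
begin

text \<open>
  The action of \<open>V\<^sup>K\<close> on \<open>C\<^sup>K\<close>, like the tensor product of \<open>V\<^sup>K\<close>, inherits all its coherence objectwise.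
  The substance of the theorem lies in the three right adjoints: the internal hom of \<open>V\<^sup>K\<close>, the functor
  \<open>Hom\<close> and the cotensor \<open>X\<^sup>M\<close>. All are cases of one construction.

  Let \<open>T : A \<times> B \<rightarrow> D\<close> and \<open>R : B\<^sup>o\<^sup>p \<times> D \<rightarrow> A\<close> with \<open>D(T(a,b), d) \<cong> A(a, R(b,d))\<close>. For a diagram \<open>X\<close> in \<open>B\<close>
  let \<open>S(k,X)\<close> be the diagram \<open>l \<mapsto> \<Coprod>\<^bsub>K(k,l)\<^esub> X\<^sub>l\<close>, and suppose that \<open>T(a,-)\<close> preserves these copowers. Then
  \<open>R(-,d)\<close> turns them into products, so an arrow from \<open>a\<close> to \<open>\<integral>\<^sub>l R(S(k,X)\<^sub>l, Y\<^sub>l)\<close> amounts to a family of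
  arrows \<open>q\<^sub>g : a \<rightarrow> R(X\<^sub>l,Y\<^sub>l)\<close>, one for every \<open>g : k \<rightarrow> l\<close>, that is compatible with the arrows of \<open>K\<close> out of
  \<open>l\<close> (\<open>RK_univ\<close>, \<open>RK_eqI\<close>). An arrow of diagrams from \<open>M\<close> to \<open>k \<mapsto> \<integral>\<^sub>l R(S(k,X)\<^sub>l, Y\<^sub>l)\<close> is such a family for
  each \<open>a = M\<^sub>k\<close>, natural in \<open>k\<close>. As in the Yoneda lemma it is determined by its members \<open>\<tau>\<^sub>l : M\<^sub>l \<rightarrow> R(X\<^sub>l,Y\<^sub>l)\<close>
  at the identities, because naturality forces \<open>q\<^sub>g = \<tau>\<^sub>l \<circ> M\<^sub>g\<close>; and what remains of naturality and
  compatibility is that \<open>\<tau>\<close> is extranatural. By adjointness such a \<open>\<tau>\<close> is a natural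
  transformation \<open>T(M,X) \<rightarrow> Y\<close> (\<open>extranatural_iff\<close>). Hence \<open>k \<mapsto> \<integral>\<^sub>l R(S(k,X)\<^sub>l, Y\<^sub>l)\<close> is right adjoint
  to \<open>T(-,X)\<close> (\<open>natural_bij_\<Phi>\<close>).

  The functor \<open>Hom\<close> is the case of the action \<open>T\<close> of \<open>V\<close> on \<open>C\<close> with \<open>S(k,X) = h\<^sub>k \<otimes> X\<close>; the internal hom of
  \<open>V\<^sup>K\<close> is the same with \<open>C = V\<close>. The cotensor is the case of the action with exchanged arguments, where
  \<open>A = D = C\<close>, \<open>B = V\<close>, \<open>R(m,d) = d\<^sup>m\<close> and \<open>S(k,M) = M \<otimes> h\<^sub>k\<close>. The objects \<open>h\<^sub>k(l)\<close> are copowers of the unit,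
  and the copowers \<open>S(k,X)\<^sub>l\<close> and their preservation come from the adjoints that \<open>V\<close> and \<open>C\<close> provide
  (\<open>left_adjoint_preserves_copower\<close>), together with the braiding for \<open>m \<otimes> -\<close> on \<open>V\<close>.
\<close>

section \<open>Calculating in categories, functors and functor categories\<close>

text \<open>
  Composability of \<open>f\<close> and \<open>g\<close> is expressed by the equation \<open>Cod f = Dom g\<close> between objects. The
  simplifier can decide such side conditions, whereas a rule about \<open>f \<in> hom x y\<close> and \<open>g \<in> hom y z\<close>
  leaves it to guess \<open>y\<close>.
\<close>

lemma hom_iff: "f \<in> hom C x y \<longleftrightarrow> f \<in> Arr C \<and> Dom C f = x \<and> Cod C f = y"
  by (simp add: hom_def)

context category
begin

lemma Ob_Dom [simp]: "f \<in> Arr C \<Longrightarrow> Dom C f \<in> Ob C"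
  and Ob_Cod [simp]: "f \<in> Arr C \<Longrightarrow> Cod C f \<in> Ob C"
  by (simp_all add: Dom_in Cod_in)

lemma Arr_Ide [simp]: "x \<in> Ob C \<Longrightarrow> Ide C x \<in> Arr C"
  and Dom_Ide [simp]: "x \<in> Ob C \<Longrightarrow> Dom C (Ide C x) = x"
  and Cod_Ide [simp]: "x \<in> Ob C \<Longrightarrow> Cod C (Ide C x) = x"
  using Ide_in by (simp_all add: hom_iff)

lemma
  assumes "f \<in> Arr C" "g \<in> Arr C" "Cod C f = Dom C g"
  shows Arr_Comp [simp]: "g \<cdot> f \<in> Arr C"
    and Dom_Comp [simp]: "Dom C (g \<cdot> f) = Dom C f"
    and Cod_Comp [simp]: "Cod C (g \<cdot> f) = Cod C g"
  using Comp_in[of f "Dom C f" "Cod C f" g "Cod C g"] assms by (simp_all add: hom_iff)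

lemma assoc_Comp:
  assumes "f \<in> Arr C" "g \<in> Arr C" "h \<in> Arr C" "Cod C f = Dom C g" "Cod C g = Dom C h"
  shows "h \<cdot> g \<cdot> f = h \<cdot> (g \<cdot> f)"
  using Comp_assoc[of f _ _ g _ h] assms by (simp add: hom_iff)

lemma Comp_Ide_left [simp]: "f \<in> Arr C \<Longrightarrow> Cod C f = x \<Longrightarrow> Ide C x \<cdot> f = f"
  and Comp_Ide_right [simp]: "f \<in> Arr C \<Longrightarrow> Dom C f = x \<Longrightarrow> f \<cdot> Ide C x = f"
  using Ide_left[of f _ x] Ide_right[of f x] by (simp_all add: hom_iff)

lemma is_iso_Ide: "x \<in> Ob C \<Longrightarrow> is_iso C x x (Ide C x)"
  by (auto simp: is_iso_def hom_iff intro: bexI[of _ "Ide C x"])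

end

lemma is_isoE:
  assumes "is_iso C x y f"
  obtains g where "f \<in> Arr C" "Dom C f = x" "Cod C f = y" "g \<in> Arr C" "Dom C g = y" "Cod C g = x"
    "g \<cdot>\<^bsub>C\<^esub> f = Ide C x" "f \<cdot>\<^bsub>C\<^esub> g = Ide C y"
  using assms by (auto simp: is_iso_def hom_iff)

lemma op_simps [simp]:
  "Ob (op C) = Ob C" "Arr (op C) = Arr C" "Dom (op C) = Cod C" "Cod (op C) = Dom C"
  "Ide (op C) = Ide C" "g \<cdot>\<^bsub>op C\<^esub> f = f \<cdot>\<^bsub>C\<^esub> g"
  by (simp_all add: op_def)

lemma hom_op [simp]: "hom (op C) x y = hom C y x"
  by (auto simp: hom_iff)

lemma prod_cat_simps [simp]:
  "Ob (A \<times>\<^sub>C B) = Ob A \<times> Ob B" "Arr (A \<times>\<^sub>C B) = Arr A \<times> Arr B"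
  "Dom (A \<times>\<^sub>C B) (f, g) = (Dom A f, Dom B g)" "Cod (A \<times>\<^sub>C B) (f, g) = (Cod A f, Cod B g)"
  "Ide (A \<times>\<^sub>C B) (x, y) = (Ide A x, Ide B y)"
  "(f', g') \<cdot>\<^bsub>A \<times>\<^sub>C B\<^esub> (f, g) = (f' \<cdot>\<^bsub>A\<^esub> f, g' \<cdot>\<^bsub>B\<^esub> g)"
  by (simp_all add: prod_cat_def)

lemma category_op: "category C \<Longrightarrow> category (op C)"
  unfolding category_def by (simp add: hom_iff)

lemma category_prod: 
  assumes "category A" "category B"
  shows "category (A \<times>\<^sub>C B)"
proof -
  interpret A: category A by fact
  interpret B: category B by fact
  show ?thesis by unfold_locales (auto simp: hom_iff A.assoc_Comp B.assoc_Comp)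
qed

context Functor
begin

lemma Ob_OM [simp]: "x \<in> Ob A \<Longrightarrow> OM F x \<in> Ob B"
  by (rule OM_in)

lemma
  assumes "f \<in> Arr A"
  shows Arr_AM [simp]: "AM F f \<in> Arr B"
    and Dom_AM [simp]: "Dom B (AM F f) = OM F (Dom A f)"
    and Cod_AM [simp]: "Cod B (AM F f) = OM F (Cod A f)"
  using AM_in[of f] assms by (simp_all add: hom_iff)

lemma AM_Ide' [simp]: "x \<in> Ob A \<Longrightarrow> AM F (Ide A x) = Ide B (OM F x)"
  by (rule AM_Ide)

lemma AM_Comp': "f \<in> Arr A \<Longrightarrow> g \<in> Arr A \<Longrightarrow> Cod A f = Dom A g \<Longrightarrow>
    AM F (g \<cdot>\<^bsub>A\<^esub> f) = AM F g \<cdot>\<^bsub>B\<^esub> AM F f"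
  using AM_Comp by (simp add: hom_iff)

end

lemma FunctorI:
  assumes "category A" "category B"
    and "\<And>x. x \<in> Ob A \<Longrightarrow> OM F x \<in> Ob B"
    and "\<And>f. f \<in> Arr A \<Longrightarrow>
      AM F f \<in> Arr B \<and> Dom B (AM F f) = OM F (Dom A f) \<and> Cod B (AM F f) = OM F (Cod A f)"
    and "\<And>x. x \<in> Ob A \<Longrightarrow> AM F (Ide A x) = Ide B (OM F x)"
    and "\<And>f g. f \<in> Arr A \<Longrightarrow> g \<in> Arr A \<Longrightarrow> Cod A f = Dom A g \<Longrightarrow>
      AM F (g \<cdot>\<^bsub>A\<^esub> f) = AM F g \<cdot>\<^bsub>B\<^esub> AM F f"
  shows "Functor A B F"
  using assms by (simp add: Functor_def Functor_axioms_def hom_iff)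

locale Bifunctor =
  A: category A + B: category B + D: category D + prod: Functor "A \<times>\<^sub>C B" D F
  for A :: "('o, 'a) cat" and B :: "('p, 'b) cat" and D :: "('q, 'd) cat" and F
begin

lemma Ob_OM2 [simp]: "x \<in> Ob A \<Longrightarrow> y \<in> Ob B \<Longrightarrow> OM F (x, y) \<in> Ob D"
  by simp

lemma
  assumes "f \<in> Arr A" "g \<in> Arr B"
  shows Arr_AM2 [simp]: "AM F (f, g) \<in> Arr D"
    and Dom_AM2 [simp]: "Dom D (AM F (f, g)) = OM F (Dom A f, Dom B g)"
    and Cod_AM2 [simp]: "Cod D (AM F (f, g)) = OM F (Cod A f, Cod B g)"
  using assms by simp_all

lemma AM_Ide2 [simp]: "x \<in> Ob A \<Longrightarrow> y \<in> Ob B \<Longrightarrow> AM F (Ide A x, Ide B y) = Ide D (OM F (x, y))"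
  using prod.AM_Ide'[of "(x, y)"] by simp

lemma AM_Comp2:
  "\<lbrakk>f \<in> Arr A; f' \<in> Arr A; Cod A f = Dom A f'; g \<in> Arr B; g' \<in> Arr B; Cod B g = Dom B g'\<rbrakk>
    \<Longrightarrow> AM F (f', g') \<cdot>\<^bsub>D\<^esub> AM F (f, g) = AM F (f' \<cdot>\<^bsub>A\<^esub> f, g' \<cdot>\<^bsub>B\<^esub> g)"
  using prod.AM_Comp'[of "(f, g)" "(f', g')"] by simp

end

lemma BifunctorI:
  "category A \<Longrightarrow> category B \<Longrightarrow> Functor (A \<times>\<^sub>C B) D F \<Longrightarrow> Bifunctor A B D F"
  by (simp add: Bifunctor_def Functor_def)

subsection \<open>Functor categories\<close>

lemma fun_cat_simps [simp]:
  "Dom (fun_cat K C) = src" "Cod (fun_cat K C) = trg"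
  "Ide (fun_cat K C) F = \<lparr>src = F, trg = F, cmp = (\<lambda>k\<in>Ob K. Ide C (OM F k))\<rparr>"
  "t \<cdot>\<^bsub>fun_cat K C\<^esub> s =
    \<lparr>src = src s, trg = trg t, cmp = (\<lambda>k\<in>Ob K. cmp t k \<cdot>\<^bsub>C\<^esub> cmp s k)\<rparr>"
  by (simp_all add: fun_cat_def Let_def)

lemma Ob_fun_cat: "F \<in> Ob (fun_cat K C) \<longleftrightarrow>
    Functor K C F \<and> OM F \<in> extensional (Ob K) \<and> AM F \<in> extensional (Arr K)"
  by (simp add: fun_cat_def Let_def)

lemma Arr_fun_cat_Nat: "t \<in> Arr (fun_cat K C) \<longleftrightarrow> src t \<in> Ob (fun_cat K C) \<and>
    trg t \<in> Ob (fun_cat K C) \<and> Nat_trans K C (src t) (trg t) (cmp t) \<and> cmp t \<in> extensional (Ob K)"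
  by (simp add: fun_cat_def Let_def)

lemma Arr_fun_cat: "t \<in> Arr (fun_cat K C) \<longleftrightarrow> src t \<in> Ob (fun_cat K C) \<and>
    trg t \<in> Ob (fun_cat K C) \<and> cmp t \<in> extensional (Ob K) \<and>
    (\<forall>k\<in>Ob K. cmp t k \<in> Arr C \<and> Dom C (cmp t k) = OM (src t) k \<and> Cod C (cmp t k) = OM (trg t) k) \<and>
    (\<forall>f\<in>Arr K. cmp t (Cod K f) \<cdot>\<^bsub>C\<^esub> AM (src t) f = AM (trg t) f \<cdot>\<^bsub>C\<^esub> cmp t (Dom K f))"
  by (auto simp: Arr_fun_cat_Nat Ob_fun_cat Nat_trans_def Nat_trans_axioms_def hom_iff)

lemma Arr_fun_catI:
  assumes "src t \<in> Ob (fun_cat K C)" "trg t \<in> Ob (fun_cat K C)" "cmp t \<in> extensional (Ob K)"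
    and "\<And>k. k \<in> Ob K \<Longrightarrow>
      cmp t k \<in> Arr C \<and> Dom C (cmp t k) = OM (src t) k \<and> Cod C (cmp t k) = OM (trg t) k"
    and "\<And>f. f \<in> Arr K \<Longrightarrow>
      cmp t (Cod K f) \<cdot>\<^bsub>C\<^esub> AM (src t) f = AM (trg t) f \<cdot>\<^bsub>C\<^esub> cmp t (Dom K f)"
  shows "t \<in> Arr (fun_cat K C)"
  using assms by (simp add: Arr_fun_cat)

lemma Functor_of_Ob [dest]: "F \<in> Ob (fun_cat K C) \<Longrightarrow> Functor K C F"
  by (simp add: Ob_fun_cat)

lemma ntrans_eqI:
  fixes s t :: "('o, 'a, 'p, 'b) ntrans"
  assumes "src s = src t" "trg s = trg t" "cmp s \<in> extensional S" "cmp t \<in> extensional S"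
    and "\<And>k. k \<in> S \<Longrightarrow> cmp s k = cmp t k"
  shows "s = t"
  using assms by (cases s, cases t) (auto intro: extensionalityI)

lemma Arr_fun_cat_eqI:
  assumes "s \<in> Arr (fun_cat K C)" "t \<in> Arr (fun_cat K C)" "src s = src t" "trg s = trg t"
    and "\<And>k. k \<in> Ob K \<Longrightarrow> cmp s k = cmp t k"
  shows "s = t"
  using assms by (auto intro!: ntrans_eqI[where S = "Ob K"] simp: Arr_fun_cat)

locale two_categories = K: category K + C: category C
  for K :: "('s, 't) cat" and C :: "('o, 'a) cat"
begin

lemma
  assumes "F \<in> Ob (fun_cat K C)"
  shows fc_Ob [simp]: "k \<in> Ob K \<Longrightarrow> OM F k \<in> Ob C"
    and fc_Ide [simp]: "k \<in> Ob K \<Longrightarrow> AM F (Ide K k) = Ide C (OM F k)"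
    and fc_Arr [simp]: "f \<in> Arr K \<Longrightarrow> AM F f \<in> Arr C"
    and fc_Dom [simp]: "f \<in> Arr K \<Longrightarrow> Dom C (AM F f) = OM F (Dom K f)"
    and fc_Cod [simp]: "f \<in> Arr K \<Longrightarrow> Cod C (AM F f) = OM F (Cod K f)"
    and fc_Comp: "f \<in> Arr K \<Longrightarrow> g \<in> Arr K \<Longrightarrow> Cod K f = Dom K g \<Longrightarrow>
      AM F (g \<cdot>\<^bsub>K\<^esub> f) = AM F g \<cdot>\<^bsub>C\<^esub> AM F f"
proof -
  interpret Functor K C F using assms by blast
  show "k \<in> Ob K \<Longrightarrow> OM F k \<in> Ob C" "k \<in> Ob K \<Longrightarrow> AM F (Ide K k) = Ide C (OM F k)"
    "f \<in> Arr K \<Longrightarrow> AM F f \<in> Arr C" "f \<in> Arr K \<Longrightarrow> Dom C (AM F f) = OM F (Dom K f)"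
    "f \<in> Arr K \<Longrightarrow> Cod C (AM F f) = OM F (Cod K f)"
    "f \<in> Arr K \<Longrightarrow> g \<in> Arr K \<Longrightarrow> Cod K f = Dom K g \<Longrightarrow>
      AM F (g \<cdot>\<^bsub>K\<^esub> f) = AM F g \<cdot>\<^bsub>C\<^esub> AM F f"
    by (simp_all add: AM_Comp')
qed

lemma
  assumes "t \<in> Arr (fun_cat K C)"
  shows fc_src [simp]: "src t \<in> Ob (fun_cat K C)"
    and fc_trg [simp]: "trg t \<in> Ob (fun_cat K C)"
    and fc_cmp [simp]: "k \<in> Ob K \<Longrightarrow> cmp t k \<in> Arr C"
    and fc_Dom_cmp [simp]: "k \<in> Ob K \<Longrightarrow> Dom C (cmp t k) = OM (src t) k"
    and fc_Cod_cmp [simp]: "k \<in> Ob K \<Longrightarrow> Cod C (cmp t k) = OM (trg t) k"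
    and fc_natural: "f \<in> Arr K \<Longrightarrow>
      cmp t (Cod K f) \<cdot>\<^bsub>C\<^esub> AM (src t) f = AM (trg t) f \<cdot>\<^bsub>C\<^esub> cmp t (Dom K f)"
    and fc_ext: "cmp t \<in> extensional (Ob K)"
  using assms by (auto simp: Arr_fun_cat)

lemma Ob_fun_catI:
  assumes "OM F \<in> extensional (Ob K)" "AM F \<in> extensional (Arr K)"
    and "\<And>k. k \<in> Ob K \<Longrightarrow> OM F k \<in> Ob C"
    and "\<And>f. f \<in> Arr K \<Longrightarrow>
      AM F f \<in> Arr C \<and> Dom C (AM F f) = OM F (Dom K f) \<and> Cod C (AM F f) = OM F (Cod K f)"
    and "\<And>k. k \<in> Ob K \<Longrightarrow> AM F (Ide K k) = Ide C (OM F k)"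
    and "\<And>f g. f \<in> Arr K \<Longrightarrow> g \<in> Arr K \<Longrightarrow> Cod K f = Dom K g \<Longrightarrow>
      AM F (g \<cdot>\<^bsub>K\<^esub> f) = AM F g \<cdot>\<^bsub>C\<^esub> AM F f"
  shows "F \<in> Ob (fun_cat K C)"
  using assms by (auto simp: Ob_fun_cat intro!: FunctorI K.category_axioms C.category_axioms)

lemma fc_Arr_Comp:
  assumes "s \<in> Arr (fun_cat K C)" "t \<in> Arr (fun_cat K C)" "trg s = src t"
  shows "t \<cdot>\<^bsub>fun_cat K C\<^esub> s \<in> Arr (fun_cat K C)"
proof (rule Arr_fun_catI)
  fix f assume f: "f \<in> Arr K"
  have "cmp t (Cod K f) \<cdot>\<^bsub>C\<^esub> cmp s (Cod K f) \<cdot>\<^bsub>C\<^esub> AM (src s) f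
      = cmp t (Cod K f) \<cdot>\<^bsub>C\<^esub> (AM (src t) f \<cdot>\<^bsub>C\<^esub> cmp s (Dom K f))"
    using assms f by (simp add: C.assoc_Comp fc_natural)
  also have "\<dots> = AM (trg t) f \<cdot>\<^bsub>C\<^esub> (cmp t (Dom K f) \<cdot>\<^bsub>C\<^esub> cmp s (Dom K f))"
    using assms f by (simp add: C.assoc_Comp[symmetric] fc_natural)
  finally show "cmp (t \<cdot>\<^bsub>fun_cat K C\<^esub> s) (Cod K f) \<cdot>\<^bsub>C\<^esub> AM (src (t \<cdot>\<^bsub>fun_cat K C\<^esub> s)) f =
      AM (trg (t \<cdot>\<^bsub>fun_cat K C\<^esub> s)) f \<cdot>\<^bsub>C\<^esub> cmp (t \<cdot>\<^bsub>fun_cat K C\<^esub> s) (Dom K f)"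
    using f by simp
qed (use assms in auto)

lemma category_fun_cat: "category (fun_cat K C)"
proof
  fix f g h w x y z
  show "f \<in> Arr (fun_cat K C) \<Longrightarrow> Dom (fun_cat K C) f \<in> Ob (fun_cat K C)"
    and "f \<in> Arr (fun_cat K C) \<Longrightarrow> Cod (fun_cat K C) f \<in> Ob (fun_cat K C)" by auto
  show "x \<in> Ob (fun_cat K C) \<Longrightarrow> Ide (fun_cat K C) x \<in> hom (fun_cat K C) x x" for x
    by (auto simp: hom_iff intro!: Arr_fun_catI)
  show "f \<in> hom (fun_cat K C) x y \<Longrightarrow> g \<in> hom (fun_cat K C) y z \<Longrightarrow>
      g \<cdot>\<^bsub>fun_cat K C\<^esub> f \<in> hom (fun_cat K C) x z" for x y z
    using fc_Arr_Comp[of f g] by (simp add: hom_iff)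
  show "f \<in> hom (fun_cat K C) w x \<Longrightarrow> g \<in> hom (fun_cat K C) x y \<Longrightarrow> h \<in> hom (fun_cat K C) y z \<Longrightarrow>
      h \<cdot>\<^bsub>fun_cat K C\<^esub> (g \<cdot>\<^bsub>fun_cat K C\<^esub> f) = h \<cdot>\<^bsub>fun_cat K C\<^esub> g \<cdot>\<^bsub>fun_cat K C\<^esub> f" for w x y z
    by (auto simp: hom_iff C.assoc_Comp intro!: restrict_ext)
  show "f \<in> hom (fun_cat K C) x y \<Longrightarrow> Ide (fun_cat K C) y \<cdot>\<^bsub>fun_cat K C\<^esub> f = f" for x y
    by (rule ntrans_eqI[where S = "Ob K"]) (auto simp: hom_iff fc_ext)
  show "f \<in> hom (fun_cat K C) x y \<Longrightarrow> f \<cdot>\<^bsub>fun_cat K C\<^esub> Ide (fun_cat K C) x = f" for x y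
    by (rule ntrans_eqI[where S = "Ob K"]) (auto simp: hom_iff fc_ext)
qed

lemmas Arr_Ide_fun_cat [simp] = category.Arr_Ide[OF category_fun_cat, simplified]

text \<open>The inverses of the components of a natural transformation are natural.\<close>

lemma is_iso_fun_cat:
  assumes t: "t \<in> Arr (fun_cat K C)" "src t = F" "trg t = G"
    and iso: "\<And>k. k \<in> Ob K \<Longrightarrow> is_iso C (OM F k) (OM G k) (cmp t k)"
  shows "is_iso (fun_cat K C) F G t"
proof -
  have "\<forall>k\<in>Ob K. \<exists>g. g \<in> Arr C \<and> Dom C g = OM G k \<and> Cod C g = OM F k \<and>
      g \<cdot>\<^bsub>C\<^esub> cmp t k = Ide C (OM F k) \<and> cmp t k \<cdot>\<^bsub>C\<^esub> g = Ide C (OM G k)"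
    using iso by (meson is_isoE)
  then obtain v where v: "\<And>k. k \<in> Ob K \<Longrightarrow> v k \<in> Arr C \<and> Dom C (v k) = OM G k \<and> Cod C (v k) = OM F k \<and>
      v k \<cdot>\<^bsub>C\<^esub> cmp t k = Ide C (OM F k) \<and> cmp t k \<cdot>\<^bsub>C\<^esub> v k = Ide C (OM G k)"
    by metis
  define u where "u = \<lparr>src = G, trg = F, cmp = (\<lambda>k\<in>Ob K. v k)\<rparr>"
  have "u \<in> Arr (fun_cat K C)"
  proof (rule Arr_fun_catI)
    fix f assume f: "f \<in> Arr K"
    let ?k = "Dom K f" and ?l = "Cod K f"
    note F = fc_src[OF t(1), unfolded t(2)] and G = fc_trg[OF t(1), unfolded t(3)]
    have "v ?l \<cdot>\<^bsub>C\<^esub> AM G f = v ?l \<cdot>\<^bsub>C\<^esub> (AM G f \<cdot>\<^bsub>C\<^esub> cmp t ?k) \<cdot>\<^bsub>C\<^esub> v ?k"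
      using f t v[of ?k] v[of ?l] F G by (simp add: C.assoc_Comp)
    also have "\<dots> = v ?l \<cdot>\<^bsub>C\<^esub> (cmp t ?l \<cdot>\<^bsub>C\<^esub> AM F f) \<cdot>\<^bsub>C\<^esub> v ?k"
      using fc_natural[OF t(1) f] t by simp
    also have "\<dots> = AM F f \<cdot>\<^bsub>C\<^esub> v ?k"
      using f t v[of ?k] v[of ?l] F G by (simp add: C.assoc_Comp[symmetric])
    finally show "cmp u (Cod K f) \<cdot>\<^bsub>C\<^esub> AM (src u) f = AM (trg u) f \<cdot>\<^bsub>C\<^esub> cmp u (Dom K f)"
      using f by (simp add: u_def)
  qed (use t v in \<open>auto simp: u_def\<close>)
  then show ?thesis
    unfolding is_iso_def using t v
    by (intro conjI bexI[of _ u]) (auto simp: hom_iff u_def intro!: restrict_ext)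
qed

end

subsection \<open>Objectwise bifunctors\<close>

lemma pointwise_ob_simps [simp]:
  "k \<in> Ob K \<Longrightarrow> OM (pointwise_ob K T X Y) k = OM T (OM X k, OM Y k)"
  "f \<in> Arr K \<Longrightarrow> AM (pointwise_ob K T X Y) f = AM T (AM X f, AM Y f)"
  by (simp_all add: pointwise_ob_def)

lemma pointwise_simps [simp]:
  "OM (pointwise K T) (X, Y) = pointwise_ob K T X Y"
  "src (AM (pointwise K T) (s, t)) = pointwise_ob K T (src s) (src t)"
  "trg (AM (pointwise K T) (s, t)) = pointwise_ob K T (trg s) (trg t)"
  "k \<in> Ob K \<Longrightarrow> cmp (AM (pointwise K T) (s, t)) k = AM T (cmp s k, cmp t k)"
  "cmp (AM (pointwise K T) (s, t)) \<in> extensional (Ob K)"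
  by (simp_all add: pointwise_def)

locale Bifunctor_diagrams = K: category K + T: Bifunctor A B D T
  for K :: "('s, 't) cat" and A :: "('o, 'a) cat" and B :: "('p, 'b) cat" and D :: "('q, 'd) cat"
    and T
begin

sublocale KA: two_categories K A by unfold_locales
sublocale KB: two_categories K B by unfold_locales
sublocale KD: two_categories K D by unfold_locales

lemma Ob_pointwise:
  assumes "X \<in> Ob (fun_cat K A)" "Y \<in> Ob (fun_cat K B)"
  shows "pointwise_ob K T X Y \<in> Ob (fun_cat K D)"
  using assms
  by (intro KD.Ob_fun_catI) (auto simp: KA.fc_Comp KB.fc_Comp T.AM_Comp2 pointwise_ob_def)

lemma Arr_pointwise:
  assumes "s \<in> Arr (fun_cat K A)" "t \<in> Arr (fun_cat K B)"
  shows "AM (pointwise K T) (s, t) \<in> Arr (fun_cat K D)"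
  using assms
  by (intro Arr_fun_catI) (simp_all add: Ob_pointwise T.AM_Comp2 KA.fc_natural KB.fc_natural)

lemma Functor_pointwise: "Functor (fun_cat K A \<times>\<^sub>C fun_cat K B) (fun_cat K D) (pointwise K T)"
proof (rule FunctorI)
  show "category (fun_cat K A \<times>\<^sub>C fun_cat K B)"
    by (intro category_prod KA.category_fun_cat KB.category_fun_cat)
  show "category (fun_cat K D)" by (rule KD.category_fun_cat)
next
  fix f g assume "f \<in> Arr (fun_cat K A \<times>\<^sub>C fun_cat K B)" "g \<in> Arr (fun_cat K A \<times>\<^sub>C fun_cat K B)"
    "Cod (fun_cat K A \<times>\<^sub>C fun_cat K B) f = Dom (fun_cat K A \<times>\<^sub>C fun_cat K B) g"
  then show "AM (pointwise K T) (g \<cdot>\<^bsub>fun_cat K A \<times>\<^sub>C fun_cat K B\<^esub> f) =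
      AM (pointwise K T) g \<cdot>\<^bsub>fun_cat K D\<^esub> AM (pointwise K T) f"
    by (cases f, cases g) (auto intro!: ntrans_eqI[where S = "Ob K"] simp: T.AM_Comp2)
next
  fix x assume "x \<in> Ob (fun_cat K A \<times>\<^sub>C fun_cat K B)"
  then show "AM (pointwise K T) (Ide (fun_cat K A \<times>\<^sub>C fun_cat K B) x) =
      Ide (fun_cat K D) (OM (pointwise K T) x)"
    by (cases x) (auto intro!: ntrans_eqI[where S = "Ob K"])
qed (auto simp: Ob_pointwise Arr_pointwise)

end

section \<open>Objectwise coherence\<close>

lemma (in two_categories) is_iso_ntrans:
  assumes "F \<in> Ob (fun_cat K C)" "G \<in> Ob (fun_cat K C)"
    and iso: "\<And>k. k \<in> Ob K \<Longrightarrow> is_iso C (OM F k) (OM G k) (\<tau> k)"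
    and natural: "\<And>f. f \<in> Arr K \<Longrightarrow> \<tau> (Cod K f) \<cdot>\<^bsub>C\<^esub> AM F f = AM G f \<cdot>\<^bsub>C\<^esub> \<tau> (Dom K f)"
  shows "is_iso (fun_cat K C) F G \<lparr>src = F, trg = G, cmp = (\<lambda>k\<in>Ob K. \<tau> k)\<rparr>"
proof (rule is_iso_fun_cat)
  have "\<tau> k \<in> Arr C \<and> Dom C (\<tau> k) = OM F k \<and> Cod C (\<tau> k) = OM G k" if "k \<in> Ob K" for k
    using iso[OF that] by (elim is_isoE) simp
  then show "\<lparr>src = F, trg = G, cmp = (\<lambda>k\<in>Ob K. \<tau> k)\<rparr> \<in> Arr (fun_cat K C)"
    using assms(1,2) natural by (intro Arr_fun_catI) simp_all
qed (use iso in auto)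

lemma fun_monoidal_simps [simp]:
  "mcat (fun_monoidal K V) = fun_cat K (mcat V)"
  "tens (fun_monoidal K V) = pointwise K (tens V)"
  "OM (unit_ob (fun_monoidal K V)) = (\<lambda>k\<in>Ob K. unit_ob V)"
  "AM (unit_ob (fun_monoidal K V)) = (\<lambda>f\<in>Arr K. Ide (mcat V) (unit_ob V))"
  "assoc (fun_monoidal K V) M N P =
     \<lparr>src = pointwise_ob K (tens V) (pointwise_ob K (tens V) M N) P,
      trg = pointwise_ob K (tens V) M (pointwise_ob K (tens V) N P),
      cmp = (\<lambda>k\<in>Ob K. assoc V (OM M k) (OM N k) (OM P k))\<rparr>"
  "lunit (fun_monoidal K V) M =
     \<lparr>src = pointwise_ob K (tens V) (unit_ob (fun_monoidal K V)) M, trg = M,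
      cmp = (\<lambda>k\<in>Ob K. lunit V (OM M k))\<rparr>"
  "runit (fun_monoidal K V) M =
     \<lparr>src = pointwise_ob K (tens V) M (unit_ob (fun_monoidal K V)), trg = M,
      cmp = (\<lambda>k\<in>Ob K. runit V (OM M k))\<rparr>"
  "braid (fun_monoidal K V) M N =
     \<lparr>src = pointwise_ob K (tens V) M N, trg = pointwise_ob K (tens V) N M,
      cmp = (\<lambda>k\<in>Ob K. braid V (OM M k) (OM N k))\<rparr>"
  by (simp_all add: fun_monoidal_def Let_def)

locale symmetric_monoidal_diagrams = K: category K + symmetric_monoidal V
  for K :: "('s, 't) cat" and V :: "('o, 'a) monoidal"
begin

sublocale T: Bifunctor_diagrams K "mcat V" "mcat V" "mcat V" "tens V"
  by unfold_locales

abbreviation VK where "VK \<equiv> fun_cat K (mcat V)"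
abbreviation unit_diagram where "unit_diagram \<equiv> unit_ob (fun_monoidal K V)"

lemma Ob_unit_diagram [simp]: "unit_diagram \<in> Ob VK"
  by (rule T.KA.Ob_fun_catI) (simp_all add: unit_in)

text \<open>
  The axioms are equations between natural transformations and so can be checked one object at a
  time, where they are the axioms of \<open>V\<close>. The components are invertible there, hence the coherence
  transformations are isomorphisms of diagrams.
\<close>

lemma symmetric_monoidal_fun_monoidal: "symmetric_monoidal (fun_monoidal K V)"
proof (intro symmetric_monoidal.intro symmetric_monoidal_axioms.intro; (unfold fun_monoidal_simps(1,2))?)
  show "Functor (VK \<times>\<^sub>C VK) VK (pointwise K (tens V))" by (rule T.Functor_pointwise)
  show "category VK" by (rule T.KA.category_fun_cat)
  show "unit_diagram \<in> Ob VK" by simp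
next
  fix a b c assume "a \<in> Ob VK" "b \<in> Ob VK" "c \<in> Ob VK"
  then show "is_iso VK (OM (pointwise K (tens V)) (OM (pointwise K (tens V)) (a, b), c))
      (OM (pointwise K (tens V)) (a, OM (pointwise K (tens V)) (b, c))) (assoc (fun_monoidal K V) a b c)"
    by (simp, intro T.KA.is_iso_ntrans)
      (auto intro!: T.Ob_pointwise assoc_iso assoc_natural simp: hom_iff)
next
  fix a assume "a \<in> Ob VK"
  then show "is_iso VK (OM (pointwise K (tens V)) (unit_diagram, a)) a (lunit (fun_monoidal K V) a)"
    by (simp, intro T.KA.is_iso_ntrans)
      (auto intro!: T.Ob_pointwise lunit_iso lunit_natural simp: hom_iff)
next
  fix a assume "a \<in> Ob VK"
  then show "is_iso VK (OM (pointwise K (tens V)) (a, unit_diagram)) a (runit (fun_monoidal K V) a)"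
    by (simp, intro T.KA.is_iso_ntrans)
      (auto intro!: T.Ob_pointwise runit_iso runit_natural simp: hom_iff)
next
  fix a b assume "a \<in> Ob VK" "b \<in> Ob VK"
  then show "is_iso VK (OM (pointwise K (tens V)) (a, b)) (OM (pointwise K (tens V)) (b, a))
      (braid (fun_monoidal K V) a b)"
    by (simp, intro T.KA.is_iso_ntrans)
      (auto intro!: T.Ob_pointwise braid_iso braid_natural simp: hom_iff)
qed (auto simp: hom_iff unit_in
      intro!: ntrans_eqI[where S = "Ob K"] restrict_ext assoc_natural lunit_natural runit_natural braid_natural
        pentagon triangle hexagon symmetry)

end

locale module_diagrams = K: category K + module_cat V C act \<alpha> l
  for K :: "('s, 't) cat" and V :: "('o, 'a) monoidal" and C :: "('p, 'b) cat" and act \<alpha> l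
begin

sublocale symmetric_monoidal_diagrams K V by unfold_locales
sublocale A: Bifunctor_diagrams K "mcat V" C C act by unfold_locales

abbreviation CK where "CK \<equiv> fun_cat K C"

lemma module_cat_fun_cat:
  "module_cat (fun_monoidal K V) CK (pointwise K act) (fun_\<alpha> K V act \<alpha>) (fun_l K V act l)"
proof (intro module_cat.intro module_cat_axioms.intro symmetric_monoidal_fun_monoidal;
    (unfold fun_monoidal_simps(1,2))?)
  show "category CK" by (rule A.KB.category_fun_cat)
  show "Functor (VK \<times>\<^sub>C CK) CK (pointwise K act)" by (rule A.Functor_pointwise)
next
  fix m n c assume "m \<in> Ob VK" "n \<in> Ob VK" "c \<in> Ob CK"
  then show "is_iso CK (OM (pointwise K act) (OM (pointwise K (tens V)) (m, n), c))
     (OM (pointwise K act) (m, OM (pointwise K act) (n, c))) (fun_\<alpha> K V act \<alpha> m n c)"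
    by (simp add: fun_\<alpha>_def, intro A.KB.is_iso_ntrans)
      (auto intro!: A.Ob_pointwise T.Ob_pointwise \<alpha>_iso \<alpha>_natural simp: hom_iff)
next
  fix c assume "c \<in> Ob CK"
  then show "is_iso CK (OM (pointwise K act) (unit_diagram, c)) c (fun_l K V act l c)"
    by (simp add: fun_l_def, intro A.KB.is_iso_ntrans)
      (auto intro!: A.Ob_pointwise l_iso l_natural simp: hom_iff)
qed (auto simp: hom_iff unit_in fun_\<alpha>_def fun_l_def
      intro!: ntrans_eqI[where S = "Ob K"] restrict_ext \<alpha>_natural l_natural module_pentagon module_triangle)

end

section \<open>Existence of ends and copowers\<close>

text \<open>
  Completeness provides limits over shapes whose objects and arrows lie in the type \<open>'s\<close>. A shape
  of another type is copied into \<open>'s\<close> along injections; cones over the copied diagram are cones over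
  the original one.
\<close>

lemma limit_exists_of_injections:
  fixes J :: "('x, 'y) cat" and e :: "'x \<Rightarrow> 's" and e' :: "'y \<Rightarrow> 's"
  assumes "complete TYPE('s) C" "inj e" "inj e'" "Functor J C D"
  shows "\<exists>x \<pi>. is_limit J C D x \<pi>"
proof -
  interpret Functor J C D by fact
  note [simp] = inv_f_f[OF assms(2)] inv_f_f[OF assms(3)]
  define J' where "J' = \<lparr>Ob = e ` Ob J, Arr = e' ` Arr J, Dom = (\<lambda>a. e (Dom J (inv e' a))),
    Cod = (\<lambda>a. e (Cod J (inv e' a))), Ide = (\<lambda>x. e' (Ide J (inv e x))),
    Comp = (\<lambda>g f. e' (inv e' g \<cdot>\<^bsub>J\<^esub> inv e' f))\<rparr>"
  define D' where "D' = \<lparr>OM = (\<lambda>x. OM D (inv e x)), AM = (\<lambda>a. AM D (inv e' a))\<rparr>"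
  note inj_simps [simp] = inj_eq[OF assms(2)] inj_eq[OF assms(3)]
  have "category J'"
    by unfold_locales (auto simp: J'_def hom_iff A.assoc_Comp)
  then have "Functor J' C D'"
    by (rule FunctorI[OF _ B.category_axioms]) (auto simp: J'_def D'_def AM_Comp')
  then obtain x \<pi> where lim: "is_limit J' C D' x \<pi>"
    using assms(1) unfolding complete_def by blast
  have cone: "is_cone J' C D' y \<rho> \<longleftrightarrow> is_cone J C D y (\<lambda>j. \<rho> (e j))" for y \<rho>
    by (auto simp: is_cone_def J'_def D'_def)
  have "is_limit J C D x (\<lambda>j. \<pi> (e j))"
    unfolding is_limit_def
  proof (intro conjI allI impI)
    show "is_cone J C D x (\<lambda>j. \<pi> (e j))"
      using lim cone by (simp add: is_limit_def)
    fix y \<rho> assume "is_cone J C D y \<rho>"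
    then have "is_cone J' C D' y (\<lambda>i. \<rho> (inv e i))"
      by (simp add: cone)
    then have "\<exists>!u. u \<in> hom C y x \<and> (\<forall>j\<in>Ob J'. \<pi> j \<cdot>\<^bsub>C\<^esub> u = \<rho> (inv e j))"
      using lim by (simp add: is_limit_def)
    then show "\<exists>!u. u \<in> hom C y x \<and> (\<forall>j\<in>Ob J. \<pi> (e j) \<cdot>\<^bsub>C\<^esub> u = \<rho> j)"
      by (simp add: J'_def)
  qed
  then show ?thesis by blast
qed

text \<open>
  An end is the limit of a diagram with nodes \<open>F(k,k)\<close> for the objects \<open>k\<close> and \<open>F(k,l)\<close> for the arrows
  \<open>f : k \<rightarrow> l\<close>; each \<open>f\<close> contributes arrows \<open>F(k,k) \<rightarrow> F(k,l)\<close> and \<open>F(l,l) \<rightarrow> F(k,l)\<close>. In a composable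
  pair of the shape one factor is an identity, so the composite is the other one.
\<close>

datatype ('x, 'y) wedge_node = Diagonal 'x | Mixed 'y
datatype ('x, 'y) wedge_arrow = Id_Diagonal 'x | Id_Mixed 'y | From_Dom 'y | From_Cod 'y

definition wedge_shape :: "('s, 't) cat \<Rightarrow> (('s, 't) wedge_node, ('s, 't) wedge_arrow) cat" where
  "wedge_shape K =
     \<lparr>Ob = Diagonal ` Ob K \<union> Mixed ` Arr K,
      Arr = Id_Diagonal ` Ob K \<union> Id_Mixed ` Arr K \<union> From_Dom ` Arr K \<union> From_Cod ` Arr K,
      Dom = case_wedge_arrow Diagonal Mixed (\<lambda>f. Diagonal (Dom K f)) (\<lambda>f. Diagonal (Cod K f)),
      Cod = case_wedge_arrow Diagonal Mixed Mixed Mixed,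
      Ide = case_wedge_node Id_Diagonal Id_Mixed,
      Comp = (\<lambda>g f. case f of Id_Diagonal _ \<Rightarrow> g | _ \<Rightarrow> f)\<rparr>"

definition wedge_diagram :: "('s, 't) cat \<Rightarrow> ('o, 'a) cat \<Rightarrow> ('s \<times> 's, 't \<times> 't, 'o, 'a) func \<Rightarrow>
    (('s, 't) wedge_node, ('s, 't) wedge_arrow, 'o, 'a) func" where
  "wedge_diagram K D F =
     \<lparr>OM = case_wedge_node (\<lambda>k. OM F (k, k)) (\<lambda>f. OM F (Dom K f, Cod K f)),
      AM = case_wedge_arrow (\<lambda>k. Ide D (OM F (k, k))) (\<lambda>f. Ide D (OM F (Dom K f, Cod K f)))
             (\<lambda>f. AM F (Ide K (Dom K f), f)) (\<lambda>f. AM F (f, Ide K (Cod K f)))\<rparr>"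

lemma is_wedge_iff: "is_wedge K D F x \<pi> \<longleftrightarrow> x \<in> Ob D \<and>
    (\<forall>k\<in>Ob K. \<pi> k \<in> Arr D \<and> Dom D (\<pi> k) = x \<and> Cod D (\<pi> k) = OM F (k, k)) \<and>
    (\<forall>f\<in>Arr K. AM F (Ide K (Dom K f), f) \<cdot>\<^bsub>D\<^esub> \<pi> (Dom K f) =
      AM F (f, Ide K (Cod K f)) \<cdot>\<^bsub>D\<^esub> \<pi> (Cod K f))"
  by (auto simp: is_wedge_def hom_iff)

text \<open>
  The first argument of \<open>c\<close> is a tag, so \<open>c\<close> embeds disjoint copies of the type in itself.
\<close>

lemma inj_pairs_of_infinite:
  assumes "infinite (UNIV :: 's set)"
  obtains c :: "nat \<Rightarrow> 's \<Rightarrow> 's" where "\<And>m n x y. c m x = c n y \<longleftrightarrow> m = n \<and> x = y"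
proof -
  obtain p :: "'s \<times> 's \<Rightarrow> 's" where p: "inj p"
    using card_of_Times_same_infinite[OF assms] by (auto simp: card_of_ordIso[symmetric] bij_betw_def)
  obtain i :: "nat \<Rightarrow> 's" where "inj i"
    using assms infinite_countable_subset by blast
  then have "p (i m, x) = p (i n, y) \<longleftrightarrow> m = n \<and> x = y" for m n x y
    using p by (simp add: inj_eq)
  then show thesis by (rule that)
qed

text \<open>
  The leg of a cone at a mixed node is forced by the leg at the domain of the arrow, and the second
  arrow into that node then imposes exactly the wedge condition.
\<close>

lemma end_exists:
  fixes K :: "('s, 's) cat"
  assumes "infinite (UNIV :: 's set)" "complete TYPE('s) D" "category K" "Functor (op K \<times>\<^sub>C K) D F"
  shows "\<exists>x \<pi>. is_end K D F x \<pi>"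
proof -
  interpret K: category K by fact
  interpret oK: category "op K" by (rule category_op[OF assms(3)])
  interpret F: Bifunctor "op K" K D F
    by (intro BifunctorI assms category_op)
  let ?J = "wedge_shape K" and ?D = "wedge_diagram K D F"
  have "category ?J"
    by unfold_locales (auto simp: wedge_shape_def hom_iff)
  then have "Functor ?J D ?D"
    by (rule FunctorI[OF _ F.D.category_axioms])
      (auto simp: wedge_shape_def wedge_diagram_def)
  moreover obtain c :: "nat \<Rightarrow> 's \<Rightarrow> 's" where c: "\<And>m n x y. c m x = c n y \<longleftrightarrow> m = n \<and> x = y"
    using inj_pairs_of_infinite[OF assms(1)] by blast
  have "inj (case_wedge_node (c 0) (c 1))"
    by (auto simp: inj_def c split: wedge_node.splits)
  moreover have "inj (case_wedge_arrow (c 0) (c 1) (c 2) (c 3))"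
    by (auto simp: inj_def c split: wedge_arrow.splits)
  ultimately obtain x \<pi> where lim: "is_limit ?J D ?D x \<pi>"
    using limit_exists_of_injections[OF assms(2)] by blast
  define mixed where "mixed \<rho> \<longleftrightarrow> (\<forall>f\<in>Arr K. \<rho> (Mixed f) =
      AM F (Ide K (Dom K f), f) \<cdot>\<^bsub>D\<^esub> \<rho> (Diagonal (Dom K f)))" for \<rho>
  have cone: "is_cone ?J D ?D y \<rho> \<longleftrightarrow> is_wedge K D F y (\<lambda>k. \<rho> (Diagonal k)) \<and> mixed \<rho>" for y \<rho>
  proof -
    have "AM F (Ide K (Dom K f), f) \<cdot>\<^bsub>D\<^esub> \<rho> (Diagonal (Dom K f)) \<in>
        hom D y (OM F (Dom K f, Cod K f))"
      if "is_wedge K D F y (\<lambda>k. \<rho> (Diagonal k))" "f \<in> Arr K" for f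
      using that K.Ob_Dom[OF that(2)] by (simp add: is_wedge_iff hom_iff)
    then have node: "\<rho> (Mixed f) \<in> hom D y (OM F (Dom K f, Cod K f))"
      if "is_wedge K D F y (\<lambda>k. \<rho> (Diagonal k))" "mixed \<rho>" "f \<in> Arr K" for f
      using that by (simp add: mixed_def)
    show ?thesis
    proof
      assume "is_cone ?J D ?D y \<rho>"
      then show "is_wedge K D F y (\<lambda>k. \<rho> (Diagonal k)) \<and> mixed \<rho>"
        by (auto simp: is_cone_def is_wedge_iff wedge_shape_def wedge_diagram_def hom_iff mixed_def ball_Un)
    next
      assume w: "is_wedge K D F y (\<lambda>k. \<rho> (Diagonal k)) \<and> mixed \<rho>"
      then have "Ide D (OM F (Dom K f, Cod K f)) \<cdot>\<^bsub>D\<^esub> \<rho> (Mixed f) = \<rho> (Mixed f)"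
        if "f \<in> Arr K" for f
        using node that by (simp add: hom_iff)
      with w node show "is_cone ?J D ?D y \<rho>"
        unfolding is_cone_def is_wedge_iff wedge_shape_def wedge_diagram_def
        by (auto simp: hom_iff mixed_def ball_Un)
    qed
  qed
  have "is_end K D F x (\<lambda>k. \<pi> (Diagonal k))"
    unfolding is_end_def
  proof (intro conjI allI impI)
    show "is_wedge K D F x (\<lambda>k. \<pi> (Diagonal k))"
      using lim cone by (simp add: is_limit_def)
    fix y \<rho> assume \<rho>: "is_wedge K D F y \<rho>"
    let ?\<rho> = "case_wedge_node \<rho> (\<lambda>f. AM F (Ide K (Dom K f), f) \<cdot>\<^bsub>D\<^esub> \<rho> (Dom K f))"
    have "is_cone ?J D ?D y ?\<rho>"
      using \<rho> by (simp add: cone mixed_def)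
    then have ex: "\<exists>!u. u \<in> hom D y x \<and> (\<forall>j\<in>Ob ?J. \<pi> j \<cdot>\<^bsub>D\<^esub> u = ?\<rho> j)"
      using lim by (simp add: is_limit_def)
    have "(\<forall>j\<in>Ob ?J. \<pi> j \<cdot>\<^bsub>D\<^esub> u = ?\<rho> j) \<longleftrightarrow> (\<forall>k\<in>Ob K. \<pi> (Diagonal k) \<cdot>\<^bsub>D\<^esub> u = \<rho> k)"
      if u: "u \<in> hom D y x" for u
    proof -
      have "\<pi> (Mixed f) \<cdot>\<^bsub>D\<^esub> u = AM F (Ide K (Dom K f), f) \<cdot>\<^bsub>D\<^esub> (\<pi> (Diagonal (Dom K f)) \<cdot>\<^bsub>D\<^esub> u)"
        if f: "f \<in> Arr K" for f
      proof -
        have "\<pi> (Mixed f) = AM F (Ide K (Dom K f), f) \<cdot>\<^bsub>D\<^esub> \<pi> (Diagonal (Dom K f))"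
          using lim f by (simp add: is_limit_def cone mixed_def)
        moreover have "\<pi> (Diagonal (Dom K f)) \<in> hom D x (OM F (Dom K f, Dom K f))"
          using lim K.Ob_Dom[OF f] by (simp add: is_limit_def cone is_wedge_iff hom_iff)
        ultimately show ?thesis
          using u f by (simp add: hom_iff F.D.assoc_Comp)
      qed
      then show ?thesis
        by (auto simp: wedge_shape_def ball_Un)
    qed
    with ex show "\<exists>!u. u \<in> hom D y x \<and> (\<forall>k\<in>Ob K. \<pi> (Diagonal k) \<cdot>\<^bsub>D\<^esub> u = \<rho> k)"
      by (metis (no_types, lifting))
  qed
  then show ?thesis by blast
qed

lemma is_end_the_end:
  assumes "\<exists>x \<pi>. is_end K D F x \<pi>"
  shows "is_end K D F (end_ob K D F) (end_pr K D F)"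
proof -
  have "\<exists>p. case p of (x, \<pi>) \<Rightarrow> is_end K D F x \<pi>" using assms by auto
  then have "case the_end K D F of (x, \<pi>) \<Rightarrow> is_end K D F x \<pi>"
    unfolding the_end_def by (rule someI_ex)
  then show ?thesis by (simp add: end_ob_def end_pr_def split_beta)
qed

text \<open>
  A copower is the colimit of a constant diagram over a discrete shape.
\<close>

lemma copower_exists:
  fixes I :: "'s set"
  assumes "cocomplete TYPE('s) C" "category C" "x \<in> Ob C"
  shows "\<exists>y \<iota>. is_copower C I x y \<iota>"
proof -
  interpret C: category C by fact
  define J :: "('s, 's) cat" where "J = \<lparr>Ob = I, Arr = I, Dom = (\<lambda>i. i), Cod = (\<lambda>i. i),
    Ide = (\<lambda>i. i), Comp = (\<lambda>g f. f)\<rparr>"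
  define D :: "('s, 's, 'a, 'b) func" where "D = \<lparr>OM = (\<lambda>i. x), AM = (\<lambda>i. Ide C x)\<rparr>"
  have "category J" by unfold_locales (auto simp: J_def hom_iff)
  then have "Functor J C D"
    by (rule FunctorI) (use assms in \<open>auto simp: J_def D_def\<close>)
  then obtain y \<iota> where lim: "is_limit (op J) (op C) D y \<iota>"
    using assms(1) unfolding cocomplete_def by blast
  have "is_cone (op J) (op C) D z \<kappa> \<longleftrightarrow> z \<in> Ob C \<and> (\<forall>i\<in>I. \<kappa> i \<in> hom C x z)" for z \<kappa>
    by (auto simp: is_cone_def J_def D_def hom_iff)
  then have "is_copower C I x y \<iota>"
    using lim by (simp add: is_limit_def is_copower_def) (simp add: J_def)
  then show ?thesis by blast
qed

lemma is_copower_the_copower: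
  assumes "\<exists>y \<iota>. is_copower C I x y \<iota>"
  shows "is_copower C I x (copower_ob C I x) (copower_in C I x)"
proof -
  have "\<exists>p. case p of (y, \<iota>) \<Rightarrow> is_copower C I x y \<iota>" using assms by auto
  then have "case the_copower C I x of (y, \<iota>) \<Rightarrow> is_copower C I x y \<iota>"
    unfolding the_copower_def by (rule someI_ex)
  then show ?thesis by (simp add: copower_ob_def copower_in_def split_beta)
qed

section \<open>The end of a bifunctor as a functor\<close>

text \<open>
  Bifunctors with the variance of a hom functor. Composites in \<open>op B\<close> are rewritten to composites in
  \<open>B\<close>, so the rules are restated for \<open>B\<close>. The second rule for composites acts in front of a further
  factor \<open>x\<close>; it merges adjacent values of \<open>R\<close> in right-nested composites.
\<close>

locale Hom_bifunctor = B: category B + R: Bifunctor "op B" D A R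
  for B :: "('p, 'b) cat" and D :: "('q, 'd) cat" and A :: "('o, 'a) cat" and R
begin

lemma R_Ide [simp]: "x \<in> Ob B \<Longrightarrow> y \<in> Ob D \<Longrightarrow> AM R (Ide B x, Ide D y) = Ide A (OM R (x, y))"
  using R.AM_Ide2[of x y] by simp

lemma R_Comp:
  assumes "f \<in> Arr B" "f' \<in> Arr B" "Cod B f' = Dom B f" "g \<in> Arr D" "g' \<in> Arr D" "Cod D g = Dom D g'"
  shows "AM R (f', g') \<cdot>\<^bsub>A\<^esub> AM R (f, g) = AM R (f \<cdot>\<^bsub>B\<^esub> f', g' \<cdot>\<^bsub>D\<^esub> g)"
  using assms by (simp add: R.AM_Comp2)

lemma R_Comp':
  assumes "f \<in> Arr B" "f' \<in> Arr B" "Cod B f' = Dom B f" "g \<in> Arr D" "g' \<in> Arr D" "Cod D g = Dom D g'"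
    and "x \<in> Arr A" "Cod A x = OM R (Cod B f, Dom D g)"
  shows "AM R (f', g') \<cdot>\<^bsub>A\<^esub> (AM R (f, g) \<cdot>\<^bsub>A\<^esub> x) = AM R (f \<cdot>\<^bsub>B\<^esub> f', g' \<cdot>\<^bsub>D\<^esub> g) \<cdot>\<^bsub>A\<^esub> x"
  using assms by (simp add: R.D.assoc_Comp[symmetric] R_Comp)

end

lemma Hom_bifunctorI:
  "category B \<Longrightarrow> category D \<Longrightarrow> Functor (op B \<times>\<^sub>C D) A R \<Longrightarrow> Hom_bifunctor B D A R"
  by (simp add: Hom_bifunctor_def BifunctorI category_op)

locale End_bifunctor = K: category K + Hom_bifunctor B D A R
  for K :: "('s, 's) cat" and B :: "('p, 'b) cat" and D :: "('q, 'd) cat"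
    and A :: "('o, 'a) cat" and R +
  assumes infinite_universe: "infinite (UNIV :: 's set)"
    and complete_A: "complete TYPE('s) A"
begin

sublocale KA: two_categories K A by unfold_locales
sublocale KB: two_categories K B by unfold_locales
sublocale KD: two_categories K D by unfold_locales

abbreviation "BK \<equiv> fun_cat K B"
abbreviation "DK \<equiv> fun_cat K D"
abbreviation "End X Y \<equiv> end_ob K A (bifun R X Y)"
abbreviation "pr X Y \<equiv> end_pr K A (bifun R X Y)"

lemma Functor_bifun:
  assumes "X \<in> Ob BK" "Y \<in> Ob DK"
  shows "Functor (op K \<times>\<^sub>C K) A (bifun R X Y)"
  by (rule FunctorI)
    (use assms in \<open>auto simp: bifun_def R_Comp KB.fc_Comp KD.fc_Comp
      intro!: category_prod category_op K.category_axioms R.D.category_axioms\<close>)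

lemma is_wedge_bifun: "X \<in> Ob BK \<Longrightarrow> Y \<in> Ob DK \<Longrightarrow> is_wedge K A (bifun R X Y) a \<rho> \<longleftrightarrow> a \<in> Ob A \<and>
    (\<forall>k\<in>Ob K. \<rho> k \<in> Arr A \<and> Dom A (\<rho> k) = a \<and> Cod A (\<rho> k) = OM R (OM X k, OM Y k)) \<and>
    (\<forall>f\<in>Arr K. AM R (Ide B (OM X (Dom K f)), AM Y f) \<cdot>\<^bsub>A\<^esub> \<rho> (Dom K f) =
      AM R (AM X f, Ide D (OM Y (Cod K f))) \<cdot>\<^bsub>A\<^esub> \<rho> (Cod K f))"
  by (simp add: is_wedge_iff bifun_def cong: conj_cong)

lemma is_end_pr:
  assumes "X \<in> Ob BK" "Y \<in> Ob DK"
  shows "is_end K A (bifun R X Y) (End X Y) (pr X Y)"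
  by (intro is_end_the_end end_exists[OF infinite_universe complete_A] K.category_axioms
      Functor_bifun assms)

lemma
  assumes "X \<in> Ob BK" "Y \<in> Ob DK"
  shows Ob_End [simp]: "End X Y \<in> Ob A"
    and Arr_pr [simp]: "k \<in> Ob K \<Longrightarrow> pr X Y k \<in> Arr A"
    and Dom_pr [simp]: "k \<in> Ob K \<Longrightarrow> Dom A (pr X Y k) = End X Y"
    and Cod_pr [simp]: "k \<in> Ob K \<Longrightarrow> Cod A (pr X Y k) = OM R (OM X k, OM Y k)"
    and pr_wedge: "f \<in> Arr K \<Longrightarrow> AM R (Ide B (OM X (Dom K f)), AM Y f) \<cdot>\<^bsub>A\<^esub> pr X Y (Dom K f) =
      AM R (AM X f, Ide D (OM Y (Cod K f))) \<cdot>\<^bsub>A\<^esub> pr X Y (Cod K f)"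
  using is_end_pr[OF assms] by (simp_all add: is_end_def is_wedge_bifun assms)

lemma End_univ:
  assumes "X \<in> Ob BK" "Y \<in> Ob DK" "is_wedge K A (bifun R X Y) a \<rho>"
  shows "\<exists>!u. u \<in> hom A a (End X Y) \<and> (\<forall>k\<in>Ob K. pr X Y k \<cdot>\<^bsub>A\<^esub> u = \<rho> k)"
  using is_end_pr[OF assms(1,2)] assms(3) by (simp add: is_end_def)

lemma End_eqI:
  assumes "X \<in> Ob BK" "Y \<in> Ob DK" "u \<in> Arr A" "v \<in> Arr A" "Dom A u = Dom A v"
    "Cod A u = End X Y" "Cod A v = End X Y"
    and eq: "\<And>k. k \<in> Ob K \<Longrightarrow> pr X Y k \<cdot>\<^bsub>A\<^esub> u = pr X Y k \<cdot>\<^bsub>A\<^esub> v"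
  shows "u = v"
proof -
  have "AM R (Ide B (OM X (Dom K f)), AM Y f) \<cdot>\<^bsub>A\<^esub> (pr X Y (Dom K f) \<cdot>\<^bsub>A\<^esub> u) =
      AM R (AM X f, Ide D (OM Y (Cod K f))) \<cdot>\<^bsub>A\<^esub> (pr X Y (Cod K f) \<cdot>\<^bsub>A\<^esub> u)" if "f \<in> Arr K" for f
    using assms(1-3,6) that by (simp add: R.D.assoc_Comp[symmetric] pr_wedge)
  then have "is_wedge K A (bifun R X Y) (Dom A u) (\<lambda>k. pr X Y k \<cdot>\<^bsub>A\<^esub> u)"
    using assms(1-3,6) by (simp add: is_wedge_bifun)
  from End_univ[OF assms(1,2) this]
  have unique: "w = w'" if "w \<in> hom A (Dom A u) (End X Y)" "w' \<in> hom A (Dom A u) (End X Y)"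
    "\<forall>k\<in>Ob K. pr X Y k \<cdot>\<^bsub>A\<^esub> w = pr X Y k \<cdot>\<^bsub>A\<^esub> u" "\<forall>k\<in>Ob K. pr X Y k \<cdot>\<^bsub>A\<^esub> w' = pr X Y k \<cdot>\<^bsub>A\<^esub> u"
    for w w' using that by blast
  show ?thesis
    by (rule unique) (use assms(3-7) eq in \<open>simp_all add: hom_iff\<close>)
qed

abbreviation "EndF \<equiv> end_functor K A R"

lemma OM_EndF [simp]: "OM EndF (X, Y) = End X Y"
  by (simp add: end_functor_def)

text \<open>
  \<open>R(X, Y f)\<close> moves past \<open>R(s, t)\<close> by naturality of \<open>t\<close>, is exchanged for \<open>R(X f, Y)\<close> by the wedge
  condition, and moves back by naturality of \<open>s\<close>.
\<close>

lemma end_map_wedge: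
  assumes s: "s \<in> Arr BK" and t: "t \<in> Arr DK"
  shows "is_wedge K A (bifun R (src s) (trg t)) (End (trg s) (src t))
    (\<lambda>k. AM R (cmp s k, cmp t k) \<cdot>\<^bsub>A\<^esub> pr (trg s) (src t) k)"
proof -
  have "AM R (Ide B (OM (src s) (Dom K f)), AM (trg t) f) \<cdot>\<^bsub>A\<^esub>
      (AM R (cmp s (Dom K f), cmp t (Dom K f)) \<cdot>\<^bsub>A\<^esub> pr (trg s) (src t) (Dom K f)) =
    AM R (AM (src s) f, Ide D (OM (trg t) (Cod K f))) \<cdot>\<^bsub>A\<^esub>
      (AM R (cmp s (Cod K f), cmp t (Cod K f)) \<cdot>\<^bsub>A\<^esub> pr (trg s) (src t) (Cod K f))"
    (is "?L = ?R") if f: "f \<in> Arr K" for f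
  proof -
    have "?L = AM R (cmp s (Dom K f), cmp t (Cod K f)) \<cdot>\<^bsub>A\<^esub>
        (AM R (Ide B (OM (trg s) (Dom K f)), AM (src t) f) \<cdot>\<^bsub>A\<^esub> pr (trg s) (src t) (Dom K f))"
      using s t f by (simp add: R_Comp' KD.fc_natural)
    also have "\<dots> = AM R (cmp s (Dom K f), cmp t (Cod K f)) \<cdot>\<^bsub>A\<^esub>
        (AM R (AM (trg s) f, Ide D (OM (src t) (Cod K f))) \<cdot>\<^bsub>A\<^esub> pr (trg s) (src t) (Cod K f))"
      using s t f by (simp add: pr_wedge)
    also have "\<dots> = ?R"
      using s t f by (simp add: R_Comp' KB.fc_natural)
    finally show ?thesis .
  qed
  then show ?thesis using s t by (simp add: is_wedge_bifun)
qed

lemma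
  assumes s: "s \<in> Arr BK" and t: "t \<in> Arr DK"
  shows Arr_EndF [simp]: "AM EndF (s, t) \<in> Arr A"
    and Dom_EndF [simp]: "Dom A (AM EndF (s, t)) = End (trg s) (src t)"
    and Cod_EndF [simp]: "Cod A (AM EndF (s, t)) = End (src s) (trg t)"
    and pr_EndF: "k \<in> Ob K \<Longrightarrow> pr (src s) (trg t) k \<cdot>\<^bsub>A\<^esub> AM EndF (s, t) =
      AM R (cmp s k, cmp t k) \<cdot>\<^bsub>A\<^esub> pr (trg s) (src t) k"
proof -
  have "\<exists>!u. u \<in> hom A (End (trg s) (src t)) (End (src s) (trg t)) \<and>
     (\<forall>k\<in>Ob K. pr (src s) (trg t) k \<cdot>\<^bsub>A\<^esub> u = AM R (cmp s k, cmp t k) \<cdot>\<^bsub>A\<^esub> pr (trg s) (src t) k)"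
    by (rule End_univ) (use s t end_map_wedge[OF s t] in auto)
  from theI'[OF this]
  show "AM EndF (s, t) \<in> Arr A" "Dom A (AM EndF (s, t)) = End (trg s) (src t)"
    "Cod A (AM EndF (s, t)) = End (src s) (trg t)"
    "k \<in> Ob K \<Longrightarrow> pr (src s) (trg t) k \<cdot>\<^bsub>A\<^esub> AM EndF (s, t) =
      AM R (cmp s k, cmp t k) \<cdot>\<^bsub>A\<^esub> pr (trg s) (src t) k"
    by (simp_all add: end_functor_def end_map_def hom_iff)
qed

lemma EndF_Ide: 
  assumes "X \<in> Ob BK" "Y \<in> Ob DK"
  shows "AM EndF (Ide BK X, Ide DK Y) = Ide A (End X Y)"
proof (rule End_eqI[OF assms])
  have I: "Ide BK X \<in> Arr BK" "Ide DK Y \<in> Arr DK" 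
    using assms by (simp_all only: category.Arr_Ide[OF KB.category_fun_cat] category.Arr_Ide[OF KD.category_fun_cat])
  fix k assume "k \<in> Ob K"
  with I assms show "pr X Y k \<cdot>\<^bsub>A\<^esub> AM EndF (Ide BK X, Ide DK Y) = pr X Y k \<cdot>\<^bsub>A\<^esub> Ide A (End X Y)"
    using pr_EndF[OF I, of k] by simp
qed (use assms in \<open>auto simp: category.Arr_Ide[OF KB.category_fun_cat, simplified]
  category.Arr_Ide[OF KD.category_fun_cat, simplified]\<close>)

lemma Functor_EndF: "Functor (op BK \<times>\<^sub>C DK) A EndF"
proof (rule FunctorI)
  show "category (op BK \<times>\<^sub>C DK)"
    by (intro category_prod category_op KB.category_fun_cat KD.category_fun_cat)
  show "category A" by (rule R.D.category_axioms)
  fix x assume "x \<in> Ob (op BK \<times>\<^sub>C DK)"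
  then show "AM EndF (Ide (op BK \<times>\<^sub>C DK) x) = Ide A (OM EndF x)"
    using EndF_Ide by (cases x) simp
next
  fix f g assume f: "f \<in> Arr (op BK \<times>\<^sub>C DK)" and g: "g \<in> Arr (op BK \<times>\<^sub>C DK)"
    and fg: "Cod (op BK \<times>\<^sub>C DK) f = Dom (op BK \<times>\<^sub>C DK) g"
  obtain s t s' t' where st: "f = (s, t)" "g = (s', t')" by fastforce
  with f g fg have s: "s \<in> Arr BK" "s' \<in> Arr BK" "trg s' = src s"
    and t: "t \<in> Arr DK" "t' \<in> Arr DK" "trg t = src t'" by auto
  note comp = KB.fc_Arr_Comp[OF s(2,1,3)] KD.fc_Arr_Comp[OF t]
  have "AM EndF (s \<cdot>\<^bsub>BK\<^esub> s', t' \<cdot>\<^bsub>DK\<^esub> t) = AM EndF (s', t') \<cdot>\<^bsub>A\<^esub> AM EndF (s, t)"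
  proof (rule End_eqI[of "src s'" "trg t'"])
    fix k assume k: "k \<in> Ob K"
    have "pr (src s') (trg t') k \<cdot>\<^bsub>A\<^esub> AM EndF (s \<cdot>\<^bsub>BK\<^esub> s', t' \<cdot>\<^bsub>DK\<^esub> t) =
       AM R (cmp s' k, cmp t' k) \<cdot>\<^bsub>A\<^esub> (AM R (cmp s k, cmp t k) \<cdot>\<^bsub>A\<^esub> pr (trg s) (src t) k)"
      using pr_EndF[OF comp k] s t k by (simp add: R_Comp')
    also have "\<dots> = AM R (cmp s' k, cmp t' k) \<cdot>\<^bsub>A\<^esub> pr (trg s') (src t') k \<cdot>\<^bsub>A\<^esub> AM EndF (s, t)"
      using pr_EndF[OF s(1) t(1) k] s t k by (simp add: R.D.assoc_Comp)
    also have "\<dots> = pr (src s') (trg t') k \<cdot>\<^bsub>A\<^esub> (AM EndF (s', t') \<cdot>\<^bsub>A\<^esub> AM EndF (s, t))"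
      using pr_EndF[OF s(2) t(2) k] s t k by (simp add: R.D.assoc_Comp[symmetric])
    finally show "pr (src s') (trg t') k \<cdot>\<^bsub>A\<^esub> AM EndF (s \<cdot>\<^bsub>BK\<^esub> s', t' \<cdot>\<^bsub>DK\<^esub> t) =
      pr (src s') (trg t') k \<cdot>\<^bsub>A\<^esub> (AM EndF (s', t') \<cdot>\<^bsub>A\<^esub> AM EndF (s, t))" .
  qed (use s t Arr_EndF[OF comp] Dom_EndF[OF comp] Cod_EndF[OF comp] in auto)
  then show "AM EndF (g \<cdot>\<^bsub>op BK \<times>\<^sub>C DK\<^esub> f) = AM EndF g \<cdot>\<^bsub>A\<^esub> AM EndF f"
    using st by simp
qed auto

end

section \<open>Currying\<close>

text \<open>The functor \<open>P \<rightarrow> A\<^sup>K\<close> that corresponds to \<open>G : K \<times> P \<rightarrow> A\<close>\<close>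

definition curry_ob where
  "curry_ob K P G p = \<lparr>OM = (\<lambda>k\<in>Ob K. OM G (k, p)), AM = (\<lambda>f\<in>Arr K. AM G (f, Ide P p))\<rparr>"

definition curry_functor where
  "curry_functor K P G = \<lparr>OM = curry_ob K P G,
     AM = (\<lambda>q. \<lparr>src = curry_ob K P G (Dom P q), trg = curry_ob K P G (Cod P q),
                cmp = (\<lambda>k\<in>Ob K. AM G (Ide K k, q))\<rparr>)\<rparr>"

lemma (in Bifunctor) Functor_curry: "Functor B (fun_cat A D) (curry_functor A B F)"
proof (rule FunctorI)
  interpret AD: two_categories A D by unfold_locales
  show "category B" by unfold_locales
  show "category (fun_cat A D)" by (rule AD.category_fun_cat)
  show *: "OM (curry_functor A B F) y \<in> Ob (fun_cat A D)" if "y \<in> Ob B" for y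
    using that by (intro AD.Ob_fun_catI) (auto simp: curry_functor_def curry_ob_def AM_Comp2)
  show "AM (curry_functor A B F) q \<in> Arr (fun_cat A D) \<and>
      Dom (fun_cat A D) (AM (curry_functor A B F) q) = OM (curry_functor A B F) (Dom B q) \<and>
      Cod (fun_cat A D) (AM (curry_functor A B F) q) = OM (curry_functor A B F) (Cod B q)"
    if "q \<in> Arr B" for q
    using that *[of "Dom B q"] *[of "Cod B q"]
    by (auto simp: curry_functor_def intro!: Arr_fun_catI)
      (auto simp: curry_ob_def AM_Comp2)
  show "AM (curry_functor A B F) (Ide B y) = Ide (fun_cat A D) (OM (curry_functor A B F) y)"
    if "y \<in> Ob B" for y
    using that by (auto simp: curry_functor_def curry_ob_def intro!: restrict_ext)
  show "AM (curry_functor A B F) (q' \<cdot>\<^bsub>B\<^esub> q) =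
      AM (curry_functor A B F) q' \<cdot>\<^bsub>fun_cat A D\<^esub> AM (curry_functor A B F) q"
    if "q \<in> Arr B" "q' \<in> Arr B" "Cod B q = Dom B q'" for q q'
    using that by (auto simp: curry_functor_def AM_Comp2 intro!: restrict_ext)
qed

section \<open>Copowers\<close>

lemma is_copower_iff: "is_copower C I x y \<iota> \<longleftrightarrow> y \<in> Ob C \<and>
    (\<forall>i\<in>I. \<iota> i \<in> Arr C \<and> Dom C (\<iota> i) = x \<and> Cod C (\<iota> i) = y) \<and>
    (\<forall>z \<kappa>. z \<in> Ob C \<and> (\<forall>i\<in>I. \<kappa> i \<in> hom C x z)
        \<longrightarrow> (\<exists>!u. u \<in> hom C y z \<and> (\<forall>i\<in>I. u \<cdot>\<^bsub>C\<^esub> \<iota> i = \<kappa> i)))"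
  by (auto simp: is_copower_def hom_iff)

lemma copower_eqI:
  assumes "is_copower C I x y \<iota>" "category C" "u \<in> hom C y z" "v \<in> hom C y z"
    and "\<And>i. i \<in> I \<Longrightarrow> u \<cdot>\<^bsub>C\<^esub> \<iota> i = v \<cdot>\<^bsub>C\<^esub> \<iota> i"
  shows "u = v"
proof -
  interpret category C by fact
  have "z \<in> Ob C" using assms(3) Ob_Cod by (auto simp: hom_iff)
  moreover have "\<forall>i\<in>I. u \<cdot>\<^bsub>C\<^esub> \<iota> i \<in> hom C x z" 
    using assms(1,3) by (simp add: is_copower_iff hom_iff)
  ultimately have "\<exists>!w. w \<in> hom C y z \<and> (\<forall>i\<in>I. w \<cdot>\<^bsub>C\<^esub> \<iota> i = u \<cdot>\<^bsub>C\<^esub> \<iota> i)"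
    using assms(1) by (simp add: is_copower_def)
  then show ?thesis using assms(3-5) by metis
qed

lemma copower_factor:
  assumes "is_copower C I x y \<iota>" "z \<in> Ob C" "\<forall>i\<in>I. \<kappa> i \<in> hom C x z"
  shows "\<exists>u. u \<in> hom C y z \<and> (\<forall>i\<in>I. u \<cdot>\<^bsub>C\<^esub> \<iota> i = \<kappa> i)"
proof -
  have "\<exists>!u. u \<in> hom C y z \<and> (\<forall>i\<in>I. u \<cdot>\<^bsub>C\<^esub> \<iota> i = \<kappa> i)"
    using assms by (simp add: is_copower_def)
  then show ?thesis by blast
qed

lemma is_copowerI:
  assumes "category C" "y \<in> Ob C" "\<And>i. i \<in> I \<Longrightarrow> \<iota> i \<in> hom C x y"
    and "\<And>z \<kappa>. z \<in> Ob C \<Longrightarrow> (\<And>i. i \<in> I \<Longrightarrow> \<kappa> i \<in> hom C x z) \<Longrightarrow>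
      \<exists>u. u \<in> hom C y z \<and> (\<forall>i\<in>I. u \<cdot>\<^bsub>C\<^esub> \<iota> i = \<kappa> i)"
    and "\<And>z u v. z \<in> Ob C \<Longrightarrow> u \<in> hom C y z \<Longrightarrow> v \<in> hom C y z \<Longrightarrow>
      (\<And>i. i \<in> I \<Longrightarrow> u \<cdot>\<^bsub>C\<^esub> \<iota> i = v \<cdot>\<^bsub>C\<^esub> \<iota> i) \<Longrightarrow> u = v"
  shows "is_copower C I x y \<iota>"
  unfolding is_copower_def
proof (intro conjI ballI allI impI)
  fix z \<kappa> assume z: "z \<in> Ob C \<and> (\<forall>i\<in>I. \<kappa> i \<in> hom C x z)"
  then obtain u where u: "u \<in> hom C y z" "\<forall>i\<in>I. u \<cdot>\<^bsub>C\<^esub> \<iota> i = \<kappa> i"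
    using assms(4) by blast
  show "\<exists>!u. u \<in> hom C y z \<and> (\<forall>i\<in>I. u \<cdot>\<^bsub>C\<^esub> \<iota> i = \<kappa> i)"
  proof (rule ex1I[of _ u])
    fix v assume "v \<in> hom C y z \<and> (\<forall>i\<in>I. v \<cdot>\<^bsub>C\<^esub> \<iota> i = \<kappa> i)"
    then show "v = u" using assms(5)[of z v u] u z by simp
  qed (use u in simp)
qed (use assms in auto)

lemma is_copower_iso:
  assumes C: "category C" and cop: "is_copower C I x y \<iota>"
    and e: "is_iso C x' x e" and d: "is_iso C y y' d"
  shows "is_copower C I x' y' (\<lambda>i. d \<cdot>\<^bsub>C\<^esub> (\<iota> i \<cdot>\<^bsub>C\<^esub> e))"
proof -
  interpret C: category C by fact
  obtain e' where e': "e \<in> Arr C" "Dom C e = x'" "Cod C e = x" "e' \<in> Arr C" "Dom C e' = x" "Cod C e' = x'"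
    "e' \<cdot>\<^bsub>C\<^esub> e = Ide C x'" "e \<cdot>\<^bsub>C\<^esub> e' = Ide C x"
    using e by (rule is_isoE)
  obtain d' where d': "d \<in> Arr C" "Dom C d = y" "Cod C d = y'" "d' \<in> Arr C" "Dom C d' = y'" "Cod C d' = y"
    "d' \<cdot>\<^bsub>C\<^esub> d = Ide C y" "d \<cdot>\<^bsub>C\<^esub> d' = Ide C y'"
    using d by (rule is_isoE)
  have \<iota>: "\<iota> i \<in> Arr C" "Dom C (\<iota> i) = x" "Cod C (\<iota> i) = y" if "i \<in> I" for i
    using cop that by (simp_all add: is_copower_iff)
  have y': "y' \<in> Ob C" using C.Ob_Cod[OF d'(1)] d'(3) by simp
  show ?thesis
  proof (rule is_copowerI[OF C y'])
    show "d \<cdot>\<^bsub>C\<^esub> (\<iota> i \<cdot>\<^bsub>C\<^esub> e) \<in> hom C x' y'" if "i \<in> I" for i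
      using that \<iota> d' e' by (simp add: hom_iff)
  next
    fix z \<kappa> assume z: "z \<in> Ob C" and \<kappa>: "\<And>i. i \<in> I \<Longrightarrow> \<kappa> i \<in> hom C x' z"
    then have "\<forall>i\<in>I. \<kappa> i \<cdot>\<^bsub>C\<^esub> e' \<in> hom C x z"
      using e' by (simp add: hom_iff)
    from copower_factor[OF cop z this]
    obtain u where u: "u \<in> hom C y z" "\<And>i. i \<in> I \<Longrightarrow> u \<cdot>\<^bsub>C\<^esub> \<iota> i = \<kappa> i \<cdot>\<^bsub>C\<^esub> e'" by blast
    have "u \<cdot>\<^bsub>C\<^esub> d' \<cdot>\<^bsub>C\<^esub> (d \<cdot>\<^bsub>C\<^esub> (\<iota> i \<cdot>\<^bsub>C\<^esub> e)) = \<kappa> i" if i: "i \<in> I" for i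
    proof -
      have "u \<cdot>\<^bsub>C\<^esub> d' \<cdot>\<^bsub>C\<^esub> (d \<cdot>\<^bsub>C\<^esub> (\<iota> i \<cdot>\<^bsub>C\<^esub> e)) = u \<cdot>\<^bsub>C\<^esub> (d' \<cdot>\<^bsub>C\<^esub> d) \<cdot>\<^bsub>C\<^esub> (\<iota> i \<cdot>\<^bsub>C\<^esub> e)"
        using u(1) \<iota>[OF i] d'(1-6) e'(1-6) by (simp add: hom_iff C.assoc_Comp)
      also have "\<dots> = u \<cdot>\<^bsub>C\<^esub> \<iota> i \<cdot>\<^bsub>C\<^esub> e"
        using u(1) \<iota>[OF i] d' e'(1-6) by (simp add: hom_iff C.assoc_Comp)
      also have "\<dots> = \<kappa> i \<cdot>\<^bsub>C\<^esub> (e' \<cdot>\<^bsub>C\<^esub> e)"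
        using u(2)[OF i] \<kappa>[OF i] e'(1-6) by (simp add: hom_iff C.assoc_Comp)
      finally show ?thesis using \<kappa>[OF i] e' by (simp add: hom_iff)
    qed
    moreover have "u \<cdot>\<^bsub>C\<^esub> d' \<in> hom C y' z" using u d' by (simp add: hom_iff)
    ultimately show "\<exists>u. u \<in> hom C y' z \<and> (\<forall>i\<in>I. u \<cdot>\<^bsub>C\<^esub> (d \<cdot>\<^bsub>C\<^esub> (\<iota> i \<cdot>\<^bsub>C\<^esub> e)) = \<kappa> i)"
      by blast
  next
    fix z u v assume u: "u \<in> hom C y' z" and v: "v \<in> hom C y' z"
      and eq: "\<And>i. i \<in> I \<Longrightarrow> u \<cdot>\<^bsub>C\<^esub> (d \<cdot>\<^bsub>C\<^esub> (\<iota> i \<cdot>\<^bsub>C\<^esub> e)) = v \<cdot>\<^bsub>C\<^esub> (d \<cdot>\<^bsub>C\<^esub> (\<iota> i \<cdot>\<^bsub>C\<^esub> e))"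
    have *: "w \<cdot>\<^bsub>C\<^esub> d \<cdot>\<^bsub>C\<^esub> \<iota> i = w \<cdot>\<^bsub>C\<^esub> (d \<cdot>\<^bsub>C\<^esub> (\<iota> i \<cdot>\<^bsub>C\<^esub> e)) \<cdot>\<^bsub>C\<^esub> e'"
      if "w \<in> hom C y' z" "i \<in> I" for w i
    proof -
      have "w \<cdot>\<^bsub>C\<^esub> (d \<cdot>\<^bsub>C\<^esub> (\<iota> i \<cdot>\<^bsub>C\<^esub> e)) \<cdot>\<^bsub>C\<^esub> e' = w \<cdot>\<^bsub>C\<^esub> (d \<cdot>\<^bsub>C\<^esub> (\<iota> i \<cdot>\<^bsub>C\<^esub> (e \<cdot>\<^bsub>C\<^esub> e')))"
        using that \<iota> d'(1-6) e'(1-6) by (simp add: hom_iff C.assoc_Comp)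
      then show ?thesis
        using that \<iota> d'(1-6) e' by (simp add: hom_iff C.assoc_Comp)
    qed
    have "u \<cdot>\<^bsub>C\<^esub> d = v \<cdot>\<^bsub>C\<^esub> d"
      by (rule copower_eqI[OF cop C, of _ z]) (use u v d' * eq in \<open>auto simp: hom_iff\<close>)
    then have "u \<cdot>\<^bsub>C\<^esub> d \<cdot>\<^bsub>C\<^esub> d' = v \<cdot>\<^bsub>C\<^esub> d \<cdot>\<^bsub>C\<^esub> d'" by simp
    then show "u = v" using u v d' by (simp add: hom_iff C.assoc_Comp)
  qed
qed

lemma is_copower_cong:
  "is_copower C I x y \<iota> \<Longrightarrow> (\<And>i. i \<in> I \<Longrightarrow> \<iota> i = \<iota>' i) \<Longrightarrow> is_copower C I x y \<iota>'"
  by (simp add: is_copower_def)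

text \<open>
  Transposition turns a family \<open>L x \<rightarrow> z\<close> into a family \<open>x \<rightarrow> r z\<close>, which factors through the copower.
  The left adjoint is given by plain functions \<open>L\<close> on objects and \<open>L'\<close> on arrows, so that the lemma
  applies directly to a bifunctor with one argument fixed.
\<close>

lemma left_adjoint_preserves_copower:
  assumes A: "category A" and D: "category D" and cop: "is_copower A I x y \<iota>" and x: "x \<in> Ob A"
    and L_Ob: "\<And>a. a \<in> Ob A \<Longrightarrow> L a \<in> Ob D"
    and L_Arr: "\<And>a a' f. f \<in> hom A a a' \<Longrightarrow> L' f \<in> hom D (L a) (L a')"
    and r: "\<And>d. d \<in> Ob D \<Longrightarrow> r d \<in> Ob A"
    and bij: "\<And>a d. a \<in> Ob A \<Longrightarrow> d \<in> Ob D \<Longrightarrow> bij_betw (\<phi> a d) (hom D (L a) d) (hom A a (r d))"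
    and natural: "\<And>a a' d f u. f \<in> hom A a' a \<Longrightarrow> d \<in> Ob D \<Longrightarrow> u \<in> hom D (L a) d \<Longrightarrow>
      \<phi> a' d (u \<cdot>\<^bsub>D\<^esub> L' f) = \<phi> a d u \<cdot>\<^bsub>A\<^esub> f"
  shows "is_copower D I (L x) (L y) (\<lambda>i. L' (\<iota> i))"
proof -
  interpret A: category A by fact
  interpret D: category D by fact
  have y: "y \<in> Ob A" and \<iota>: "\<And>i. i \<in> I \<Longrightarrow> \<iota> i \<in> hom A x y"
    using cop by (simp_all add: is_copower_def)
  have L\<iota>: "L' (\<iota> i) \<in> hom D (L x) (L y)" if "i \<in> I" for i
    using L_Arr \<iota> that by blast
  show ?thesis
  proof (rule is_copowerI[OF D L_Ob[OF y] L\<iota>])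
    fix z \<kappa> assume z: "z \<in> Ob D" and \<kappa>: "\<And>i. i \<in> I \<Longrightarrow> \<kappa> i \<in> hom D (L x) z"
    then have "\<forall>i\<in>I. \<phi> x z (\<kappa> i) \<in> hom A x (r z)"
      using bij[OF x z] by (meson bij_betwE)
    from copower_factor[OF cop r[OF z] this]
    obtain w where w: "w \<in> hom A y (r z)" "\<And>i. i \<in> I \<Longrightarrow> w \<cdot>\<^bsub>A\<^esub> \<iota> i = \<phi> x z (\<kappa> i)" by blast
    then obtain u where u: "u \<in> hom D (L y) z" "w = \<phi> y z u"
      using bij[OF y z] by (auto simp: bij_betw_def)
    have "u \<cdot>\<^bsub>D\<^esub> L' (\<iota> i) = \<kappa> i" if i: "i \<in> I" for i
    proof (rule inj_onD[OF bij_betw_imp_inj_on[OF bij[OF x z]]])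
      show "\<phi> x z (u \<cdot>\<^bsub>D\<^esub> L' (\<iota> i)) = \<phi> x z (\<kappa> i)"
        using natural[OF \<iota>[OF i] z u(1)] u(2) w(2)[OF i] by simp
      show "u \<cdot>\<^bsub>D\<^esub> L' (\<iota> i) \<in> hom D (L x) z" "\<kappa> i \<in> hom D (L x) z"
        using D.Comp_in[OF L\<iota>[OF i] u(1)] \<kappa>[OF i] by simp_all
    qed
    with u show "\<exists>u. u \<in> hom D (L y) z \<and> (\<forall>i\<in>I. u \<cdot>\<^bsub>D\<^esub> L' (\<iota> i) = \<kappa> i)" by blast
  next
    fix z u v assume z: "z \<in> Ob D" and u: "u \<in> hom D (L y) z" and v: "v \<in> hom D (L y) z"
      and eq: "\<And>i. i \<in> I \<Longrightarrow> u \<cdot>\<^bsub>D\<^esub> L' (\<iota> i) = v \<cdot>\<^bsub>D\<^esub> L' (\<iota> i)"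
    have "\<phi> y z u = \<phi> y z v"
    proof (rule copower_eqI[OF cop A])
      show "\<phi> y z u \<in> hom A y (r z)" "\<phi> y z v \<in> hom A y (r z)"
        using bij[OF y z] u v by (meson bij_betwE)+
      show "\<phi> y z u \<cdot>\<^bsub>A\<^esub> \<iota> i = \<phi> y z v \<cdot>\<^bsub>A\<^esub> \<iota> i" if "i \<in> I" for i
        using natural[OF \<iota>[OF that] z u] natural[OF \<iota>[OF that] z v] eq[OF that] by simp
    qed
    then show "u = v"
      using inj_onD[OF bij_betw_imp_inj_on[OF bij[OF y z]]] u v by blast
  qed
qed

section \<open>The functors \<open>h\<^sub>k\<close>\<close>

locale copowers_of_unit = symmetric_monoidal_diagrams K V
  for K :: "('s, 's) cat" and V :: "('o, 'a) monoidal" +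
  assumes cocomplete_V: "cocomplete TYPE('s) (mcat V)"
begin

abbreviation "hh \<equiv> h_ob K V"

text \<open>
  The summand inclusion \<open>1 \<rightarrow> h\<^sub>k(l)\<close> indexed by \<open>g : k \<rightarrow> l\<close>; the indices \<open>k\<close> and \<open>l\<close> are read off from \<open>g\<close>.
\<close>

definition inc :: "'s \<Rightarrow> 'a" where
  "inc g = copower_in (mcat V) (hom K (Dom K g) (Cod K g)) I g"

lemma is_copower_h:
  assumes "l \<in> Ob K"
  shows "is_copower (mcat V) (hom K k l) I (OM (hh k) l) inc"
proof -
  have "is_copower (mcat V) (hom K k l) I (OM (hh k) l) (copower_in (mcat V) (hom K k l) I)"
    using is_copower_the_copower[OF copower_exists[OF cocomplete_V tens.B.category_axioms unit_in]] assms
    by (simp add: h_ob_def)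
  then show ?thesis
    by (rule is_copower_cong) (simp add: hom_iff inc_def)
qed

lemma Ob_hh [simp]: "l \<in> Ob K \<Longrightarrow> OM (hh k) l \<in> ObV"
  using is_copower_h[of l k] by (simp add: is_copower_def)

lemma
  assumes "g \<in> Arr K"
  shows Arr_inc [simp]: "inc g \<in> Arr (mcat V)"
    and Dom_inc [simp]: "Dom (mcat V) (inc g) = I"
    and Cod_inc [simp]: "Cod (mcat V) (inc g) = OM (hh (Dom K g)) (Cod K g)"
  using is_copower_h[of "Cod K g" "Dom K g"] assms by (auto simp: is_copower_iff hom_iff)

lemma h_eqI:
  assumes "l \<in> Ob K" "u \<in> homV (OM (hh k) l) z" "v \<in> homV (OM (hh k) l) z"
    and "\<And>g. g \<in> Arr K \<Longrightarrow> Dom K g = k \<Longrightarrow> Cod K g = l \<Longrightarrow> u \<bullet> inc g = v \<bullet> inc g"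
  shows "u = v"
  by (rule copower_eqI[OF is_copower_h[OF assms(1), of k] tens.B.category_axioms assms(2,3)])
    (use assms(4) in \<open>simp add: hom_iff\<close>)

text \<open>
  Both functorialities of \<open>h\<close>, in \<open>l\<close> by postcomposition and in \<open>k\<close> by precomposition, reindex the
  summands, so equations between the induced arrows reduce to equations in \<open>K\<close>.
\<close>

lemma h_map:
  assumes k: "k \<in> Ob K" "k' \<in> Ob K" "l \<in> Ob K" "l' \<in> Ob K" and r: "\<And>g. g \<in> hom K k l \<Longrightarrow> r g \<in> hom K k' l'"
  defines "m \<equiv> copower_map (mcat V) I (hom K k l) (hom K k' l') r"
  shows "m \<in> homV (OM (hh k) l) (OM (hh k') l')"
    and "g \<in> hom K k l \<Longrightarrow> m \<bullet> inc g = inc (r g)"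
proof -
  have "\<exists>!u. u \<in> homV (OM (hh k) l) (OM (hh k') l') \<and> (\<forall>g\<in>hom K k l. u \<bullet> inc g = inc (r g))"
  proof -
    have "\<forall>g\<in>hom K k l. inc (r g) \<in> homV I (OM (hh k') l')"
      using r by (simp add: hom_iff)
    with is_copower_h[OF k(3), of k] Ob_hh[OF k(4), of k'] show ?thesis
      by (simp add: is_copower_def)
  qed
  then have "\<exists>!u. u \<in> homV (copower_ob (mcat V) (hom K k l) I) (copower_ob (mcat V) (hom K k' l') I) \<and>
     (\<forall>g\<in>hom K k l. u \<bullet> copower_in (mcat V) (hom K k l) I g = copower_in (mcat V) (hom K k' l') I (r g))"
    using k r by (simp add: h_ob_def hom_iff inc_def cong: conj_cong)
  from theI'[OF this] r show "m \<in> homV (OM (hh k) l) (OM (hh k') l')"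
    "g \<in> hom K k l \<Longrightarrow> m \<bullet> inc g = inc (r g)"
    using k by (simp_all add: m_def copower_map_def h_ob_def hom_iff inc_def)
qed

lemma
  assumes "k \<in> Ob K" "f \<in> Arr K"
  shows Arr_hh [simp]: "AM (hh k) f \<in> Arr (mcat V)"
    and Dom_hh [simp]: "Dom (mcat V) (AM (hh k) f) = OM (hh k) (Dom K f)"
    and Cod_hh [simp]: "Cod (mcat V) (AM (hh k) f) = OM (hh k) (Cod K f)"
    and hh_inc: "g \<in> Arr K \<Longrightarrow> Dom K g = k \<Longrightarrow> Cod K g = Dom K f \<Longrightarrow> AM (hh k) f \<bullet> inc g = inc (f \<cdot>\<^bsub>K\<^esub> g)"
proof -
  have AM: "AM (hh k) f =
      copower_map (mcat V) I (hom K k (Dom K f)) (hom K k (Cod K f)) (\<lambda>g. f \<cdot>\<^bsub>K\<^esub> g)"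
    using assms by (simp add: h_ob_def)
  have r: "\<And>g. g \<in> hom K k (Dom K f) \<Longrightarrow> f \<cdot>\<^bsub>K\<^esub> g \<in> hom K k (Cod K f)"
    using assms by (simp add: hom_iff)
  show "AM (hh k) f \<in> Arr (mcat V)" "Dom (mcat V) (AM (hh k) f) = OM (hh k) (Dom K f)"
    "Cod (mcat V) (AM (hh k) f) = OM (hh k) (Cod K f)"
    "g \<in> Arr K \<Longrightarrow> Dom K g = k \<Longrightarrow> Cod K g = Dom K f \<Longrightarrow> AM (hh k) f \<bullet> inc g = inc (f \<cdot>\<^bsub>K\<^esub> g)"
    using h_map[OF assms(1,1) K.Ob_Dom[OF assms(2)] K.Ob_Cod[OF assms(2)] r] assms
    unfolding AM by (simp_all add: hom_iff)
qed

lemma Ob_h [simp]: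
  assumes k: "k \<in> Ob K"
  shows "hh k \<in> Ob VK"
proof (rule T.KA.Ob_fun_catI)
  show "OM (hh k) \<in> extensional (Ob K)" "AM (hh k) \<in> extensional (Arr K)"
    by (simp_all add: h_ob_def)
  show "AM (hh k) (Ide K l) = Ide (mcat V) (OM (hh k) l)" if "l \<in> Ob K" for l
    by (rule h_eqI[of l _ k "OM (hh k) l"]) (use k that in \<open>simp_all add: hom_iff hh_inc\<close>)
  show "AM (hh k) (f' \<cdot>\<^bsub>K\<^esub> f) = AM (hh k) f' \<bullet> AM (hh k) f"
    if "f \<in> Arr K" "f' \<in> Arr K" "Cod K f = Dom K f'" for f f'
    by (rule h_eqI[of "Dom K f" _ k "OM (hh k) (Cod K f')"])
      (use k that in \<open>simp_all add: hom_iff hh_inc tens.B.assoc_Comp K.assoc_Comp\<close>)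
qed (use k in simp_all)

abbreviation "hF \<equiv> h_functor K V"

lemma OM_hF [simp]: "OM hF = hh"
  and src_hF [simp]: "src (AM hF e) = hh (Cod K e)"
  and trg_hF [simp]: "trg (AM hF e) = hh (Dom K e)"
  by (simp_all add: h_functor_def)

lemma
  assumes "e \<in> Arr K" "l \<in> Ob K"
  shows hF_in: "cmp (AM hF e) l \<in> homV (OM (hh (Cod K e)) l) (OM (hh (Dom K e)) l)"
    and hF_inc: "g \<in> Arr K \<Longrightarrow> Dom K g = Cod K e \<Longrightarrow> Cod K g = l \<Longrightarrow> 
      cmp (AM hF e) l \<bullet> inc g = inc (g \<cdot>\<^bsub>K\<^esub> e)"
proof -
  have AM: "cmp (AM hF e) l = copower_map (mcat V) I (hom K (Cod K e) l) (hom K (Dom K e) l) (\<lambda>g. g \<cdot>\<^bsub>K\<^esub> e)"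
    using assms by (simp add: h_functor_def)
  have r: "\<And>g. g \<in> hom K (Cod K e) l \<Longrightarrow> g \<cdot>\<^bsub>K\<^esub> e \<in> hom K (Dom K e) l"
    using assms by (simp add: hom_iff)
  show "cmp (AM hF e) l \<in> homV (OM (hh (Cod K e)) l) (OM (hh (Dom K e)) l)"
    "g \<in> Arr K \<Longrightarrow> Dom K g = Cod K e \<Longrightarrow> Cod K g = l \<Longrightarrow> cmp (AM hF e) l \<bullet> inc g = inc (g \<cdot>\<^bsub>K\<^esub> e)"
    using h_map[OF K.Ob_Cod[OF assms(1)] K.Ob_Dom[OF assms(1)] assms(2,2) r]
    unfolding AM by (simp_all add: hom_iff)
qed

lemma Arr_hF [simp]:
  assumes e: "e \<in> Arr K"
  shows "AM hF e \<in> Arr VK"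
proof (rule Arr_fun_catI)
  show "cmp (AM hF e) \<in> extensional (Ob K)" by (simp add: h_functor_def)
  fix f assume f: "f \<in> Arr K"
  show "cmp (AM hF e) (Cod K f) \<bullet> AM (src (AM hF e)) f = AM (trg (AM hF e)) f \<bullet> cmp (AM hF e) (Dom K f)"
    by (rule h_eqI[of "Dom K f" _ "Cod K e" "OM (hh (Dom K e)) (Cod K f)"])
      (use e f hF_in[OF e, of "Dom K f"] hF_in[OF e, of "Cod K f"] in
        \<open>simp_all add: hom_iff hh_inc hF_inc tens.B.assoc_Comp K.assoc_Comp\<close>)
qed (use e hF_in[OF e] in \<open>simp_all add: hom_iff\<close>)

lemma hF_Ide:
  assumes k: "k \<in> Ob K"
  shows "AM hF (Ide K k) = Ide VK (hh k)"
proof (rule Arr_fun_cat_eqI)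
  show "AM hF (Ide K k) \<in> Arr VK" using k by simp
  show "Ide VK (hh k) \<in> Arr VK" by (rule category.Arr_Ide[OF T.KA.category_fun_cat Ob_h[OF k]])
  show "src (AM hF (Ide K k)) = src (Ide VK (hh k))" "trg (AM hF (Ide K k)) = trg (Ide VK (hh k))"
    using k by simp_all
  fix l assume l: "l \<in> Ob K"
  show "cmp (AM hF (Ide K k)) l = cmp (Ide VK (hh k)) l"
  proof (rule h_eqI[of l _ k "OM (hh k) l"])
    show "cmp (AM hF (Ide K k)) l \<in> homV (OM (hh k) l) (OM (hh k) l)"
      using hF_in[of "Ide K k" l] k l by simp
    show "cmp (Ide VK (hh k)) l \<in> homV (OM (hh k) l) (OM (hh k) l)"
      using l by (simp add: hom_iff)
    fix g assume g: "g \<in> Arr K" "Dom K g = k" "Cod K g = l"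
    then show "cmp (AM hF (Ide K k)) l \<bullet> inc g = cmp (Ide VK (hh k)) l \<bullet> inc g"
      using hF_inc[of "Ide K k" l g] k l by simp
  qed (rule l)
qed

lemma Functor_hF: "Functor (op K) VK hF"
proof (rule FunctorI)
  show "category (op K)" by (rule category_op[OF K.category_axioms])
  show "category VK" by (rule T.KA.category_fun_cat)
  show "AM hF (Ide (op K) k) = Ide VK (OM hF k)" if "k \<in> Ob (op K)" for k
    using hF_Ide that by simp
  fix e e' assume "e \<in> Arr (op K)" "e' \<in> Arr (op K)" "Cod (op K) e = Dom (op K) e'"
  then have e: "e \<in> Arr K" "e' \<in> Arr K" "Cod K e' = Dom K e" by simp_all
  have "AM hF (e \<cdot>\<^bsub>K\<^esub> e') = AM hF e' \<cdot>\<^bsub>VK\<^esub> AM hF e"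
  proof (rule Arr_fun_cat_eqI)
    show "AM hF e' \<cdot>\<^bsub>VK\<^esub> AM hF e \<in> Arr VK"
      using e by (intro T.KA.fc_Arr_Comp) simp_all
    fix l assume l: "l \<in> Ob K"
    show "cmp (AM hF (e \<cdot>\<^bsub>K\<^esub> e')) l = cmp (AM hF e' \<cdot>\<^bsub>VK\<^esub> AM hF e) l"
      by (rule h_eqI[of l _ "Cod K e" "OM (hh (Dom K e')) l"])
        (use e l in \<open>simp_all add: hom_iff hF_inc tens.B.assoc_Comp K.assoc_Comp\<close>)
  qed (use e in simp_all)
  then show "AM hF (e' \<cdot>\<^bsub>op K\<^esub> e) = AM hF e' \<cdot>\<^bsub>VK\<^esub> AM hF e"
    by simp
qed simp_all

end

section \<open>Adjunctions of diagrams\<close>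

text \<open>
  Keeping the three categories of \<open>D(T(a,b), d) \<cong> A(a, R(b,d))\<close> apart makes this notion cover both
  adjunctions of a closed module: \<open>C(m \<otimes> c, d) \<cong> V(m, C(c,d))\<close> and, after an exchange of the
  arguments of the action, \<open>C(m \<otimes> c, d) \<cong> C(c, d\<^sup>m)\<close>.
\<close>

definition natural_bij where
  "natural_bij A B D T R \<phi> \<longleftrightarrow>
     (\<forall>a\<in>Ob A. \<forall>b\<in>Ob B. \<forall>d\<in>Ob D.
        bij_betw (\<phi> a b d) (hom D (OM T (a, b)) d) (hom A a (OM R (b, d)))) \<and>
     (\<forall>a a' b b' d d' f g h u.
        f \<in> hom A a' a \<and> g \<in> hom B b' b \<and> h \<in> hom D d d' \<and> u \<in> hom D (OM T (a, b)) d \<longrightarrow>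
        \<phi> a' b' d' (h \<cdot>\<^bsub>D\<^esub> u \<cdot>\<^bsub>D\<^esub> AM T (f, g)) = AM R (g, h) \<cdot>\<^bsub>A\<^esub> \<phi> a b d u \<cdot>\<^bsub>A\<^esub> f)"

lemma natural_bij_bij:
  assumes "natural_bij A B D T R \<phi>" "a \<in> Ob A" "b \<in> Ob B" "d \<in> Ob D"
  shows "bij_betw (\<phi> a b d) (hom D (OM T (a, b)) d) (hom A a (OM R (b, d)))"
  using assms by (simp add: natural_bij_def)

lemma natural_bij_natural:
  assumes "natural_bij A B D T R \<phi>"
    and "f \<in> hom A a' a" "g \<in> hom B b' b" "h \<in> hom D d d'" "u \<in> hom D (OM T (a, b)) d"
  shows "\<phi> a' b' d' (h \<cdot>\<^bsub>D\<^esub> u \<cdot>\<^bsub>D\<^esub> AM T (f, g)) = AM R (g, h) \<cdot>\<^bsub>A\<^esub> \<phi> a b d u \<cdot>\<^bsub>A\<^esub> f"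
  using assms unfolding natural_bij_def by blast

lemma natural_bij_HP_bij:
  assumes "natural_bij_HP V C H P \<psi>" "m \<in> Ob V" "c \<in> Ob C" "d \<in> Ob C"
  shows "bij_betw (\<psi> m c d) (hom V m (OM H (c, d))) (hom C c (OM P (m, d)))"
  using assms by (simp add: natural_bij_HP_def)

lemma natural_bij_HP_natural:
  assumes "natural_bij_HP V C H P \<psi>"
    and "f \<in> hom V m' m" "g \<in> hom C c' c" "h \<in> hom C d d'" "v \<in> hom V m (OM H (c, d))"
  shows "\<psi> m' c' d' (AM H (g, h) \<cdot>\<^bsub>V\<^esub> v \<cdot>\<^bsub>V\<^esub> f) = AM P (f, h) \<cdot>\<^bsub>C\<^esub> \<psi> m c d v \<cdot>\<^bsub>C\<^esub> g"
  using assms unfolding natural_bij_HP_def by blast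

lemma natural_bij_TH_iff: "natural_bij_TH V C T H \<phi> \<longleftrightarrow> natural_bij V C C T H \<phi>"
  by (simp add: natural_bij_TH_def natural_bij_def)

text \<open>
  The diagram \<open>S(k,X)\<close> is the one with \<open>S(k,X)\<^sub>l = \<Coprod>\<^bsub>K(k,l)\<^esub> X\<^sub>l\<close>, with inclusions \<open>j X g\<close> for
  \<open>g : k \<rightarrow> l\<close>; \<open>h\<^sub>k \<otimes> X\<close> and \<open>M \<otimes> h\<^sub>k\<close> are of this form. The copower property is imposed on the
  images under \<open>T(a,-)\<close>, because copowers in \<open>D\<close> are what the adjunction turns into products in \<open>A\<close>.
\<close>

locale Copower_weights = End_bifunctor K B D A R + S: Bifunctor "op K" "fun_cat K B" "fun_cat K B" S +
  T: Bifunctor A B D T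
  for K :: "('s, 's) cat" and B :: "('p, 'b) cat" and D :: "('q, 'd) cat" and A :: "('o, 'a) cat"
    and R and S and T +
  fixes \<phi> and j
  assumes \<phi>: "natural_bij A B D T R \<phi>"
    and j_in: "\<lbrakk>X \<in> Ob (fun_cat K B); g \<in> Arr K\<rbrakk> \<Longrightarrow>
      j X g \<in> hom B (OM X (Cod K g)) (OM (OM S (Dom K g, X)) (Cod K g))"
    and j_copower: "\<lbrakk>X \<in> Ob (fun_cat K B); a \<in> Ob A; k \<in> Ob K; l \<in> Ob K\<rbrakk> \<Longrightarrow>
      is_copower D (hom K k l) (OM T (a, OM X l)) (OM T (a, OM (OM S (k, X)) l)) (\<lambda>g. AM T (Ide A a, j X g))"
    and j_natural: "\<lbrakk>s \<in> Arr (fun_cat K B); e \<in> Arr K; g \<in> Arr K; Dom K g = Cod K e\<rbrakk> \<Longrightarrow>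
      cmp (AM S (e, s)) (Cod K g) \<cdot>\<^bsub>B\<^esub> j (src s) g = j (trg s) (g \<cdot>\<^bsub>K\<^esub> e) \<cdot>\<^bsub>B\<^esub> cmp s (Cod K g)"
    and j_post: "\<lbrakk>X \<in> Ob (fun_cat K B); g \<in> Arr K; f \<in> Arr K; Dom K f = Cod K g\<rbrakk> \<Longrightarrow>
      AM (OM S (Dom K g, X)) f \<cdot>\<^bsub>B\<^esub> j X g = j X (f \<cdot>\<^bsub>K\<^esub> g) \<cdot>\<^bsub>B\<^esub> AM X f"
begin

lemma
  assumes "X \<in> Ob BK" "g \<in> Arr K"
  shows Arr_j [simp]: "j X g \<in> Arr B"
    and Dom_j [simp]: "Dom B (j X g) = OM X (Cod K g)"
    and Cod_j [simp]: "Cod B (j X g) = OM (OM S (Dom K g, X)) (Cod K g)"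
  using j_in[OF assms] by (simp_all add: hom_iff)

lemma
  assumes "e \<in> Arr K" "s \<in> Arr BK"
  shows Arr_S [simp]: "AM S (e, s) \<in> Arr BK"
    and src_S [simp]: "src (AM S (e, s)) = OM S (Cod K e, src s)"
    and trg_S [simp]: "trg (AM S (e, s)) = OM S (Dom K e, trg s)"
  using S.Arr_AM2[of e s] S.Dom_AM2[of e s] S.Cod_AM2[of e s] assms by simp_all

subsection \<open>The universal property of \<open>R\<^sup>K(X, Y)\<^sub>k\<close>\<close>

lemmas \<phi>_bij = natural_bij_bij[OF \<phi>]
lemmas \<phi>_natural = natural_bij_natural[OF \<phi>]

lemma \<phi>_in:
  assumes "a \<in> Ob A" "b \<in> Ob B" "u \<in> hom D (OM T (a, b)) d"
  shows "\<phi> a b d u \<in> hom A a (OM R (b, d))"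
proof -
  have "d \<in> Ob D" using assms(3) R.B.Ob_Cod by (auto simp: hom_iff)
  then show ?thesis using \<phi>_bij assms by (meson bij_betwE)
qed

lemma \<phi>_eqI:
  assumes "a \<in> Ob A" "b \<in> Ob B" "u \<in> hom D (OM T (a, b)) d" "v \<in> hom D (OM T (a, b)) d"
    "\<phi> a b d u = \<phi> a b d v"
  shows "u = v"
proof -
  have "d \<in> Ob D" using assms(3) R.B.Ob_Cod by (auto simp: hom_iff)
  then show ?thesis 
    using inj_onD[OF bij_betw_imp_inj_on[OF \<phi>_bij[OF assms(1,2)]]] assms(3-5) by blast
qed

lemma \<phi>_surj:
  assumes "a \<in> Ob A" "b \<in> Ob B" "d \<in> Ob D" "v \<in> hom A a (OM R (b, d))"
  obtains u where "u \<in> hom D (OM T (a, b)) d" "\<phi> a b d u = v"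
proof -
  have "v \<in> \<phi> a b d ` hom D (OM T (a, b)) d"
    using \<phi>_bij[OF assms(1-3)] assms(4) by (simp add: bij_betw_def)
  then show thesis using that by blast
qed

text \<open>
  Arrows \<open>a \<rightarrow> R(S(k,X)\<^sub>l, d)\<close> are arrows \<open>T(a, S(k,X)\<^sub>l) \<rightarrow> d\<close> out of a copower, so \<open>R(-,d)\<close> turns
  the copower \<open>S(k,X)\<^sub>l\<close> into a product of copies of \<open>R(X\<^sub>l,d)\<close>.
\<close>

lemma R_power:
  assumes X: "X \<in> Ob BK" and a: "a \<in> Ob A" and k: "k \<in> Ob K" and l: "l \<in> Ob K" and d: "d \<in> Ob D"
    and q: "\<And>g. g \<in> hom K k l \<Longrightarrow> q g \<in> hom A a (OM R (OM X l, d))"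
  shows "\<exists>!\<rho>. \<rho> \<in> hom A a (OM R (OM (OM S (k, X)) l, d)) \<and>
    (\<forall>g\<in>hom K k l. AM R (j X g, Ide D d) \<cdot>\<^bsub>A\<^esub> \<rho> = q g)"
proof -
  let ?x = "OM X l" and ?y = "OM (OM S (k, X)) l"
  have x: "?x \<in> Ob B" and y: "?y \<in> Ob B" using X k l by simp_all
  note cop = j_copower[OF X a k l]
  have pre: "AM R (j X g, Ide D d) \<cdot>\<^bsub>A\<^esub> \<phi> a ?y d u = \<phi> a ?x d (u \<cdot>\<^bsub>D\<^esub> AM T (Ide A a, j X g))"
    if u: "u \<in> hom D (OM T (a, ?y)) d" and g: "g \<in> hom K k l" for u g
  proof -
    have "\<phi> a ?x d (Ide D d \<cdot>\<^bsub>D\<^esub> u \<cdot>\<^bsub>D\<^esub> AM T (Ide A a, j X g)) =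
        AM R (j X g, Ide D d) \<cdot>\<^bsub>A\<^esub> \<phi> a ?y d u \<cdot>\<^bsub>A\<^esub> Ide A a"
      by (rule \<phi>_natural) (use X a d u g in \<open>auto simp: hom_iff\<close>)
    moreover have "Dom A (\<phi> a ?y d u) = a" "\<phi> a ?y d u \<in> Arr A" "Cod A (\<phi> a ?y d u) = OM R (?y, d)"
      using \<phi>_in[OF a y u] by (simp_all add: hom_iff)
    ultimately show ?thesis using u g X a d by (auto simp: hom_iff)
  qed
  have "\<forall>g\<in>hom K k l. \<exists>v. v \<in> hom D (OM T (a, ?x)) d \<and> \<phi> a ?x d v = q g"
    using \<phi>_surj[OF a x d q] by metis
  then obtain \<kappa> where \<kappa>: "\<forall>g\<in>hom K k l. \<kappa> g \<in> hom D (OM T (a, ?x)) d"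
    "\<And>g. g \<in> hom K k l \<Longrightarrow> \<phi> a ?x d (\<kappa> g) = q g"
    by metis
  obtain w where w: "w \<in> hom D (OM T (a, ?y)) d"
    "\<And>g. g \<in> hom K k l \<Longrightarrow> w \<cdot>\<^bsub>D\<^esub> AM T (Ide A a, j X g) = \<kappa> g"
    using copower_factor[OF cop d \<kappa>(1)] by blast
  show ?thesis
  proof (rule ex1I[of _ "\<phi> a ?y d w"])
    show "\<phi> a ?y d w \<in> hom A a (OM R (?y, d)) \<and>
        (\<forall>g\<in>hom K k l. AM R (j X g, Ide D d) \<cdot>\<^bsub>A\<^esub> \<phi> a ?y d w = q g)"
      using w \<kappa> pre \<phi>_in[OF a y w(1)] by simp
    fix \<rho> assume \<rho>: "\<rho> \<in> hom A a (OM R (?y, d)) \<and>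
      (\<forall>g\<in>hom K k l. AM R (j X g, Ide D d) \<cdot>\<^bsub>A\<^esub> \<rho> = q g)"
    then obtain u where u: "u \<in> hom D (OM T (a, ?y)) d" "\<phi> a ?y d u = \<rho>"
      using \<phi>_surj[OF a y d] by blast
    have "u = w"
    proof (rule copower_eqI[OF cop R.B.category_axioms u(1) w(1)])
      fix g assume g: "g \<in> hom K k l"
      have "\<phi> a ?x d (u \<cdot>\<^bsub>D\<^esub> AM T (Ide A a, j X g)) = \<phi> a ?x d (\<kappa> g)"
        using pre[OF u(1) g] u(2) \<rho> g \<kappa>(2) by simp
      then show "u \<cdot>\<^bsub>D\<^esub> AM T (Ide A a, j X g) = w \<cdot>\<^bsub>D\<^esub> AM T (Ide A a, j X g)"
        using \<phi>_eqI[OF a x] w(2)[OF g] \<kappa>(1) u(1) g X a by (auto simp: hom_iff)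
    qed
    with u show "\<rho> = \<phi> a ?y d w" by simp
  qed
qed

abbreviation "PP \<equiv> op BK \<times>\<^sub>C DK"

text \<open>
  The functor \<open>(k, X, Y) \<mapsto> \<integral>\<^sub>l R(S(k,X)\<^sub>l, Y\<^sub>l)\<close>. It is covariant in \<open>k\<close> because \<open>S\<close> and \<open>R\<close> are both
  contravariant in their first arguments. Currying it gives the right adjoint \<open>RK\<close>.
\<close>

definition "weighted_end = \<lparr>OM = (\<lambda>(k, X, Y). OM EndF (OM S (k, X), Y)), AM = (\<lambda>(e, s, t). AM EndF (AM S (e, s), t))\<rparr>"

lemma Bifunctor_weighted_end: "Bifunctor K PP A weighted_end"
proof (intro BifunctorI FunctorI)
  interpret E: Functor PP A EndF by (rule Functor_EndF)
  show "category PP" by (rule E.A.category_axioms)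
  then show "category (K \<times>\<^sub>C PP)" by (rule category_prod[OF K.category_axioms])
  show "AM weighted_end (Ide (K \<times>\<^sub>C PP) x) = Ide A (OM weighted_end x)" if "x \<in> Ob (K \<times>\<^sub>C PP)" for x
  proof -
    obtain k X Y where x: "x = (k, X, Y)" by (cases x)
    with that have k: "k \<in> Ob K" "X \<in> Ob BK" "Y \<in> Ob DK" by auto
    then have "AM S (Ide K k, Ide BK X) = Ide BK (OM S (k, X))"
      using S.AM_Ide2[of k X] by simp
    then show ?thesis
      using EndF_Ide[of "OM S (k, X)" Y] k by (simp add: x weighted_end_def)
  qed
  show "AM weighted_end (q' \<cdot>\<^bsub>K \<times>\<^sub>C PP\<^esub> q) = AM weighted_end q' \<cdot>\<^bsub>A\<^esub> AM weighted_end q"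
    if q: "q \<in> Arr (K \<times>\<^sub>C PP)" "q' \<in> Arr (K \<times>\<^sub>C PP)" "Cod (K \<times>\<^sub>C PP) q = Dom (K \<times>\<^sub>C PP) q'" for q q'
  proof -
    obtain e s t e' s' t' where eq: "q = (e, s, t)" "q' = (e', s', t')" by (cases q, cases q')
    with q have e: "e \<in> Arr K" "e' \<in> Arr K" "Cod K e = Dom K e'"
      and s: "s \<in> Arr BK" "s' \<in> Arr BK" "src s = trg s'" 
      and t: "t \<in> Arr DK" "t' \<in> Arr DK" "trg t = src t'" by auto
    have "AM S (e' \<cdot>\<^bsub>K\<^esub> e, s \<cdot>\<^bsub>BK\<^esub> s') = AM S (e, s) \<cdot>\<^bsub>BK\<^esub> AM S (e', s')"
      using S.AM_Comp2[of e' e s' s] e s by simp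
    then show ?thesis
      using E.AM_Comp'[of "(AM S (e, s), t)" "(AM S (e', s'), t')"] e s t by (simp add: eq weighted_end_def)
  qed
qed (auto simp: weighted_end_def K.category_axioms R.D.category_axioms)

definition "RK = curry_functor K PP weighted_end"

lemma Functor_RK: "Functor PP (fun_cat K A) RK"
  unfolding RK_def by (rule Bifunctor.Functor_curry[OF Bifunctor_weighted_end])

lemma RK_simps [simp]:
  "k \<in> Ob K \<Longrightarrow> OM (OM RK (X, Y)) k = End (OM S (k, X)) Y"
  "e \<in> Arr K \<Longrightarrow> AM (OM RK (X, Y)) e = AM weighted_end (e, Ide BK X, Ide DK Y)"
  "src (AM RK (s, t)) = OM RK (trg s, src t)" "trg (AM RK (s, t)) = OM RK (src s, trg t)"
  "k \<in> Ob K \<Longrightarrow> cmp (AM RK (s, t)) k = AM weighted_end (Ide K k, s, t)"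
  by (simp_all add: RK_def weighted_end_def curry_functor_def curry_ob_def)

text \<open>
  The arrow \<open>RK(X,Y)\<^sub>k \<rightarrow> R(X\<^sub>l,Y\<^sub>l)\<close> for \<open>g : k \<rightarrow> l\<close>. The adjunction is derived from these legs alone: their
  compatibility, their behaviour under the arrows of \<open>K\<close>, \<open>X\<close> and \<open>Y\<close>, and their universality.
\<close>

definition "leg X Y g = AM R (j X g, Ide D (OM Y (Cod K g))) \<cdot>\<^bsub>A\<^esub> pr (OM S (Dom K g, X)) Y (Cod K g)"

lemma
  assumes "X \<in> Ob BK" "Y \<in> Ob DK" "g \<in> Arr K"
  shows Arr_leg [simp]: "leg X Y g \<in> Arr A"
    and Dom_leg [simp]: "Dom A (leg X Y g) = End (OM S (Dom K g, X)) Y"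
    and Cod_leg [simp]: "Cod A (leg X Y g) = OM R (OM X (Cod K g), OM Y (Cod K g))"
  using assms by (simp_all add: leg_def)

lemma leg_post:
  assumes "X \<in> Ob BK" "Y \<in> Ob DK" "g \<in> Arr K" "f \<in> Arr K" "Dom K f = Cod K g"
  shows "AM R (Ide B (OM X (Dom K f)), AM Y f) \<cdot>\<^bsub>A\<^esub> leg X Y g =
    AM R (AM X f, Ide D (OM Y (Cod K f))) \<cdot>\<^bsub>A\<^esub> leg X Y (f \<cdot>\<^bsub>K\<^esub> g)"
proof -
  let ?S = "OM S (Dom K g, X)" and ?d = "Ide D (OM Y (Cod K f))"
  have "AM R (Ide B (OM X (Dom K f)), AM Y f) \<cdot>\<^bsub>A\<^esub> leg X Y g =
      AM R (j X g, ?d) \<cdot>\<^bsub>A\<^esub> (AM R (Ide B (OM ?S (Dom K f)), AM Y f) \<cdot>\<^bsub>A\<^esub> pr ?S Y (Dom K f))"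
    using assms by (simp add: leg_def R_Comp')
  also have "\<dots> = AM R (j X g, ?d) \<cdot>\<^bsub>A\<^esub> (AM R (AM ?S f, ?d) \<cdot>\<^bsub>A\<^esub> pr ?S Y (Cod K f))"
    using assms pr_wedge[of ?S Y f] by simp
  also have "\<dots> = AM R (AM X f, ?d) \<cdot>\<^bsub>A\<^esub> leg X Y (f \<cdot>\<^bsub>K\<^esub> g)"
    using assms j_post[OF assms(1,3,4,5)] by (simp add: leg_def R_Comp')
  finally show ?thesis .
qed

lemma leg_weighted_end:
  assumes s: "s \<in> Arr BK" and t: "t \<in> Arr DK" and e: "e \<in> Arr K" and g: "g \<in> Arr K" "Dom K g = Cod K e"
  shows "leg (src s) (trg t) g \<cdot>\<^bsub>A\<^esub> AM weighted_end (e, s, t) =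
    AM R (cmp s (Cod K g), cmp t (Cod K g)) \<cdot>\<^bsub>A\<^esub> leg (trg s) (src t) (g \<cdot>\<^bsub>K\<^esub> e)"
proof -
  let ?l = "Cod K g"
  have "leg (src s) (trg t) g \<cdot>\<^bsub>A\<^esub> AM weighted_end (e, s, t) = AM R (j (src s) g, Ide D (OM (trg t) ?l)) \<cdot>\<^bsub>A\<^esub>
      (pr (OM S (Cod K e, src s)) (trg t) ?l \<cdot>\<^bsub>A\<^esub> AM EndF (AM S (e, s), t))"
    using s t e g by (simp add: leg_def weighted_end_def R.D.assoc_Comp)
  also have "\<dots> = AM R (j (src s) g, Ide D (OM (trg t) ?l)) \<cdot>\<^bsub>A\<^esub>
      (AM R (cmp (AM S (e, s)) ?l, cmp t ?l) \<cdot>\<^bsub>A\<^esub> pr (OM S (Dom K e, trg s)) (src t) ?l)"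
    using pr_EndF[OF Arr_S[OF e s] t, of ?l] e s g by simp
  also have "\<dots> = AM R (cmp s ?l, cmp t ?l) \<cdot>\<^bsub>A\<^esub> leg (trg s) (src t) (g \<cdot>\<^bsub>K\<^esub> e)"
    using s t e g j_natural[OF s e g] by (simp add: leg_def R_Comp')
  finally show ?thesis .
qed

lemma leg_RK:
  assumes "X \<in> Ob BK" "Y \<in> Ob DK" "e \<in> Arr K" "g \<in> Arr K" "Dom K g = Cod K e"
  shows "leg X Y g \<cdot>\<^bsub>A\<^esub> AM (OM RK (X, Y)) e = leg X Y (g \<cdot>\<^bsub>K\<^esub> e)"
  using leg_weighted_end[of "Ide BK X" "Ide DK Y" e g] assms by simp

text \<open>
  For fixed \<open>l\<close> the arrows \<open>q g\<close> combine into one arrow \<open>\<rho>\<^sub>l\<close> into \<open>R(S(k,X)\<^sub>l, Y\<^sub>l)\<close>, the product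
  being indexed by \<open>K(k,l)\<close>. Compatibility of the family \<open>q\<close> is the wedge condition for \<open>\<rho>\<close>, tested on
  the factors of the product. Thus \<open>RK(X,Y)\<^sub>k\<close> is the end of \<open>R(X,Y)\<close> over the category of arrows out of
  \<open>k\<close>.
\<close>

lemma RK_univ:
  assumes X: "X \<in> Ob BK" and Y: "Y \<in> Ob DK" and k: "k \<in> Ob K" and a: "a \<in> Ob A"
    and q: "\<And>g. g \<in> Arr K \<Longrightarrow> Dom K g = k \<Longrightarrow> q g \<in> hom A a (OM R (OM X (Cod K g), OM Y (Cod K g)))"
    and compat: "\<And>g f. g \<in> Arr K \<Longrightarrow> Dom K g = k \<Longrightarrow> f \<in> Arr K \<Longrightarrow> Dom K f = Cod K g \<Longrightarrow>
      AM R (Ide B (OM X (Dom K f)), AM Y f) \<cdot>\<^bsub>A\<^esub> q g =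
      AM R (AM X f, Ide D (OM Y (Cod K f))) \<cdot>\<^bsub>A\<^esub> q (f \<cdot>\<^bsub>K\<^esub> g)"
  shows "\<exists>u. u \<in> hom A a (End (OM S (k, X)) Y) \<and>
    (\<forall>g\<in>Arr K. Dom K g = k \<longrightarrow> leg X Y g \<cdot>\<^bsub>A\<^esub> u = q g)"
proof -
  let ?S = "OM S (k, X)"
  have "\<forall>l\<in>Ob K. \<exists>\<rho>. \<rho> \<in> hom A a (OM R (OM ?S l, OM Y l)) \<and>
      (\<forall>g\<in>hom K k l. AM R (j X g, Ide D (OM Y l)) \<cdot>\<^bsub>A\<^esub> \<rho> = q g)"
  proof
    fix l assume l: "l \<in> Ob K"
    have "\<exists>!\<rho>. \<rho> \<in> hom A a (OM R (OM ?S l, OM Y l)) \<and>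
      (\<forall>g\<in>hom K k l. AM R (j X g, Ide D (OM Y l)) \<cdot>\<^bsub>A\<^esub> \<rho> = q g)"
      by (rule R_power[OF X a k l]) (use q Y l in \<open>auto simp: hom_iff\<close>)
    then show "\<exists>\<rho>. \<rho> \<in> hom A a (OM R (OM ?S l, OM Y l)) \<and>
      (\<forall>g\<in>hom K k l. AM R (j X g, Ide D (OM Y l)) \<cdot>\<^bsub>A\<^esub> \<rho> = q g)" by blast
  qed
  then obtain \<rho> where \<rho>': "\<forall>l\<in>Ob K. \<rho> l \<in> hom A a (OM R (OM ?S l, OM Y l)) \<and>
      (\<forall>g\<in>hom K k l. AM R (j X g, Ide D (OM Y l)) \<cdot>\<^bsub>A\<^esub> \<rho> l = q g)"
    by metis
  then have \<rho>: "\<rho> l \<in> Arr A" "Dom A (\<rho> l) = a" "Cod A (\<rho> l) = OM R (OM ?S l, OM Y l)"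
    if "l \<in> Ob K" for l using that by (simp_all add: hom_iff)
  have \<rho>q: "AM R (j X g, Ide D (OM Y (Cod K g))) \<cdot>\<^bsub>A\<^esub> \<rho> (Cod K g) = q g"
    if "g \<in> Arr K" "Dom K g = k" for g
    using \<rho>' that K.Ob_Cod by (auto simp: hom_iff)
  have "AM R (Ide B (OM ?S (Dom K f)), AM Y f) \<cdot>\<^bsub>A\<^esub> \<rho> (Dom K f) =
      AM R (AM ?S f, Ide D (OM Y (Cod K f))) \<cdot>\<^bsub>A\<^esub> \<rho> (Cod K f)" (is "?L = ?M") if f: "f \<in> Arr K" for f
  proof -
    let ?d = "Ide D (OM Y (Cod K f))"
    \<comment> \<open>By \<open>R_power\<close>, arrows into \<open>R(S(k,X)\<^sub>l, d)\<close> are equal if they agree after each \<open>R(j X g, d)\<close>.\<close>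
    have eq: "AM R (j X g, ?d) \<cdot>\<^bsub>A\<^esub> ?L = AM R (j X g, ?d) \<cdot>\<^bsub>A\<^esub> ?M" if "g \<in> hom K k (Dom K f)" for g
    proof -
      have g: "g \<in> Arr K" "Dom K g = k" "Dom K f = Cod K g" using that by (simp_all add: hom_iff)
      have "AM R (j X g, ?d) \<cdot>\<^bsub>A\<^esub> ?L = AM R (Ide B (OM X (Dom K f)), AM Y f) \<cdot>\<^bsub>A\<^esub>
          (AM R (j X g, Ide D (OM Y (Cod K g))) \<cdot>\<^bsub>A\<^esub> \<rho> (Cod K g))"
        using X Y k f g \<rho>[of "Cod K g"] by (simp add: R_Comp')
      also have "\<dots> = AM R (AM X f, ?d) \<cdot>\<^bsub>A\<^esub> q (f \<cdot>\<^bsub>K\<^esub> g)"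
        using \<rho>q[OF g(1,2)] compat[OF g(1,2) f g(3)] by simp
      also have "\<dots> = AM R (AM X f, ?d) \<cdot>\<^bsub>A\<^esub> (AM R (j X (f \<cdot>\<^bsub>K\<^esub> g), ?d) \<cdot>\<^bsub>A\<^esub> \<rho> (Cod K f))"
        using \<rho>q[of "f \<cdot>\<^bsub>K\<^esub> g"] f g by simp
      also have "\<dots> = AM R (j X g, ?d) \<cdot>\<^bsub>A\<^esub> ?M"
        using X Y k f g \<rho>[of "Cod K f"] j_post[OF X g(1) f g(3)] by (simp add: R_Comp')
      finally show ?thesis .
    qed
    have "\<exists>!\<sigma>. \<sigma> \<in> hom A a (OM R (OM ?S (Dom K f), OM Y (Cod K f))) \<and>
       (\<forall>g\<in>hom K k (Dom K f). AM R (j X g, ?d) \<cdot>\<^bsub>A\<^esub> \<sigma> = AM R (j X g, ?d) \<cdot>\<^bsub>A\<^esub> ?M)"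
      by (rule R_power[OF X a k])
        (use X Y f k \<rho>[of "Cod K f"] in \<open>auto simp: hom_iff\<close>)
    moreover have "?L \<in> hom A a (OM R (OM ?S (Dom K f), OM Y (Cod K f)))"
      "?M \<in> hom A a (OM R (OM ?S (Dom K f), OM Y (Cod K f)))"
      using X Y f k \<rho>[of "Cod K f"] \<rho>[of "Dom K f"] by (simp_all add: hom_iff)
    ultimately show ?thesis using eq by blast
  qed
  then have "is_wedge K A (bifun R ?S Y) a \<rho>"
    using \<rho> a X Y k by (simp add: is_wedge_bifun)
  then obtain u where u: "u \<in> hom A a (End ?S Y)" "\<And>l. l \<in> Ob K \<Longrightarrow> pr ?S Y l \<cdot>\<^bsub>A\<^esub> u = \<rho> l"
    using End_univ[of ?S Y a \<rho>] X Y k by auto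
  have "leg X Y g \<cdot>\<^bsub>A\<^esub> u = q g" if g: "g \<in> Arr K" "Dom K g = k" for g
  proof -
    have "leg X Y g \<cdot>\<^bsub>A\<^esub> u = AM R (j X g, Ide D (OM Y (Cod K g))) \<cdot>\<^bsub>A\<^esub> (pr ?S Y (Cod K g) \<cdot>\<^bsub>A\<^esub> u)"
      using X Y k g u(1) by (auto simp: leg_def hom_iff R.D.assoc_Comp)
    then show ?thesis using u(2)[of "Cod K g"] g \<rho>q by simp
  qed
  with u show ?thesis by blast
qed

lemma RK_eqI:
  assumes X: "X \<in> Ob BK" and Y: "Y \<in> Ob DK" and k: "k \<in> Ob K"
    and u: "u \<in> hom A a (End (OM S (k, X)) Y)" and v: "v \<in> hom A a (End (OM S (k, X)) Y)"
    and eq: "\<And>g. g \<in> Arr K \<Longrightarrow> Dom K g = k \<Longrightarrow> leg X Y g \<cdot>\<^bsub>A\<^esub> u = leg X Y g \<cdot>\<^bsub>A\<^esub> v"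
  shows "u = v"
proof (rule End_eqI[OF _ Y])
  let ?S = "OM S (k, X)"
  show "?S \<in> Ob BK" using X k by simp
  have a: "a \<in> Ob A" using u R.D.Ob_Dom by (auto simp: hom_iff)
  fix l assume l: "l \<in> Ob K"
  have *: "AM R (j X g, Ide D (OM Y l)) \<cdot>\<^bsub>A\<^esub> (pr ?S Y l \<cdot>\<^bsub>A\<^esub> w) = leg X Y g \<cdot>\<^bsub>A\<^esub> w"
    if "w \<in> hom A a (End ?S Y)" "g \<in> hom K k l" for w g
    using that X Y k l by (auto simp: leg_def hom_iff R.D.assoc_Comp)
  have "\<exists>!\<sigma>. \<sigma> \<in> hom A a (OM R (OM ?S l, OM Y l)) \<and>
      (\<forall>g\<in>hom K k l. AM R (j X g, Ide D (OM Y l)) \<cdot>\<^bsub>A\<^esub> \<sigma> = leg X Y g \<cdot>\<^bsub>A\<^esub> v)"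
    by (rule R_power[OF X a k l]) (use X Y k l v in \<open>auto simp: hom_iff\<close>)
  moreover have "pr ?S Y l \<cdot>\<^bsub>A\<^esub> u \<in> hom A a (OM R (OM ?S l, OM Y l))"
    "pr ?S Y l \<cdot>\<^bsub>A\<^esub> v \<in> hom A a (OM R (OM ?S l, OM Y l))"
    using X Y k l u v by (simp_all add: hom_iff)
  moreover have "\<forall>g\<in>hom K k l. AM R (j X g, Ide D (OM Y l)) \<cdot>\<^bsub>A\<^esub> (pr ?S Y l \<cdot>\<^bsub>A\<^esub> u) = leg X Y g \<cdot>\<^bsub>A\<^esub> v"
    using *[OF u] eq by (auto simp: hom_iff)
  moreover have "\<forall>g\<in>hom K k l. AM R (j X g, Ide D (OM Y l)) \<cdot>\<^bsub>A\<^esub> (pr ?S Y l \<cdot>\<^bsub>A\<^esub> v) = leg X Y g \<cdot>\<^bsub>A\<^esub> v"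
    using *[OF v] by blast
  ultimately show "pr ?S Y l \<cdot>\<^bsub>A\<^esub> u = pr ?S Y l \<cdot>\<^bsub>A\<^esub> v"
    by blast
qed (use u v in \<open>auto simp: hom_iff\<close>)

subsection \<open>The adjunction\<close>

sublocale TK: Bifunctor_diagrams K A B D T by unfold_locales

abbreviation "AK \<equiv> fun_cat K A"
abbreviation "adjunct M X Y t l \<equiv> \<phi> (OM M l) (OM X l) (OM Y l) (t l)"

text \<open>
  The two sides of the naturality square are arrows \<open>T(M\<^sub>k,X\<^sub>k) \<rightarrow> Y\<^sub>l\<close>. Their adjuncts are computed by
  naturality of \<open>\<phi>\<close> in \<open>d\<close> for the one through \<open>Y\<^sub>k\<close>, and in \<open>a\<close> and \<open>b\<close> for the one through
  \<open>T(M\<^sub>l,X\<^sub>l)\<close>.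
\<close>

lemma extranatural_iff:
  assumes M: "M \<in> Ob AK" and X: "X \<in> Ob BK" and Y: "Y \<in> Ob DK" and f: "f \<in> Arr K"
    and t: "\<And>l. l \<in> Ob K \<Longrightarrow> t l \<in> hom D (OM T (OM M l, OM X l)) (OM Y l)"
  shows "t (Cod K f) \<cdot>\<^bsub>D\<^esub> AM T (AM M f, AM X f) = AM Y f \<cdot>\<^bsub>D\<^esub> t (Dom K f) \<longleftrightarrow>
    AM R (Ide B (OM X (Dom K f)), AM Y f) \<cdot>\<^bsub>A\<^esub> adjunct M X Y t (Dom K f) =
      AM R (AM X f, Ide D (OM Y (Cod K f))) \<cdot>\<^bsub>A\<^esub> adjunct M X Y t (Cod K f) \<cdot>\<^bsub>A\<^esub> AM M f"
proof -
  let ?k = "Dom K f" and ?l = "Cod K f"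
  have kl: "?k \<in> Ob K" "?l \<in> Ob K" using f by simp_all
  have tk: "t ?k \<in> Arr D" "Dom D (t ?k) = OM T (OM M ?k, OM X ?k)" "Cod D (t ?k) = OM Y ?k"
    and tl: "t ?l \<in> Arr D" "Dom D (t ?l) = OM T (OM M ?l, OM X ?l)" "Cod D (t ?l) = OM Y ?l"
    using t[OF kl(1)] t[OF kl(2)] by (simp_all add: hom_iff)
  have \<tau>k: "adjunct M X Y t ?k \<in> hom A (OM M ?k) (OM R (OM X ?k, OM Y ?k))"
    by (rule \<phi>_in) (use M X f t[OF kl(1)] in simp_all)
  have "\<phi> (OM M ?k) (OM X ?k) (OM Y ?l)
      (AM Y f \<cdot>\<^bsub>D\<^esub> t ?k \<cdot>\<^bsub>D\<^esub> AM T (Ide A (OM M ?k), Ide B (OM X ?k))) =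
    AM R (Ide B (OM X ?k), AM Y f) \<cdot>\<^bsub>A\<^esub> adjunct M X Y t ?k \<cdot>\<^bsub>A\<^esub> Ide A (OM M ?k)"
    by (rule \<phi>_natural) (use M X Y f t[OF kl(1)] in \<open>simp_all add: hom_iff\<close>)
  then have left: "\<phi> (OM M ?k) (OM X ?k) (OM Y ?l) (AM Y f \<cdot>\<^bsub>D\<^esub> t ?k) =
      AM R (Ide B (OM X ?k), AM Y f) \<cdot>\<^bsub>A\<^esub> adjunct M X Y t ?k"
    using M X Y f tk \<tau>k by (simp add: hom_iff)
  have "\<phi> (OM M ?k) (OM X ?k) (OM Y ?l)
      (Ide D (OM Y ?l) \<cdot>\<^bsub>D\<^esub> t ?l \<cdot>\<^bsub>D\<^esub> AM T (AM M f, AM X f)) =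
    AM R (AM X f, Ide D (OM Y ?l)) \<cdot>\<^bsub>A\<^esub> adjunct M X Y t ?l \<cdot>\<^bsub>A\<^esub> AM M f"
    by (rule \<phi>_natural) (use M X Y f t[OF kl(2)] in \<open>simp_all add: hom_iff\<close>)
  then have right: "\<phi> (OM M ?k) (OM X ?k) (OM Y ?l) (t ?l \<cdot>\<^bsub>D\<^esub> AM T (AM M f, AM X f)) =
    AM R (AM X f, Ide D (OM Y ?l)) \<cdot>\<^bsub>A\<^esub> adjunct M X Y t ?l \<cdot>\<^bsub>A\<^esub> AM M f"
    using tl Y f by simp
  have "t ?l \<cdot>\<^bsub>D\<^esub> AM T (AM M f, AM X f) \<in> hom D (OM T (OM M ?k, OM X ?k)) (OM Y ?l)"
    "AM Y f \<cdot>\<^bsub>D\<^esub> t ?k \<in> hom D (OM T (OM M ?k, OM X ?k)) (OM Y ?l)"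
    using M X Y f tk tl by (simp_all add: hom_iff)
  from \<phi>_eqI[OF _ _ this] M X f left right show ?thesis by auto
qed

text \<open>
  The component of \<open>\<Phi> t\<close> at \<open>k\<close> has the leg \<open>M\<^sub>k \<rightarrow> M\<^sub>l \<rightarrow> R(X\<^sub>l,Y\<^sub>l)\<close> at \<open>g : k \<rightarrow> l\<close>, namely \<open>M g\<close> followed by
  the adjunct of \<open>t\<^sub>l\<close>. As in the Yoneda lemma, no other choice is natural in \<open>k\<close> and has this adjunct
  as its leg at the identity of \<open>l\<close>.
\<close>

definition "\<Phi> M X Y t = \<lparr>src = M, trg = OM RK (X, Y),
  cmp = (\<lambda>k\<in>Ob K. THE u. u \<in> hom A (OM M k) (End (OM S (k, X)) Y) \<and>
    (\<forall>g\<in>Arr K. Dom K g = k \<longrightarrow>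
      leg X Y g \<cdot>\<^bsub>A\<^esub> u = adjunct M X Y (cmp t) (Cod K g) \<cdot>\<^bsub>A\<^esub> AM M g))\<rparr>"

context
  fixes M X Y
  assumes M: "M \<in> Ob AK" and X: "X \<in> Ob BK" and Y: "Y \<in> Ob DK"
begin

lemma adjunct_in:
  assumes "t \<in> hom DK (pointwise_ob K T M X) Y" "l \<in> Ob K"
  shows "adjunct M X Y (cmp t) l \<in> hom A (OM M l) (OM R (OM X l, OM Y l))"
  by (rule \<phi>_in) (use assms M X in \<open>auto simp: hom_iff\<close>)

lemma \<Phi>_cmp:
  assumes t: "t \<in> hom DK (pointwise_ob K T M X) Y" and k: "k \<in> Ob K"
  shows "cmp (\<Phi> M X Y t) k \<in> hom A (OM M k) (End (OM S (k, X)) Y)"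
    and "g \<in> Arr K \<Longrightarrow> Dom K g = k \<Longrightarrow>
      leg X Y g \<cdot>\<^bsub>A\<^esub> cmp (\<Phi> M X Y t) k = adjunct M X Y (cmp t) (Cod K g) \<cdot>\<^bsub>A\<^esub> AM M g"
proof -
  let ?\<tau> = "adjunct M X Y (cmp t)"
  note \<tau> = adjunct_in[OF t, unfolded hom_iff]
  have "AM R (Ide B (OM X (Dom K f)), AM Y f) \<cdot>\<^bsub>A\<^esub> (?\<tau> (Cod K g) \<cdot>\<^bsub>A\<^esub> AM M g) =
      AM R (AM X f, Ide D (OM Y (Cod K f))) \<cdot>\<^bsub>A\<^esub> (?\<tau> (Cod K (f \<cdot>\<^bsub>K\<^esub> g)) \<cdot>\<^bsub>A\<^esub> AM M (f \<cdot>\<^bsub>K\<^esub> g))"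
    if g: "g \<in> Arr K" "Dom K g = k" and f: "f \<in> Arr K" "Dom K f = Cod K g" for f g
  proof -
    have "AM R (Ide B (OM X (Dom K f)), AM Y f) \<cdot>\<^bsub>A\<^esub> ?\<tau> (Dom K f) =
      AM R (AM X f, Ide D (OM Y (Cod K f))) \<cdot>\<^bsub>A\<^esub> ?\<tau> (Cod K f) \<cdot>\<^bsub>A\<^esub> AM M f"
      using extranatural_iff[OF M X Y f(1), of "cmp t"] t f KD.fc_natural[of t f]
      by (auto simp: hom_iff)
    then have "AM R (Ide B (OM X (Dom K f)), AM Y f) \<cdot>\<^bsub>A\<^esub> ?\<tau> (Dom K f) \<cdot>\<^bsub>A\<^esub> AM M g =
      AM R (AM X f, Ide D (OM Y (Cod K f))) \<cdot>\<^bsub>A\<^esub> ?\<tau> (Cod K f) \<cdot>\<^bsub>A\<^esub> AM M f \<cdot>\<^bsub>A\<^esub> AM M g" by simp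
    then show ?thesis
      using M X Y f g \<tau>[of "Dom K f"] \<tau>[of "Cod K f"]
      by (simp add: KA.fc_Comp R.D.assoc_Comp)
  qed
  then have "\<exists>u. u \<in> hom A (OM M k) (End (OM S (k, X)) Y) \<and>
    (\<forall>g\<in>Arr K. Dom K g = k \<longrightarrow> leg X Y g \<cdot>\<^bsub>A\<^esub> u = ?\<tau> (Cod K g) \<cdot>\<^bsub>A\<^esub> AM M g)"
    using M k \<tau> by (intro RK_univ[OF X Y k]) (simp_all add: hom_iff)
  then have "\<exists>!u. u \<in> hom A (OM M k) (End (OM S (k, X)) Y) \<and>
    (\<forall>g\<in>Arr K. Dom K g = k \<longrightarrow> leg X Y g \<cdot>\<^bsub>A\<^esub> u = ?\<tau> (Cod K g) \<cdot>\<^bsub>A\<^esub> AM M g)"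
    using RK_eqI[OF X Y k] by (auto 0 3)
  from theI'[OF this]
  show "cmp (\<Phi> M X Y t) k \<in> hom A (OM M k) (End (OM S (k, X)) Y)"
    and "g \<in> Arr K \<Longrightarrow> Dom K g = k \<Longrightarrow>
      leg X Y g \<cdot>\<^bsub>A\<^esub> cmp (\<Phi> M X Y t) k = ?\<tau> (Cod K g) \<cdot>\<^bsub>A\<^esub> AM M g"
    using k by (simp_all add: \<Phi>_def)
qed

lemma \<Phi>_cmp_Ide:
  assumes t: "t \<in> hom DK (pointwise_ob K T M X) Y" and k: "k \<in> Ob K"
  shows "leg X Y (Ide K k) \<cdot>\<^bsub>A\<^esub> cmp (\<Phi> M X Y t) k = adjunct M X Y (cmp t) k"
  using \<Phi>_cmp(2)[OF t k, of "Ide K k"] adjunct_in[OF t k] M k by (simp add: hom_iff)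

lemma Ob_RK: "OM RK (X, Y) \<in> Ob AK"
  using Functor.OM_in[OF Functor_RK, of "(X, Y)"] X Y by simp

lemma \<Phi>_in:
  assumes t: "t \<in> hom DK (pointwise_ob K T M X) Y"
  shows "\<Phi> M X Y t \<in> hom AK M (OM RK (X, Y))"
proof -
  have src: "src (\<Phi> M X Y t) = M" "trg (\<Phi> M X Y t) = OM RK (X, Y)"
    by (simp_all add: \<Phi>_def)
  note \<Phi> = \<Phi>_cmp(1)[OF t, unfolded hom_iff]
  note \<tau> = adjunct_in[OF t, unfolded hom_iff]
  have "\<Phi> M X Y t \<in> Arr AK"
  proof (rule Arr_fun_catI)
    show "cmp (\<Phi> M X Y t) \<in> extensional (Ob K)" by (simp add: \<Phi>_def)
    fix f assume f: "f \<in> Arr K"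
    let ?u = "cmp (\<Phi> M X Y t)"
    have E: "AM (OM RK (X, Y)) f \<in> hom A (End (OM S (Dom K f, X)) Y) (End (OM S (Cod K f, X)) Y)"
      using KA.fc_Arr[OF Ob_RK f] KA.fc_Dom[OF Ob_RK f] KA.fc_Cod[OF Ob_RK f] f
      by (simp add: hom_iff)
    have "?u (Cod K f) \<cdot>\<^bsub>A\<^esub> AM M f = AM (OM RK (X, Y)) f \<cdot>\<^bsub>A\<^esub> ?u (Dom K f)"
    proof (rule RK_eqI[OF X Y K.Ob_Cod[OF f]])
      show "?u (Cod K f) \<cdot>\<^bsub>A\<^esub> AM M f \<in> hom A (OM M (Dom K f)) (End (OM S (Cod K f, X)) Y)"
        "AM (OM RK (X, Y)) f \<cdot>\<^bsub>A\<^esub> ?u (Dom K f) \<in> hom A (OM M (Dom K f)) (End (OM S (Cod K f, X)) Y)"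
        using \<Phi>[of "Cod K f"] \<Phi>[of "Dom K f"] E M f by (simp_all add: hom_iff)
      fix g assume g: "g \<in> Arr K" "Dom K g = Cod K f"
      have "leg X Y g \<cdot>\<^bsub>A\<^esub> (?u (Cod K f) \<cdot>\<^bsub>A\<^esub> AM M f) =
          adjunct M X Y (cmp t) (Cod K g) \<cdot>\<^bsub>A\<^esub> AM M g \<cdot>\<^bsub>A\<^esub> AM M f"
        using \<Phi>_cmp(2)[OF t, of "Cod K f" g] \<Phi>[of "Cod K f"] g f X Y M by (simp add: hom_iff R.D.assoc_Comp[symmetric])
      also have "\<dots> = leg X Y (g \<cdot>\<^bsub>K\<^esub> f) \<cdot>\<^bsub>A\<^esub> ?u (Dom K f)"
        using \<Phi>_cmp(2)[OF t, of "Dom K f" "g \<cdot>\<^bsub>K\<^esub> f"] g f M \<tau>[of "Cod K g"]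
        by (simp add: KA.fc_Comp R.D.assoc_Comp)
      also have "\<dots> = leg X Y g \<cdot>\<^bsub>A\<^esub> AM (OM RK (X, Y)) f \<cdot>\<^bsub>A\<^esub> ?u (Dom K f)"
        using leg_RK[OF X Y f g] by simp
      also have "\<dots> = leg X Y g \<cdot>\<^bsub>A\<^esub> (AM (OM RK (X, Y)) f \<cdot>\<^bsub>A\<^esub> ?u (Dom K f))"
        using \<Phi>[of "Dom K f"] E g f X Y by (simp add: hom_iff R.D.assoc_Comp)
      finally show "leg X Y g \<cdot>\<^bsub>A\<^esub> (?u (Cod K f) \<cdot>\<^bsub>A\<^esub> AM M f) =
        leg X Y g \<cdot>\<^bsub>A\<^esub> (AM (OM RK (X, Y)) f \<cdot>\<^bsub>A\<^esub> ?u (Dom K f))" .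
    qed
    then show "?u (Cod K f) \<cdot>\<^bsub>A\<^esub> AM (src (\<Phi> M X Y t)) f =
        AM (trg (\<Phi> M X Y t)) f \<cdot>\<^bsub>A\<^esub> ?u (Dom K f)"
      unfolding src .
  qed (use src M Ob_RK \<Phi> in simp_all)
  then show ?thesis by (simp add: hom_iff src)
qed

lemma \<Phi>_inj: "inj_on (\<Phi> M X Y) (hom DK (pointwise_ob K T M X) Y)"
proof (rule inj_onI)
  fix t t' assume t: "t \<in> hom DK (pointwise_ob K T M X) Y" and t': "t' \<in> hom DK (pointwise_ob K T M X) Y"
    and eq: "\<Phi> M X Y t = \<Phi> M X Y t'"
  show "t = t'"
  proof (rule Arr_fun_cat_eqI[of _ K D])
    fix k assume k: "k \<in> Ob K"
    have "adjunct M X Y (cmp t) k = adjunct M X Y (cmp t') k"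
      using \<Phi>_cmp_Ide[OF t k] \<Phi>_cmp_Ide[OF t' k] eq by simp
    then show "cmp t k = cmp t' k"
      by (intro \<phi>_eqI[of "OM M k" "OM X k"]) (use t t' k M X in \<open>auto simp: hom_iff\<close>)
  qed (use t t' in \<open>auto simp: hom_iff\<close>)
qed

text \<open>
  The legs of \<open>v\<^sub>l\<close> at identities give an extranatural family, whose adjunct is the preimage \<open>t\<close> of
  \<open>v\<close>. Naturality of \<open>v\<close> recovers all its other legs from these.
\<close>

lemma \<Phi>_surj:
  assumes v: "v \<in> hom AK M (OM RK (X, Y))"
  shows "\<exists>t \<in> hom DK (pointwise_ob K T M X) Y. \<Phi> M X Y t = v"
proof -
  have v': "v \<in> Arr AK" "src v = M" "trg v = OM RK (X, Y)" using v by (simp_all add: hom_iff)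
  have vk: "cmp v k \<in> Arr A" "Dom A (cmp v k) = OM M k" "Cod A (cmp v k) = End (OM S (k, X)) Y"
    if "k \<in> Ob K" for k
    using v' that by simp_all
  define \<tau> where "\<tau> l = leg X Y (Ide K l) \<cdot>\<^bsub>A\<^esub> cmp v l" for l
  have \<tau>: "\<tau> l \<in> hom A (OM M l) (OM R (OM X l, OM Y l))" if "l \<in> Ob K" for l
    using that vk X Y by (simp add: \<tau>_def hom_iff)
  have pv: "leg X Y g \<cdot>\<^bsub>A\<^esub> cmp v (Dom K g) = \<tau> (Cod K g) \<cdot>\<^bsub>A\<^esub> AM M g" if g: "g \<in> Arr K" for g
  proof -
    have E: "AM (OM RK (X, Y)) g \<in> hom A (End (OM S (Dom K g, X)) Y) (End (OM S (Cod K g, X)) Y)"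
      using KA.fc_Arr[OF Ob_RK g] KA.fc_Dom[OF Ob_RK g] KA.fc_Cod[OF Ob_RK g] g
      by (simp add: hom_iff)
    have "leg X Y g \<cdot>\<^bsub>A\<^esub> cmp v (Dom K g) =
        leg X Y (Ide K (Cod K g)) \<cdot>\<^bsub>A\<^esub> AM (OM RK (X, Y)) g \<cdot>\<^bsub>A\<^esub> cmp v (Dom K g)"
      using leg_RK[OF X Y g, of "Ide K (Cod K g)"] g by simp
    also have "\<dots> = leg X Y (Ide K (Cod K g)) \<cdot>\<^bsub>A\<^esub> (AM (OM RK (X, Y)) g \<cdot>\<^bsub>A\<^esub> cmp v (Dom K g))"
      using E g vk[of "Dom K g"] X Y by (simp add: hom_iff R.D.assoc_Comp)
    also have "\<dots> = leg X Y (Ide K (Cod K g)) \<cdot>\<^bsub>A\<^esub> (cmp v (Cod K g) \<cdot>\<^bsub>A\<^esub> AM M g)"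
      using KA.fc_natural[OF v'(1) g] v' by simp
    also have "\<dots> = \<tau> (Cod K g) \<cdot>\<^bsub>A\<^esub> AM M g"
      using g vk[of "Cod K g"] X Y M by (simp add: \<tau>_def R.D.assoc_Comp)
    finally show ?thesis .
  qed
  have "\<forall>l\<in>Ob K. \<exists>u. u \<in> hom D (OM T (OM M l, OM X l)) (OM Y l) \<and>
      \<phi> (OM M l) (OM X l) (OM Y l) u = \<tau> l"
  proof
    fix l assume l: "l \<in> Ob K"
    obtain u where "u \<in> hom D (OM T (OM M l, OM X l)) (OM Y l)" "\<phi> (OM M l) (OM X l) (OM Y l) u = \<tau> l"
      using \<phi>_surj[OF _ _ _ \<tau>[OF l]] M X Y l by auto
    then show "\<exists>u. u \<in> hom D (OM T (OM M l, OM X l)) (OM Y l) \<and>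
      \<phi> (OM M l) (OM X l) (OM Y l) u = \<tau> l" by blast
  qed
  then obtain w where w: "\<And>l. l \<in> Ob K \<Longrightarrow> w l \<in> hom D (OM T (OM M l, OM X l)) (OM Y l)"
    "\<And>l. l \<in> Ob K \<Longrightarrow> \<phi> (OM M l) (OM X l) (OM Y l) (w l) = \<tau> l"
    by metis
  define t where "t = \<lparr>src = pointwise_ob K T M X, trg = Y, cmp = (\<lambda>l\<in>Ob K. w l)\<rparr>"
  have "t \<in> Arr DK"
  proof (rule Arr_fun_catI)
    fix f assume f: "f \<in> Arr K"
    let ?k = "Dom K f" and ?l = "Cod K f"
    have "AM R (Ide B (OM X ?k), AM Y f) \<cdot>\<^bsub>A\<^esub> \<tau> ?k =
        AM R (Ide B (OM X ?k), AM Y f) \<cdot>\<^bsub>A\<^esub> leg X Y (Ide K ?k) \<cdot>\<^bsub>A\<^esub> cmp v ?k"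
      using X Y f vk[of ?k] by (simp add: \<tau>_def R.D.assoc_Comp)
    also have "\<dots> = AM R (AM X f, Ide D (OM Y ?l)) \<cdot>\<^bsub>A\<^esub> leg X Y f \<cdot>\<^bsub>A\<^esub> cmp v ?k"
      using leg_post[OF X Y, of "Ide K ?k" f] f by simp
    also have "\<dots> = AM R (AM X f, Ide D (OM Y ?l)) \<cdot>\<^bsub>A\<^esub> (\<tau> ?l \<cdot>\<^bsub>A\<^esub> AM M f)"
      using pv[OF f] vk[of ?k] X Y f by (simp add: R.D.assoc_Comp)
    also have "\<dots> = AM R (AM X f, Ide D (OM Y ?l)) \<cdot>\<^bsub>A\<^esub> \<tau> ?l \<cdot>\<^bsub>A\<^esub> AM M f"
      using \<tau>[of ?l] X Y M f by (simp add: R.D.assoc_Comp hom_iff)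
    finally show "cmp t ?l \<cdot>\<^bsub>D\<^esub> AM (src t) f = AM (trg t) f \<cdot>\<^bsub>D\<^esub> cmp t ?k"
      using extranatural_iff[OF M X Y f w(1)] w(2) f by (simp add: t_def)
  qed (use M X Y w(1) in \<open>auto simp: t_def hom_iff TK.Ob_pointwise\<close>)
  then have t: "t \<in> hom DK (pointwise_ob K T M X) Y" by (simp add: hom_iff t_def)
  have "\<Phi> M X Y t = v"
  proof (rule Arr_fun_cat_eqI[of _ K A])
    show "\<Phi> M X Y t \<in> Arr AK" "src (\<Phi> M X Y t) = src v" "trg (\<Phi> M X Y t) = trg v"
      using \<Phi>_in[OF t] v' by (simp_all add: hom_iff)
    fix k assume k: "k \<in> Ob K"
    show "cmp (\<Phi> M X Y t) k = cmp v k"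
    proof (rule RK_eqI[OF X Y k \<Phi>_cmp(1)[OF t k]])
      show "cmp v k \<in> hom A (OM M k) (End (OM S (k, X)) Y)" using vk k by (simp add: hom_iff)
      fix g assume "g \<in> Arr K" "Dom K g = k"
      then show "leg X Y g \<cdot>\<^bsub>A\<^esub> cmp (\<Phi> M X Y t) k = leg X Y g \<cdot>\<^bsub>A\<^esub> cmp v k"
        using \<Phi>_cmp(2)[OF t k, of g] pv[of g] w(2)[of "Cod K g"] by (simp add: t_def)
    qed
  qed (rule v'(1))
  with t show ?thesis by blast
qed

end

lemma natural_bij_\<Phi>: "natural_bij AK BK DK (pointwise K T) RK \<Phi>"
  unfolding natural_bij_def
proof (intro conjI ballI allI impI)
  fix M X Y assume M: "M \<in> Ob AK" "X \<in> Ob BK" "Y \<in> Ob DK"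
  show "bij_betw (\<Phi> M X Y) (hom DK (OM (pointwise K T) (M, X)) Y) (hom AK M (OM RK (X, Y)))"
    unfolding bij_betw_def pointwise_simps
    using \<Phi>_inj[OF M] \<Phi>_in[OF M] \<Phi>_surj[OF M] by blast
next
  fix M M' X X' Y Y' f g h t
  assume "f \<in> hom AK M' M \<and> g \<in> hom BK X' X \<and> h \<in> hom DK Y Y' \<and>
    t \<in> hom DK (OM (pointwise K T) (M, X)) Y"
  then have f: "f \<in> Arr AK" "src f = M'" "trg f = M" and g: "g \<in> Arr BK" "src g = X'" "trg g = X"
    and h: "h \<in> Arr DK" "src h = Y" "trg h = Y'" and t: "t \<in> hom DK (pointwise_ob K T M X) Y"
    and t': "t \<in> Arr DK" "src t = pointwise_ob K T M X" "trg t = Y"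
    by (auto simp: hom_iff)
  have Ob: "M \<in> Ob AK" "M' \<in> Ob AK" "X \<in> Ob BK" "X' \<in> Ob BK" "Y \<in> Ob DK" "Y' \<in> Ob DK"
    using f g h by auto
  define s where "s = h \<cdot>\<^bsub>DK\<^esub> t \<cdot>\<^bsub>DK\<^esub> AM (pointwise K T) (f, g)"
  have s: "s \<in> hom DK (pointwise_ob K T M' X') Y'"
  proof -
    have "h \<cdot>\<^bsub>DK\<^esub> t \<in> Arr DK"
      by (rule KD.fc_Arr_Comp) (use h t' in simp_all)
    then have "s \<in> Arr DK"
      unfolding s_def
      by (rule KD.fc_Arr_Comp[OF TK.Arr_pointwise[OF f(1) g(1)]]) (use f g t' in simp)
    then show ?thesis using f g h by (simp add: hom_iff s_def)
  qed
  have s_cmp: "cmp s l = cmp h l \<cdot>\<^bsub>D\<^esub> cmp t l \<cdot>\<^bsub>D\<^esub> AM T (cmp f l, cmp g l)" if "l \<in> Ob K" for l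
    using that by (simp add: s_def)
  have RK: "AM RK (g, h) \<in> hom AK (OM RK (X, Y)) (OM RK (X', Y'))"
    using Functor.AM_in[OF Functor_RK, of "(g, h)" "(X, Y)" "(X', Y')"] g h by (simp add: hom_iff)
  define v where "v = AM RK (g, h) \<cdot>\<^bsub>AK\<^esub> \<Phi> M X Y t \<cdot>\<^bsub>AK\<^esub> f"
  have \<Phi>t: "\<Phi> M X Y t \<in> Arr AK" "src (\<Phi> M X Y t) = M" "trg (\<Phi> M X Y t) = OM RK (X, Y)"
    using \<Phi>_in[OF Ob(1,3,5) t] by (simp_all add: hom_iff)
  have v: "v \<in> Arr AK" "src v = M'" "trg v = OM RK (X', Y')"
  proof -
    have "AM RK (g, h) \<cdot>\<^bsub>AK\<^esub> \<Phi> M X Y t \<in> Arr AK"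
      by (rule KA.fc_Arr_Comp) (use RK \<Phi>t in \<open>simp_all add: hom_iff\<close>)
    then show "v \<in> Arr AK"
      unfolding v_def by (rule KA.fc_Arr_Comp[OF f(1)]) (use f \<Phi>t in simp)
    show "src v = M'" "trg v = OM RK (X', Y')"
      using f g h by (simp_all add: v_def)
  qed
  have "\<Phi> M' X' Y' s = v"
  proof (rule Arr_fun_cat_eqI[of _ K A])
    show "\<Phi> M' X' Y' s \<in> Arr AK" "src (\<Phi> M' X' Y' s) = src v" "trg (\<Phi> M' X' Y' s) = trg v"
      using \<Phi>_in[OF Ob(2,4,6) s] v by (simp_all add: hom_iff)
    fix k assume k: "k \<in> Ob K"
    show "cmp (\<Phi> M' X' Y' s) k = cmp v k"
    proof (rule RK_eqI[OF Ob(4,6) k \<Phi>_cmp(1)[OF Ob(2,4,6) s k]])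
      show "cmp v k \<in> hom A (OM M' k) (End (OM S (k, X')) Y')"
        using v k by (simp add: hom_iff)
      fix e assume e: "e \<in> Arr K" "Dom K e = k"
      let ?l = "Cod K e" and ?u = "cmp (\<Phi> M X Y t) k"
      note u = \<Phi>_cmp[OF Ob(1,3,5) t k]
      have \<tau>: "adjunct M X Y (cmp t) ?l \<in> hom A (OM M ?l) (OM R (OM X ?l, OM Y ?l))"
        using adjunct_in[OF Ob(1,3,5) t] e by simp
      have G: "AM weighted_end (Ide K k, g, h) \<in> hom A (End (OM S (k, X)) Y) (End (OM S (k, X')) Y')"
        using g h k by (simp add: weighted_end_def hom_iff)
      have "leg X' Y' e \<cdot>\<^bsub>A\<^esub> cmp v k = leg X' Y' e \<cdot>\<^bsub>A\<^esub> AM weighted_end (Ide K k, g, h) \<cdot>\<^bsub>A\<^esub> (?u \<cdot>\<^bsub>A\<^esub> cmp f k)"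
        using G u(1) f e k Ob by (simp add: v_def hom_iff R.D.assoc_Comp)
      also have "\<dots> = AM R (cmp g ?l, cmp h ?l) \<cdot>\<^bsub>A\<^esub> leg X Y e \<cdot>\<^bsub>A\<^esub> (?u \<cdot>\<^bsub>A\<^esub> cmp f k)"
        using leg_weighted_end[of g h "Ide K k" e] g h e k by simp
      also have "\<dots> = AM R (cmp g ?l, cmp h ?l) \<cdot>\<^bsub>A\<^esub> (leg X Y e \<cdot>\<^bsub>A\<^esub> ?u) \<cdot>\<^bsub>A\<^esub> cmp f k"
        using u(1) f g h e k Ob by (simp add: hom_iff R.D.assoc_Comp)
      also have "\<dots> = AM R (cmp g ?l, cmp h ?l) \<cdot>\<^bsub>A\<^esub> adjunct M X Y (cmp t) ?l \<cdot>\<^bsub>A\<^esub> (AM M e \<cdot>\<^bsub>A\<^esub> cmp f k)"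
        using u(2)[OF e] \<tau> f g h e k Ob by (simp add: hom_iff R.D.assoc_Comp)
      also have "\<dots> = AM R (cmp g ?l, cmp h ?l) \<cdot>\<^bsub>A\<^esub> adjunct M X Y (cmp t) ?l \<cdot>\<^bsub>A\<^esub> (cmp f ?l \<cdot>\<^bsub>A\<^esub> AM M' e)"
        using KA.fc_natural[OF f(1) e(1)] f e by simp
      also have "\<dots> = AM R (cmp g ?l, cmp h ?l) \<cdot>\<^bsub>A\<^esub> adjunct M X Y (cmp t) ?l \<cdot>\<^bsub>A\<^esub> cmp f ?l \<cdot>\<^bsub>A\<^esub> AM M' e"
        using \<tau> f g h e k Ob by (simp add: hom_iff R.D.assoc_Comp)
      also have "\<dots> = adjunct M' X' Y' (cmp s) ?l \<cdot>\<^bsub>A\<^esub> AM M' e"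
        using \<phi>_natural[of "cmp f ?l" "OM M' ?l" "OM M ?l" "cmp g ?l" "OM X' ?l" "OM X ?l"
            "cmp h ?l" "OM Y ?l" "OM Y' ?l" "cmp t ?l"] f g h t' e s_cmp by (simp add: hom_iff)
      also have "\<dots> = leg X' Y' e \<cdot>\<^bsub>A\<^esub> cmp (\<Phi> M' X' Y' s) k"
        using \<Phi>_cmp(2)[OF Ob(2,4,6) s k e] by simp
      finally show "leg X' Y' e \<cdot>\<^bsub>A\<^esub> cmp (\<Phi> M' X' Y' s) k = leg X' Y' e \<cdot>\<^bsub>A\<^esub> cmp v k" by simp
    qed
  qed (rule v(1))
  then show "\<Phi> M' X' Y' (h \<cdot>\<^bsub>DK\<^esub> t \<cdot>\<^bsub>DK\<^esub> AM (pointwise K T) (f, g)) =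
      AM RK (g, h) \<cdot>\<^bsub>AK\<^esub> \<Phi> M X Y t \<cdot>\<^bsub>AK\<^esub> f"
    unfolding s_def v_def .
qed

end

section \<open>The two adjunctions for diagrams in a closed module\<close>

definition swap_functor where
  "swap_functor T = \<lparr>OM = (\<lambda>(b, a). OM T (a, b)), AM = (\<lambda>(g, f). AM T (f, g))\<rparr>"

lemma swap_functor_simps [simp]:
  "OM (swap_functor T) (b, a) = OM T (a, b)" "AM (swap_functor T) (g, f) = AM T (f, g)"
  by (simp_all add: swap_functor_def)

lemma pointwise_swap [simp]: "pointwise_ob K (swap_functor T) Y X = pointwise_ob K T X Y"
  "AM (pointwise K (swap_functor T)) (t, s) = AM (pointwise K T) (s, t)"
  by (simp_all add: pointwise_ob_def pointwise_def)

definition precompose_functor where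
  "precompose_functor F T = \<lparr>OM = (\<lambda>(a, b). OM T (OM F a, b)), AM = (\<lambda>(f, g). AM T (AM F f, g))\<rparr>"

lemma precompose_functor_simps [simp]:
  "OM (precompose_functor F T) (a, b) = OM T (OM F a, b)"
  "AM (precompose_functor F T) (f, g) = AM T (AM F f, g)"
  by (simp_all add: precompose_functor_def)

lemma Bifunctor_swap:
  assumes "Bifunctor A B D T"
  shows "Bifunctor B A D (swap_functor T)"
proof -
  interpret Bifunctor A B D T by fact
  show ?thesis
    by (intro BifunctorI FunctorI category_prod A.category_axioms B.category_axioms D.category_axioms)
      (auto simp: AM_Comp2)
qed

lemma Bifunctor_precompose:
  assumes "Functor A A' F" "Bifunctor A' B D T"
  shows "Bifunctor A B D (precompose_functor F T)"
proof -
  interpret F: Functor A A' F by fact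
  interpret T: Bifunctor A' B D T by fact
  show ?thesis
    by (intro BifunctorI FunctorI category_prod F.A.category_axioms T.B.category_axioms T.D.category_axioms)
      (auto simp: T.AM_Comp2 F.AM_Comp')
qed

lemma left_adjoint_bifunctor_preserves_copower:
  assumes T: "Bifunctor A B D T" and R: "Hom_bifunctor B D A R" and \<phi>: "natural_bij A B D T R \<phi>"
    and cop: "is_copower A I x y \<iota>" and x: "x \<in> Ob A" and b: "b \<in> Ob B"
  shows "is_copower D I (OM T (x, b)) (OM T (y, b)) (\<lambda>i. AM T (\<iota> i, Ide B b))"
proof -
  interpret T: Bifunctor A B D T by fact
  interpret R: Hom_bifunctor B D A R by fact
  show ?thesis
  proof (rule left_adjoint_preserves_copower[where r = "\<lambda>d. OM R (b, d)" and \<phi> = "\<lambda>a d. \<phi> a b d",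
        OF T.A.category_axioms T.D.category_axioms cop x])
    show "bij_betw (\<phi> a b d) (hom D (OM T (a, b)) d) (hom A a (OM R (b, d)))"
      if "a \<in> Ob A" "d \<in> Ob D" for a d
      by (rule natural_bij_bij[OF \<phi> that(1) b that(2)])
    then have \<phi>_in: "\<phi> a b d u \<in> hom A a (OM R (b, d))"
      if "a \<in> Ob A" "d \<in> Ob D" "u \<in> hom D (OM T (a, b)) d" for a d u
      using that by (meson bij_betwE)
    show "\<phi> a' b d (u \<cdot>\<^bsub>D\<^esub> AM T (f, Ide B b)) = \<phi> a b d u \<cdot>\<^bsub>A\<^esub> f"
      if f: "f \<in> hom A a' a" and d: "d \<in> Ob D" and u: "u \<in> hom D (OM T (a, b)) d" for a a' d f u
    proof -
      have "\<phi> a' b d (Ide D d \<cdot>\<^bsub>D\<^esub> u \<cdot>\<^bsub>D\<^esub> AM T (f, Ide B b)) =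
          AM R (Ide B b, Ide D d) \<cdot>\<^bsub>A\<^esub> \<phi> a b d u \<cdot>\<^bsub>A\<^esub> f"
        by (rule natural_bij_natural[OF \<phi> f T.B.Ide_in[OF b] T.D.Ide_in[OF d] u])
      moreover have "a \<in> Ob A" using f T.A.Ob_Cod by (auto simp: hom_iff)
      ultimately show ?thesis
        using \<phi>_in[of a d u] u b d by (simp add: hom_iff)
    qed
  qed (use b in \<open>auto simp: hom_iff\<close>)
qed

text \<open>
  The two adjunctions of a closed module compose to \<open>C(m \<otimes> c, d) \<cong> C(c, d\<^sup>m)\<close>.
\<close>

lemma natural_bij_swap:
  assumes \<phi>: "natural_bij V C C T H \<phi>" and \<psi>: "natural_bij_HP V C H P \<psi>"
    and T: "Bifunctor V C C T"
  shows "natural_bij C V C (swap_functor T) P (\<lambda>c m d u. \<psi> m c d (\<phi> m c d u))"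
  unfolding natural_bij_def
proof (intro conjI ballI allI impI; (unfold swap_functor_simps)?)
  fix c m d assume "c \<in> Ob C" "m \<in> Ob V" "d \<in> Ob C"
  then show "bij_betw (\<lambda>u. \<psi> m c d (\<phi> m c d u)) (hom C (OM T (m, c)) d) (hom C c (OM P (m, d)))"
    using bij_betw_trans[OF natural_bij_bij[OF \<phi>] natural_bij_HP_bij[OF \<psi>]] by (simp add: comp_def)
next
  interpret T: Bifunctor V C C T by fact
  fix c c' m m' d d' g f h u
  assume "g \<in> hom C c' c \<and> f \<in> hom V m' m \<and> h \<in> hom C d d' \<and> u \<in> hom C (OM T (m, c)) d"
  then have *: "g \<in> hom C c' c" "f \<in> hom V m' m" "h \<in> hom C d d'" "u \<in> hom C (OM T (m, c)) d"
    by simp_all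
  then have "m \<in> Ob V" "c \<in> Ob C" "d \<in> Ob C"
    by (auto simp: hom_iff)
  from bij_betwE[OF natural_bij_bij[OF \<phi> this]] * have "\<phi> m c d u \<in> hom V m (OM H (c, d))"
    by blast
  then show "\<psi> m' c' d' (\<phi> m' c' d' (h \<cdot>\<^bsub>C\<^esub> u \<cdot>\<^bsub>C\<^esub> AM T (f, g))) =
      AM P (f, h) \<cdot>\<^bsub>C\<^esub> \<psi> m c d (\<phi> m c d u) \<cdot>\<^bsub>C\<^esub> g"
    using natural_bij_natural[OF \<phi> *(2,1,3,4)] natural_bij_HP_natural[OF \<psi> *(2,1,3)] by simp
qed

text \<open>
  Conversely, \<open>V(m, H(c,d)) \<cong> C(c, d\<^sup>m)\<close> results from passing through \<open>C(m \<otimes> c, d)\<close>.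
\<close>

lemma natural_bij_HP_of_natural_bij:
  assumes T: "Bifunctor V C C T" and \<phi>: "natural_bij V C C T H \<phi>" and \<psi>: "natural_bij C V C T' P \<psi>"
    and swap: "\<And>m c. OM T' (c, m) = OM T (m, c)" "\<And>f g. AM T' (g, f) = AM T (f, g)"
  shows "natural_bij_HP V C H P (\<lambda>m c d v. \<psi> c m d (inv_into (hom C (OM T (m, c)) d) (\<phi> m c d) v))"
  unfolding natural_bij_HP_def
proof (intro conjI ballI allI impI)
  fix m c d assume "m \<in> Ob V" "c \<in> Ob C" "d \<in> Ob C"
  then show "bij_betw (\<lambda>v. \<psi> c m d (inv_into (hom C (OM T (m, c)) d) (\<phi> m c d) v))
      (hom V m (OM H (c, d))) (hom C c (OM P (m, d)))"
    using bij_betw_trans[OF bij_betw_inv_into[OF natural_bij_bij[OF \<phi>]]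
      natural_bij_bij[OF \<psi>, unfolded swap]] by (simp add: comp_def)
next
  interpret T: Bifunctor V C C T by fact
  have inv: "inv_into (hom C (OM T (m, c)) d) (\<phi> m c d) (\<phi> m c d u) = u"
    if "m \<in> Ob V" "c \<in> Ob C" "u \<in> hom C (OM T (m, c)) d" for m c d u
  proof -
    have "d \<in> Ob C" using that(3) by (auto simp: hom_iff)
    from bij_betw_imp_inj_on[OF natural_bij_bij[OF \<phi> that(1,2) this]] that(3) show ?thesis
      by (rule inv_into_f_f)
  qed
  fix m m' c c' d d' f g h v
  assume "f \<in> hom V m' m \<and> g \<in> hom C c' c \<and> h \<in> hom C d d' \<and> v \<in> hom V m (OM H (c, d))"
  then have *: "f \<in> hom V m' m" "g \<in> hom C c' c" "h \<in> hom C d d'" "v \<in> hom V m (OM H (c, d))"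
    by simp_all
  then have Ob: "m \<in> Ob V" "c \<in> Ob C" "d \<in> Ob C" "m' \<in> Ob V" "c' \<in> Ob C" "d' \<in> Ob C"
    by (auto simp: hom_iff)
  have "v \<in> \<phi> m c d ` hom C (OM T (m, c)) d"
    using natural_bij_bij[OF \<phi> Ob(1-3)] *(4) by (simp add: bij_betw_def)
  then obtain u where u: "u \<in> hom C (OM T (m, c)) d" "v = \<phi> m c d u" by blast
  have "AM H (g, h) \<cdot>\<^bsub>V\<^esub> v \<cdot>\<^bsub>V\<^esub> f = \<phi> m' c' d' (h \<cdot>\<^bsub>C\<^esub> u \<cdot>\<^bsub>C\<^esub> AM T (f, g))"
    using natural_bij_natural[OF \<phi> *(1-3) u(1)] u(2) by simp
  moreover have "h \<cdot>\<^bsub>C\<^esub> u \<cdot>\<^bsub>C\<^esub> AM T (f, g) \<in> hom C (OM T (m', c')) d'"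
    using * u(1) by (auto simp: hom_iff)
  ultimately have "inv_into (hom C (OM T (m', c')) d') (\<phi> m' c' d') (AM H (g, h) \<cdot>\<^bsub>V\<^esub> v \<cdot>\<^bsub>V\<^esub> f) =
      h \<cdot>\<^bsub>C\<^esub> u \<cdot>\<^bsub>C\<^esub> AM T' (g, f)"
    using inv Ob by (simp add: swap)
  moreover have "\<psi> c' m' d' (h \<cdot>\<^bsub>C\<^esub> u \<cdot>\<^bsub>C\<^esub> AM T' (g, f)) = AM P (f, h) \<cdot>\<^bsub>C\<^esub> \<psi> c m d u \<cdot>\<^bsub>C\<^esub> g"
    using natural_bij_natural[OF \<psi> *(2,1,3)] u(1) by (simp add: swap)
  ultimately show "\<psi> c' m' d' (inv_into (hom C (OM T (m', c')) d') (\<phi> m' c' d')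
        (AM H (g, h) \<cdot>\<^bsub>V\<^esub> v \<cdot>\<^bsub>V\<^esub> f)) =
      AM P (f, h) \<cdot>\<^bsub>C\<^esub> \<psi> c m d (inv_into (hom C (OM T (m, c)) d) (\<phi> m c d) v) \<cdot>\<^bsub>C\<^esub> g"
    using inv[OF Ob(1,2) u(1)] u(2) by simp
qed

definition inverse_arrow where
  "inverse_arrow C f = (SOME g. g \<in> hom C (Cod C f) (Dom C f) \<and>
     g \<cdot>\<^bsub>C\<^esub> f = Ide C (Dom C f) \<and> f \<cdot>\<^bsub>C\<^esub> g = Ide C (Cod C f))"

lemma inverse_arrow:
  assumes "is_iso C x y f"
  shows "inverse_arrow C f \<in> hom C y x" "inverse_arrow C f \<cdot>\<^bsub>C\<^esub> f = Ide C x"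
    "f \<cdot>\<^bsub>C\<^esub> inverse_arrow C f = Ide C y" "is_iso C y x (inverse_arrow C f)"
proof -
  have "\<exists>g. g \<in> hom C (Cod C f) (Dom C f) \<and> g \<cdot>\<^bsub>C\<^esub> f = Ide C (Dom C f) \<and> f \<cdot>\<^bsub>C\<^esub> g = Ide C (Cod C f)"
    using assms by (auto simp: is_iso_def hom_iff)
  from someI_ex[OF this] show
    "inverse_arrow C f \<in> hom C y x" "inverse_arrow C f \<cdot>\<^bsub>C\<^esub> f = Ide C x"
    "f \<cdot>\<^bsub>C\<^esub> inverse_arrow C f = Ide C y" "is_iso C y x (inverse_arrow C f)"
    using assms by (auto simp: inverse_arrow_def is_iso_def hom_iff)
qed

lemma (in category) inverse_arrow_natural:
  assumes "is_iso C x y f" "is_iso C x' y' f'" "u \<in> hom C x x'" "v \<in> hom C y y'" "f' \<cdot> u = v \<cdot> f"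
  shows "inverse_arrow C f' \<cdot> v = u \<cdot> inverse_arrow C f"
proof -
  let ?i = "inverse_arrow C f" and ?i' = "inverse_arrow C f'"
  note i = inverse_arrow[OF assms(1), unfolded hom_iff] and i' = inverse_arrow[OF assms(2), unfolded hom_iff]
  have f: "f \<in> hom C x y" "f' \<in> hom C x' y'" using assms(1,2) by (simp_all add: is_iso_def)
  have "?i' \<cdot> v = ?i' \<cdot> (v \<cdot> f) \<cdot> ?i"
    using f assms(4) i i' by (simp add: hom_iff assoc_Comp)
  also have "\<dots> = ?i' \<cdot> (f' \<cdot> u) \<cdot> ?i" using assms(5) by simp
  also have "\<dots> = ?i' \<cdot> f' \<cdot> (u \<cdot> ?i)"
    using f assms(3) i(1) i'(1) by (simp add: hom_iff assoc_Comp)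
  also have "\<dots> = u \<cdot> ?i"
    using f assms(3) i(1) i'(1,2) by (simp add: hom_iff)
  finally show ?thesis .
qed

text \<open>
  The preservation of copowers by \<open>m \<otimes> -\<close> is assumed instead of a functor \<open>d\<^sup>m\<close>, so that \<open>V\<close> acting
  on itself is an instance. The inclusion \<open>X\<^sub>l \<rightarrow> h\<^sub>k(l) \<otimes> X\<^sub>l\<close> is \<open>X\<^sub>l \<cong> 1 \<otimes> X\<^sub>l\<close> followed by a summand
  inclusion of \<open>h\<^sub>k(l)\<close>.
\<close>

locale enriched_module_diagrams =
  module_diagrams K V C act \<alpha> l + copowers_of_unit K V + En: Hom_bifunctor C C "mcat V" en
  for K :: "('s, 's) cat" and V :: "('o, 'a) monoidal" and C :: "('p, 'b) cat" and act \<alpha> l and en +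
  fixes \<phi>
  assumes infinite_universe': "infinite (UNIV :: 's set)"
    and complete_V: "complete TYPE('s) (mcat V)"
    and \<phi>': "natural_bij (mcat V) C C act en \<phi>"
    and act_copower: "\<lbrakk>m \<in> ObV; is_copower C J x y \<iota>; x \<in> Ob C\<rbrakk> \<Longrightarrow>
      is_copower C (J :: 's set) (OM act (m, x)) (OM act (m, y)) (\<lambda>i. AM act (idV m, \<iota> i))"
begin

abbreviation "l_inv c \<equiv> inverse_arrow C (l c)"
abbreviation "act_h \<equiv> precompose_functor hF (pointwise K act)"
abbreviation "act_in X g \<equiv> AM act (inc g, Ide C (OM X (Cod K g))) \<cdot>\<^bsub>C\<^esub> l_inv (OM X (Cod K g))"

lemma l_inv_natural:
  assumes "u \<in> Arr C"
  shows "l_inv (Cod C u) \<cdot>\<^bsub>C\<^esub> u = AM act (idV I, u) \<cdot>\<^bsub>C\<^esub> l_inv (Dom C u)"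
proof (rule C.inverse_arrow_natural[OF l_iso l_iso])
  show "l (Cod C u) \<cdot>\<^bsub>C\<^esub> AM act (idV I, u) = u \<cdot>\<^bsub>C\<^esub> l (Dom C u)"
    using l_natural[of u] assms by (simp add: hom_iff)
qed (use assms unit_in in \<open>auto simp: hom_iff\<close>)

lemma
  assumes "c \<in> Ob C"
  shows Arr_l_inv [simp]: "l_inv c \<in> Arr C" and Dom_l_inv [simp]: "Dom C (l_inv c) = c"
    and Cod_l_inv [simp]: "Cod C (l_inv c) = OM act (I, c)"
  using inverse_arrow(1)[OF l_iso[OF assms]] by (simp_all add: hom_iff)

text \<open>
  \<open>- \<otimes> X\<^sub>l\<close> preserves the copower \<open>h\<^sub>k(l)\<close> of the unit because it is left adjoint to \<open>C(X\<^sub>l,-)\<close>.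
\<close>

lemma act_in_copower:
  assumes X: "X \<in> Ob CK" and "m \<in> ObV" "k \<in> Ob K" "l' \<in> Ob K"
  shows "is_copower C (hom K k l') (OM act (m, OM X l')) (OM act (m, OM (OM act_h (k, X)) l'))
    (\<lambda>g. AM act (idV m, act_in X g))"
proof -
  let ?x = "OM X l'"
  have x: "?x \<in> Ob C" using assms by simp
  have "is_copower C (hom K k l') (OM act (I, ?x)) (OM act (OM (hh k) l', ?x))
      (\<lambda>g. AM act (inc g, Ide C ?x))"
    by (rule left_adjoint_bifunctor_preserves_copower[OF A.T.Bifunctor_axioms En.Hom_bifunctor_axioms
          \<phi>' is_copower_h[OF assms(4)] unit_in x])
  from is_copower_iso[OF C.category_axioms this inverse_arrow(4)[OF l_iso[OF x]] C.is_iso_Ide]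
  have "is_copower C (hom K k l') ?x (OM act (OM (hh k) l', ?x)) 
      (\<lambda>g. Ide C (OM act (OM (hh k) l', ?x)) \<cdot>\<^bsub>C\<^esub> (AM act (inc g, Ide C ?x) \<cdot>\<^bsub>C\<^esub> l_inv ?x))"
    using x assms by simp
  then have "is_copower C (hom K k l') ?x (OM act (OM (hh k) l', ?x)) (\<lambda>g. act_in X g)"
    by (rule is_copower_cong) (use x assms in \<open>auto simp: hom_iff\<close>)
  from act_copower[OF assms(2) this x] show ?thesis using assms by simp
qed

lemma act_l_inv:
  assumes v: "v \<in> Arr (mcat V)" "Dom (mcat V) v = I" and u: "u \<in> Arr C"
  shows "AM act (v, u) \<cdot>\<^bsub>C\<^esub> l_inv (Dom C u) = AM act (v, Ide C (Cod C u)) \<cdot>\<^bsub>C\<^esub> l_inv (Cod C u) \<cdot>\<^bsub>C\<^esub> u"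
proof -
  have "AM act (v, u) \<cdot>\<^bsub>C\<^esub> l_inv (Dom C u) =
      AM act (v, Ide C (Cod C u)) \<cdot>\<^bsub>C\<^esub> AM act (idV I, u) \<cdot>\<^bsub>C\<^esub> l_inv (Dom C u)"
    using assms unit_in by (simp add: A.T.AM_Comp2)
  also have "\<dots> = AM act (v, Ide C (Cod C u)) \<cdot>\<^bsub>C\<^esub> (l_inv (Cod C u) \<cdot>\<^bsub>C\<^esub> u)"
    unfolding l_inv_natural[OF u] using assms unit_in by (simp add: C.assoc_Comp)
  also have "\<dots> = AM act (v, Ide C (Cod C u)) \<cdot>\<^bsub>C\<^esub> l_inv (Cod C u) \<cdot>\<^bsub>C\<^esub> u"
    using assms unit_in by (simp add: C.assoc_Comp)
  finally show ?thesis .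
qed

sublocale Hom: Copower_weights K C C "mcat V" en act_h act \<phi> act_in
proof (intro Copower_weights.intro Copower_weights_axioms.intro End_bifunctor.intro End_bifunctor_axioms.intro)
  show "category K" "Hom_bifunctor C C (mcat V) en" "Bifunctor (mcat V) C C act"
    by unfold_locales
  show "infinite (UNIV :: 's set)" by (rule infinite_universe')
  show "complete TYPE('s) (mcat V)" by (rule complete_V)
  show "natural_bij (mcat V) C C act en \<phi>" by (rule \<phi>')
  interpret P: Bifunctor VK CK CK "pointwise K act"
    by (rule BifunctorI[OF T.KA.category_fun_cat A.KB.category_fun_cat A.Functor_pointwise])
  show "Bifunctor (op K) CK CK act_h"
    by (rule Bifunctor_precompose[OF Functor_hF P.Bifunctor_axioms])
  show "is_copower C (hom K k l') (OM act (m, OM X l')) (OM act (m, OM (OM act_h (k, X)) l'))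
    (\<lambda>g. AM act (idV m, act_in X g))" if "X \<in> Ob CK" "m \<in> ObV" "k \<in> Ob K" "l' \<in> Ob K" for X m k l'
    by (rule act_in_copower) (fact that)+
  show "act_in X g \<in> hom C (OM X (Cod K g)) (OM (OM act_h (Dom K g, X)) (Cod K g))"
    if "X \<in> Ob CK" "g \<in> Arr K" for X g
    using that unit_in by (simp add: hom_iff)
  show "cmp (AM act_h (e, s)) (Cod K g) \<cdot>\<^bsub>C\<^esub> act_in (src s) g =
      act_in (trg s) (g \<cdot>\<^bsub>K\<^esub> e) \<cdot>\<^bsub>C\<^esub> cmp s (Cod K g)"
    if s: "s \<in> Arr CK" and e: "e \<in> Arr K" and g: "g \<in> Arr K" "Dom K g = Cod K e" for s e g
  proof -
    have "cmp (AM act_h (e, s)) (Cod K g) \<cdot>\<^bsub>C\<^esub> act_in (src s) g =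
        AM act (inc (g \<cdot>\<^bsub>K\<^esub> e), cmp s (Cod K g)) \<cdot>\<^bsub>C\<^esub> l_inv (OM (src s) (Cod K g))"
      using s e g unit_in by (simp add: C.assoc_Comp[symmetric] A.T.AM_Comp2 hF_inc)
    also have "\<dots> = act_in (trg s) (g \<cdot>\<^bsub>K\<^esub> e) \<cdot>\<^bsub>C\<^esub> cmp s (Cod K g)"
      using act_l_inv[of "inc (g \<cdot>\<^bsub>K\<^esub> e)" "cmp s (Cod K g)"] s e g by simp
    finally show ?thesis .
  qed
  show "AM (OM act_h (Dom K g, X)) f \<cdot>\<^bsub>C\<^esub> act_in X g = act_in X (f \<cdot>\<^bsub>K\<^esub> g) \<cdot>\<^bsub>C\<^esub> AM X f"
    if X: "X \<in> Ob CK" and g: "g \<in> Arr K" and f: "f \<in> Arr K" "Dom K f = Cod K g" for X g f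
  proof -
    have "AM (OM act_h (Dom K g, X)) f \<cdot>\<^bsub>C\<^esub> act_in X g =
        AM act (inc (f \<cdot>\<^bsub>K\<^esub> g), AM X f) \<cdot>\<^bsub>C\<^esub> l_inv (OM X (Cod K g))"
      using X g f unit_in by (simp add: C.assoc_Comp[symmetric] A.T.AM_Comp2 hh_inc)
    also have "\<dots> = act_in X (f \<cdot>\<^bsub>K\<^esub> g) \<cdot>\<^bsub>C\<^esub> AM X f"
      using act_l_inv[of "inc (f \<cdot>\<^bsub>K\<^esub> g)" "AM X f"] X g f by simp
    finally show ?thesis .
  qed
qed

text \<open>
  At an object \<open>k\<close> the two descriptions differ only in that one has \<open>h\<close> applied to the identity of \<open>k\<close>
  where the other has the identity of \<open>h\<^sub>k\<close>.
\<close>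

lemma fun_Hom_eq: "fun_Hom K V C act en = Hom.RK"
  by (auto simp: fun_Hom_def fun_Hom_ob_def Let_def Hom.RK_def Hom.weighted_end_def curry_functor_def
      curry_ob_def hF_Ide fun_eq_iff intro!: ext)

lemma Functor_fun_Hom: "Functor (op CK \<times>\<^sub>C CK) VK (fun_Hom K V C act en)"
  unfolding fun_Hom_eq by (rule Hom.Functor_RK)

lemma natural_bij_fun_Hom: "natural_bij VK CK CK (pointwise K act) (fun_Hom K V C act en) Hom.\<Phi>"
  unfolding fun_Hom_eq by (rule Hom.natural_bij_\<Phi>)

end

text \<open>
  Here the action is regarded as a bifunctor with the \<open>C\<close>-argument first, and \<open>M \<otimes> h\<^sub>k\<close> as a sum of
  copies of \<open>M\<close>, with inclusions \<open>M\<^sub>l \<cong> M\<^sub>l \<otimes> 1 \<rightarrow> M\<^sub>l \<otimes> h\<^sub>k(l)\<close>.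
\<close>

locale cotensored_module_diagrams =
  module_diagrams K V C act \<alpha> l + copowers_of_unit K V + Cot: Hom_bifunctor "mcat V" C C cot
  for K :: "('s, 's) cat" and V :: "('o, 'a) monoidal" and C :: "('p, 'b) cat" and act \<alpha> l and cot +
  fixes \<chi>
  assumes infinite_universe': "infinite (UNIV :: 's set)"
    and complete_C: "complete TYPE('s) C"
    and \<chi>: "natural_bij C (mcat V) C (swap_functor act) cot \<chi>"
    and tens_copower: "\<lbrakk>m \<in> ObV; is_copower (mcat V) J x y \<iota>; x \<in> ObV\<rbrakk> \<Longrightarrow>
      is_copower (mcat V) (J :: 's set) (m \<otimes> x) (m \<otimes> y) (\<lambda>i. idV m \<otimes>\<^sub>a \<iota> i)"
    and act_copower_left: "\<lbrakk>c \<in> Ob C; is_copower (mcat V) J x y \<iota>; x \<in> ObV\<rbrakk> \<Longrightarrow>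
      is_copower C (J :: 's set) (OM act (x, c)) (OM act (y, c)) (\<lambda>i. AM act (\<iota> i, Ide C c))"
begin

abbreviation "r_inv m \<equiv> inverse_arrow (mcat V) (runit V m)"
abbreviation "tens_h \<equiv> precompose_functor hF (swap_functor (pointwise K (tens V)))"
abbreviation "tens_in M g \<equiv> (idV (OM M (Cod K g)) \<otimes>\<^sub>a inc g) \<bullet> r_inv (OM M (Cod K g))"

lemma
  assumes "m \<in> ObV"
  shows Arr_r_inv [simp]: "r_inv m \<in> Arr (mcat V)" and Dom_r_inv [simp]: "Dom (mcat V) (r_inv m) = m"
    and Cod_r_inv [simp]: "Cod (mcat V) (r_inv m) = m \<otimes> I"
  using inverse_arrow(1)[OF runit_iso[OF assms]] by (simp_all add: hom_iff)

lemma r_inv_natural: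
  assumes "u \<in> Arr (mcat V)"
  shows "r_inv (Cod (mcat V) u) \<bullet> u = (u \<otimes>\<^sub>a idV I) \<bullet> r_inv (Dom (mcat V) u)"
proof (rule tens.B.inverse_arrow_natural[OF runit_iso runit_iso])
  show "runit V (Cod (mcat V) u) \<bullet> (u \<otimes>\<^sub>a idV I) = u \<bullet> runit V (Dom (mcat V) u)"
    using runit_natural[of u] assms by (simp add: hom_iff)
qed (use assms unit_in in \<open>auto simp: hom_iff\<close>)

lemma tens_r_inv:
  assumes v: "v \<in> Arr (mcat V)" "Dom (mcat V) v = I" and u: "u \<in> Arr (mcat V)"
  shows "(u \<otimes>\<^sub>a v) \<bullet> r_inv (Dom (mcat V) u) =
    (idV (Cod (mcat V) u) \<otimes>\<^sub>a v) \<bullet> r_inv (Cod (mcat V) u) \<bullet> u"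
proof -
  have "(u \<otimes>\<^sub>a v) \<bullet> r_inv (Dom (mcat V) u) =
      (idV (Cod (mcat V) u) \<otimes>\<^sub>a v) \<bullet> (u \<otimes>\<^sub>a idV I) \<bullet> r_inv (Dom (mcat V) u)"
    using assms unit_in by (simp add: T.T.AM_Comp2)
  also have "\<dots> = (idV (Cod (mcat V) u) \<otimes>\<^sub>a v) \<bullet> (r_inv (Cod (mcat V) u) \<bullet> u)"
    unfolding r_inv_natural[OF u] using assms unit_in by (simp add: tens.B.assoc_Comp)
  also have "\<dots> = (idV (Cod (mcat V) u) \<otimes>\<^sub>a v) \<bullet> r_inv (Cod (mcat V) u) \<bullet> u"
    using assms unit_in by (simp add: tens.B.assoc_Comp)
  finally show ?thesis .
qed

lemma tens_in_copower:
  assumes M: "M \<in> Ob VK" and c: "c \<in> Ob C" and "k \<in> Ob K" "l' \<in> Ob K"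
  shows "is_copower C (hom K k l') (OM act (OM M l', c)) (OM act (OM (OM tens_h (k, M)) l', c))
    (\<lambda>g. AM act (tens_in M g, Ide C c))"
proof -
  let ?m = "OM M l'"
  have m: "?m \<in> ObV" using assms by simp
  have "is_copower (mcat V) (hom K k l') (?m \<otimes> I) (?m \<otimes> OM (hh k) l') (\<lambda>g. idV ?m \<otimes>\<^sub>a inc g)"
    by (rule tens_copower[OF m is_copower_h[OF assms(4)] unit_in])
  from is_copower_iso[OF tens.B.category_axioms this inverse_arrow(4)[OF runit_iso[OF m]] tens.B.is_iso_Ide]
  have "is_copower (mcat V) (hom K k l') ?m (?m \<otimes> OM (hh k) l')
      (\<lambda>g. idV (?m \<otimes> OM (hh k) l') \<bullet> ((idV ?m \<otimes>\<^sub>a inc g) \<bullet> r_inv ?m))"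
    using m assms by simp
  then have "is_copower (mcat V) (hom K k l') ?m (?m \<otimes> OM (hh k) l') (\<lambda>g. tens_in M g)"
    by (rule is_copower_cong) (use m assms unit_in in \<open>auto simp: hom_iff\<close>)
  from act_copower_left[OF c this m] show ?thesis using assms by simp
qed

sublocale Cot: Copower_weights K "mcat V" C C cot tens_h "swap_functor act" \<chi> tens_in
proof (intro Copower_weights.intro Copower_weights_axioms.intro End_bifunctor.intro End_bifunctor_axioms.intro)
  show "category K" "Hom_bifunctor (mcat V) C C cot"
    by unfold_locales
  show "Bifunctor C (mcat V) C (swap_functor act)"
    by (rule Bifunctor_swap[OF A.T.Bifunctor_axioms])
  show "infinite (UNIV :: 's set)" by (rule infinite_universe')
  show "complete TYPE('s) C" by (rule complete_C)
  show "natural_bij C (mcat V) C (swap_functor act) cot \<chi>" by (rule \<chi>)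
  interpret P: Bifunctor VK VK VK "pointwise K (tens V)"
    by (rule BifunctorI[OF T.KA.category_fun_cat T.KA.category_fun_cat T.Functor_pointwise])
  show "Bifunctor (op K) VK VK tens_h"
    by (rule Bifunctor_precompose[OF Functor_hF Bifunctor_swap[OF P.Bifunctor_axioms]])
  show "is_copower C (hom K k l') (OM (swap_functor act) (c, OM M l'))
      (OM (swap_functor act) (c, OM (OM tens_h (k, M)) l'))
      (\<lambda>g. AM (swap_functor act) (Ide C c, tens_in M g))"
    if "M \<in> Ob VK" "c \<in> Ob C" "k \<in> Ob K" "l' \<in> Ob K" for M c k l'
    unfolding swap_functor_simps by (rule tens_in_copower) (fact that)+
  show "tens_in M g \<in> homV (OM M (Cod K g)) (OM (OM tens_h (Dom K g, M)) (Cod K g))"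
    if "M \<in> Ob VK" "g \<in> Arr K" for M g
    using that unit_in by (simp add: hom_iff)
  show "cmp (AM tens_h (e, s)) (Cod K g) \<bullet> tens_in (src s) g =
      tens_in (trg s) (g \<cdot>\<^bsub>K\<^esub> e) \<bullet> cmp s (Cod K g)"
    if s: "s \<in> Arr VK" and e: "e \<in> Arr K" and g: "g \<in> Arr K" "Dom K g = Cod K e" for s e g
  proof -
    have "cmp (AM tens_h (e, s)) (Cod K g) \<bullet> tens_in (src s) g =
        (cmp s (Cod K g) \<otimes>\<^sub>a inc (g \<cdot>\<^bsub>K\<^esub> e)) \<bullet> r_inv (OM (src s) (Cod K g))"
      using s e g unit_in by (simp add: tens.B.assoc_Comp[symmetric] T.T.AM_Comp2 hF_inc)
    also have "\<dots> = tens_in (trg s) (g \<cdot>\<^bsub>K\<^esub> e) \<bullet> cmp s (Cod K g)"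
      using tens_r_inv[of "inc (g \<cdot>\<^bsub>K\<^esub> e)" "cmp s (Cod K g)"] s e g by simp
    finally show ?thesis .
  qed
  show "AM (OM tens_h (Dom K g, M)) f \<bullet> tens_in M g = tens_in M (f \<cdot>\<^bsub>K\<^esub> g) \<bullet> AM M f"
    if M: "M \<in> Ob VK" and g: "g \<in> Arr K" and f: "f \<in> Arr K" "Dom K f = Cod K g" for M g f
  proof -
    have "AM (OM tens_h (Dom K g, M)) f \<bullet> tens_in M g =
        (AM M f \<otimes>\<^sub>a inc (f \<cdot>\<^bsub>K\<^esub> g)) \<bullet> r_inv (OM M (Cod K g))"
      using M g f unit_in by (simp add: tens.B.assoc_Comp[symmetric] T.T.AM_Comp2 hh_inc)
    also have "\<dots> = tens_in M (f \<cdot>\<^bsub>K\<^esub> g) \<bullet> AM M f"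
      using tens_r_inv[of "inc (f \<cdot>\<^bsub>K\<^esub> g)" "AM M f"] M g f by simp
    finally show ?thesis .
  qed
qed

lemma fun_cot_eq: "fun_cot K V C cot = Cot.RK"
  by (auto simp: fun_cot_def fun_cot_ob_def Let_def Cot.RK_def Cot.weighted_end_def curry_functor_def
      curry_ob_def hF_Ide fun_eq_iff intro!: ext)

lemma Functor_fun_cot: "Functor (op VK \<times>\<^sub>C CK) CK (fun_cot K V C cot)"
  unfolding fun_cot_eq by (rule Cot.Functor_RK)

lemma natural_bij_fun_cot:
  "natural_bij CK VK CK (pointwise K (swap_functor act)) (fun_cot K V C cot) Cot.\<Phi>"
  unfolding fun_cot_eq by (rule Cot.natural_bij_\<Phi>)

end

section \<open>The closed module of diagrams\<close>

lemma (in symmetric_monoidal) module_over_itself: "module_cat V (mcat V) (tens V) (assoc V) (lunit V)"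
  by unfold_locales
    (simp_all add: assoc_iso assoc_natural lunit_iso lunit_natural pentagon triangle)

text \<open>
  The braiding carries copowers that are tensored on the right to copowers tensored on the left.
\<close>

lemma (in symmetric_monoidal) tens_left_preserves_copower:
  assumes right: "is_copower (mcat V) J (x \<otimes> m) (y \<otimes> m) (\<lambda>i. \<iota> i \<otimes>\<^sub>a idV m)"
    and m: "m \<in> ObV" and x: "x \<in> ObV" and cop: "is_copower (mcat V) J x y \<iota>"
  shows "is_copower (mcat V) J (m \<otimes> x) (m \<otimes> y) (\<lambda>i. idV m \<otimes>\<^sub>a \<iota> i)"
proof -
  have y: "y \<in> ObV" and \<iota>: "\<And>i. i \<in> J \<Longrightarrow> \<iota> i \<in> homV x y"
    using cop by (simp_all add: is_copower_def)
  interpret T: Bifunctor "mcat V" "mcat V" "mcat V" "tens V" by unfold_locales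
  show ?thesis
  proof (rule is_copower_cong[OF is_copower_iso[OF tens.B.category_axioms right braid_iso[OF m x] braid_iso[OF y m]]])
    fix i assume i: "i \<in> J"
    have b: "braid V m x \<in> homV (m \<otimes> x) (x \<otimes> m)" "braid V x m \<in> homV (x \<otimes> m) (m \<otimes> x)"
      "braid V y m \<in> homV (y \<otimes> m) (m \<otimes> y)"
      using braid_iso[OF m x] braid_iso[OF x m] braid_iso[OF y m] by (simp_all add: is_iso_def)
    have "braid V y m \<bullet> ((\<iota> i \<otimes>\<^sub>a idV m) \<bullet> braid V m x) = braid V y m \<bullet> (\<iota> i \<otimes>\<^sub>a idV m) \<bullet> braid V m x"
      using b \<iota>[OF i] m by (simp add: hom_iff tens.B.assoc_Comp)
    also have "\<dots> = (idV m \<otimes>\<^sub>a \<iota> i) \<bullet> braid V x m \<bullet> braid V m x"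
      using braid_natural[OF \<iota>[OF i] tens.B.Ide_in[OF m]] by simp
    also have "\<dots> = idV m \<otimes>\<^sub>a \<iota> i"
      using b \<iota>[OF i] m symmetry[OF m x] by (simp add: hom_iff tens.B.assoc_Comp)
    finally show "braid V y m \<bullet> ((\<iota> i \<otimes>\<^sub>a idV m) \<bullet> braid V m x) = idV m \<otimes>\<^sub>a \<iota> i" .
  qed
qed

theorem theorem5p1:
  fixes K :: "('s, 's) cat"
    and V :: "('o, 'a) monoidal"
    and C :: "('p, 'b) cat"
  assumes "infinite (UNIV :: 's set)"
    and "category K"
    and "closed_symmetric_monoidal V"
    and "bicomplete TYPE('s) (mcat V)"
    and "closed_module V C act \<alpha> l cot en"
    and "bicomplete TYPE('s) C"
  shows "closed_symmetric_monoidal (fun_monoidal K V) \<and>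
    closed_module (fun_monoidal K V) (fun_cat K C)
      (pointwise K act) (fun_\<alpha> K V act \<alpha>) (fun_l K V act l)
      (fun_cot K V C cot) (fun_Hom K V C act en)"
proof -
  interpret K: category K by fact
  interpret V: closed_symmetric_monoidal V by fact
  interpret C: closed_module V C act \<alpha> l cot en by fact
  interpret copowers_of_unit K V
    by unfold_locales (use assms(4) in \<open>simp add: bicomplete_def\<close>)
  interpret self: module_cat V "mcat V" "tens V" "assoc V" "lunit V"
    by (rule V.module_over_itself)
  obtain hom \<phi>\<^sub>V where hom: "Functor (op (mcat V) \<times>\<^sub>C mcat V) (mcat V) hom"
    and \<phi>\<^sub>V: "natural_bij (mcat V) (mcat V) (mcat V) (tens V) hom \<phi>\<^sub>V"
    using V.closed by (auto simp: natural_bij_TH_iff)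
  obtain \<phi> \<psi> where \<phi>: "natural_bij (mcat V) C C act en \<phi>"
    and \<psi>: "natural_bij_HP (mcat V) C en cot \<psi>"
    using C.adjunctions by (auto simp: natural_bij_TH_iff)
  have V: "category (mcat V)" and C: "category C" by unfold_locales
  have tens: "Bifunctor (mcat V) (mcat V) (mcat V) (tens V)" by unfold_locales
  have act: "Bifunctor (mcat V) C C act" by unfold_locales
  have hom': "Hom_bifunctor (mcat V) (mcat V) (mcat V) hom"
    by (rule Hom_bifunctorI[OF V V hom])
  have en: "Hom_bifunctor C C (mcat V) en"
    by (rule Hom_bifunctorI[OF C C C.en.Functor_axioms])
  have cot: "Hom_bifunctor (mcat V) C C cot"
    by (rule Hom_bifunctorI[OF V C C.cot.Functor_axioms])
  note \<chi> = natural_bij_swap[OF \<phi> \<psi> act]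
  have tens_copower: "is_copower (mcat V) J (OM (tens V) (m, x)) (OM (tens V) (m, y))
      (\<lambda>i. AM (tens V) (Ide (mcat V) m, \<iota> i))"
    if "m \<in> Ob (mcat V)" "is_copower (mcat V) J x y \<iota>" "x \<in> Ob (mcat V)" for m x y \<iota> and J :: "'s set"
    using left_adjoint_bifunctor_preserves_copower[OF tens hom' \<phi>\<^sub>V that(2,3,1)] that
    by (intro V.tens_left_preserves_copower)
  have act_copower: "is_copower C J (OM act (m, x)) (OM act (m, y)) (\<lambda>i. AM act (Ide (mcat V) m, \<iota> i))"
    if "m \<in> Ob (mcat V)" "is_copower C J x y \<iota>" "x \<in> Ob C" for m x y \<iota> and J :: "'s set"
    using left_adjoint_bifunctor_preserves_copower[OF Bifunctor_swap[OF act] cot \<chi> that(2,3,1)] by simp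
  have act_copower_left: "is_copower C J (OM act (x, c)) (OM act (y, c)) (\<lambda>i. AM act (\<iota> i, Ide C c))"
    if "c \<in> Ob C" "is_copower (mcat V) J x y \<iota>" "x \<in> Ob (mcat V)" for c x y \<iota> and J :: "'s set"
    by (rule left_adjoint_bifunctor_preserves_copower[OF act en \<phi> that(2,3,1)])
  have complete: "complete TYPE('s) (mcat V)" "complete TYPE('s) C"
    using assms(4,6) by (simp_all add: bicomplete_def)
  \<comment> \<open>\<open>V\<close> acting on itself: the functor \<open>Hom\<close> is then the internal hom of \<open>V\<^sup>K\<close>.\<close>
  interpret self: enriched_module_diagrams K V "mcat V" "tens V" "assoc V" "lunit V" hom \<phi>\<^sub>V
    by (intro enriched_module_diagrams.intro enriched_module_diagrams_axioms.intro module_diagrams.intro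
      self.module_cat_axioms K.category_axioms copowers_of_unit_axioms hom' assms(1) complete \<phi>\<^sub>V tens_copower)
  interpret H: enriched_module_diagrams K V C act \<alpha> l en \<phi>
    by (intro enriched_module_diagrams.intro enriched_module_diagrams_axioms.intro module_diagrams.intro
      C.module_cat_axioms K.category_axioms copowers_of_unit_axioms en assms(1) complete \<phi> act_copower)
  interpret P: cotensored_module_diagrams K V C act \<alpha> l cot "\<lambda>c m d u. \<psi> m c d (\<phi> m c d u)"
    by (intro cotensored_module_diagrams.intro cotensored_module_diagrams_axioms.intro module_diagrams.intro
      C.module_cat_axioms K.category_axioms copowers_of_unit_axioms cot assms(1) complete \<chi>
      tens_copower act_copower_left)
  let ?VK = "fun_cat K (mcat V)" and ?CK = "fun_cat K C"
  have "closed_symmetric_monoidal (fun_monoidal K V)"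
    unfolding closed_symmetric_monoidal_def closed_symmetric_monoidal_axioms_def fun_monoidal_simps
    using symmetric_monoidal_fun_monoidal self.Functor_fun_Hom self.natural_bij_fun_Hom
    by (auto simp: natural_bij_TH_iff)
  moreover have "closed_module (fun_monoidal K V) ?CK
      (pointwise K act) (fun_\<alpha> K V act \<alpha>) (fun_l K V act l) (fun_cot K V C cot) (fun_Hom K V C act en)"
  proof (intro closed_module.intro closed_module_axioms.intro; (unfold fun_monoidal_simps(1))?)
    show "module_cat (fun_monoidal K V) ?CK (pointwise K act) (fun_\<alpha> K V act \<alpha>) (fun_l K V act l)"
      by (rule H.module_cat_fun_cat)
    show "Functor (op ?VK \<times>\<^sub>C ?CK) ?CK (fun_cot K V C cot)" by (rule P.Functor_fun_cot)
    show "Functor (op ?CK \<times>\<^sub>C ?CK) ?VK (fun_Hom K V C act en)" by (rule H.Functor_fun_Hom)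
    have "Bifunctor ?VK ?CK ?CK (pointwise K act)"
      by (rule BifunctorI[OF T.KA.category_fun_cat H.A.KB.category_fun_cat H.A.Functor_pointwise])
    from natural_bij_HP_of_natural_bij[OF this H.natural_bij_fun_Hom P.natural_bij_fun_cot]
    show "\<exists>\<phi> \<psi>. natural_bij_TH ?VK ?CK (pointwise K act) (fun_Hom K V C act en) \<phi> \<and>
      natural_bij_HP ?VK ?CK (fun_Hom K V C act en) (fun_cot K V C cot) \<psi>"
      using H.natural_bij_fun_Hom by (auto simp: natural_bij_TH_iff)
  qed
  ultimately show ?thesis by blast
qed

end
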